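(* In each of the two settings described in the context: for all $(y,z)\in\mathcal A^2$, there exists $p_0\in\mathbb N$ such that for all integers $p>p_0$, the return trajectory subgroup $H^p(y,z)$ is Zariski dense in $\mathbf G$.
   Context: $\mathbb N=\{1,2,\dots\}$. $\mathbb H^n$ is the upper half space with boundary $\mathbb R^{n-1}\cup\{\infty\}$. Schottky semigroup setting. $n\ge2$; $\mathbf G=\mathrm{SO}_Q<\mathrm{GL}_{n+1}$ over $\mathbb Q$ preserves $Q=x_1^2+\dots+x_n^2-x_{n+1}^2$; $G=\mathbf G(\mathbb R)^\circ$ is the group of orientation preserving isometries of $\mathbb H^n$. $N_0\in\mathbb N$, $0\le N_1\le N_0$, $N=N_0+N_1$, $D_1,\dots,D_{2N_0}\subset\mathbb R^{n-1}$ are mutually disjoint closed Euclidean balls; $\Gamma<G$ is a Zariski dense semigroup generated by hyperbolic elements $g_1,\dots,g_N$ with $g_j(\operatorname{ext}(D_{j+N_0}))=\operatorname{int}(D_j)$ for $1\le j\le N_0$ and $g_{N_0+j}=g_j^{-1}$ for $1\le j\le N_1$. (The paper also assumes that the $g_j$ lift to integral points $\tilde g_j\in\tilde{\mathbf G}(\mathbb Z)$ of the simply connected cover $\tilde{\mathbf G}$ of $\mathbf G$.) Continued fractions semigroup setting. $n=3$, $\mathbf G=\mathrm{SL}_2$, $G=\mathrm{SL}_2(\mathbb C)$; $\mathsf A\subset\mathbb N+i\mathbb Z$ finite, $\mathsf A\not\subset\mathbb N$; $g_{a,a'}=\begin{pmatrix}0&1\\1&a\end{pmatrix}\begin{pmatrix}0&1\\1&a'\end{pmatrix}$.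 $\Gamma<G$ is the semigroup generated by $\{g_{a,a'}:a,a'\in\mathsf A\}$, assumed Zariski dense in $G$. With $N=(\#\mathsf A)^2$, relabel these generators as $g_1,\dots,g_N$. $\mathcal A=\{1,\dots,N\}$. A finite sequence in $\mathcal A$ is admissible if any two consecutive entries $\alpha,\beta$ satisfy $|\alpha-\beta|\ne N_0$ (Schottky setting), resp. with no condition (continued fractions setting). For $p\in\mathbb N$ and $(y,z)\in\mathcal A^2$, the return trajectory subgroup $H^p(y,z)$ is the subgroup of the group $\langle\Gamma\rangle$ generated by all elements $$g_{\alpha_1}g_{\alpha_2}\cdots g_{\alpha_p}\;g_{\beta_p}^{-1}g_{\beta_{p-1}}^{-1}\cdots g_{\beta_1}^{-1}$$ over all pairs of admissible sequences $(y,\alpha_p,\alpha_{p-1},\dots,\alpha_1,z)$ and $(y,\beta_p,\beta_{p-1},\dots,\beta_1,z)$. *)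

theory Defs
  imports "HOL-Analysis.Analysis" "HOL-Algebra.Generated_Groups"
begin

section \<open>Zariski topology on spaces of matrices\<close>

text \<open>Polynomial functions of the matrix entries, with coefficients in a subring \<open>K\<close>.\<close>

inductive_set mpoly_funs :: "'a::comm_ring_1 set \<Rightarrow> ('a^'n^'m \<Rightarrow> 'a) set"
  for K :: "'a set" where
  const: "c \<in> K \<Longrightarrow> (\<lambda>A. c) \<in> mpoly_funs K"
| entry: "(\<lambda>A. A $ i $ j) \<in> mpoly_funs K"
| add: "f \<in> mpoly_funs K \<Longrightarrow> h \<in> mpoly_funs K \<Longrightarrow> (\<lambda>A. f A + h A) \<in> mpoly_funs K"
| mult: "f \<in> mpoly_funs K \<Longrightarrow> h \<in> mpoly_funs K \<Longrightarrow> (\<lambda>A. f A * h A) \<in> mpoly_funs K"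

definition zariski_closed_over :: "complex set \<Rightarrow> (complex^'n^'m) set \<Rightarrow> bool" where
  "zariski_closed_over K S \<longleftrightarrow> (\<exists>F\<subseteq>mpoly_funs K. S = {A. \<forall>f\<in>F. f A = 0})"

text \<open>An algebraic group is identified with its set \<open>X\<close> of complex points. Both groups
  in which density is considered (\<open>SO_Q\<close> and \<open>SL2\<close>) are closed in the space of all square
  matrices, so the closure may be taken there.\<close>

definition zariski_dense_in :: "(complex^'n^'m) set \<Rightarrow> (complex^'n^'m) set \<Rightarrow> bool" where
  "zariski_dense_in H X \<longleftrightarrow> H \<subseteq> X \<and> zariski_closed_over UNIV hull H = X"


section \<open>Matrix groups and semigroups\<close>

definition GL :: "('a::field^'n^'n) monoid" where
  "GL = \<lparr>carrier = {A. invertible A}, mult = (**), one = mat 1\<rparr>"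

inductive_set semigroup_gen :: "('a::semiring_1^'n^'n) set \<Rightarrow> ('a^'n^'n) set"
  for S :: "('a^'n^'n) set" where
  gen: "A \<in> S \<Longrightarrow> A \<in> semigroup_gen S"
| prod: "A \<in> semigroup_gen S \<Longrightarrow> B \<in> semigroup_gen S \<Longrightarrow> A ** B \<in> semigroup_gen S"

abbreviation complexify :: "real^'n^'m \<Rightarrow> complex^'n^'m" where
  "complexify \<equiv> map_matrix complex_of_real"


section \<open>The orthogonal group and its action on the boundary\<close>

text \<open>With \<open>CARD('d) = n - 1\<close>, the index type \<open>'d option option\<close> has \<open>n + 1\<close> elements.
  The index \<open>None\<close> is the coordinate of negative sign \<open>x\<^sub>n\<^sub>+\<^sub>1\<close>, \<open>Some None\<close> is \<open>x\<^sub>n\<close>, and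
  \<open>Some (Some i)\<close> are \<open>x\<^sub>1, \<dots>, x\<^sub>n\<^sub>-\<^sub>1\<close>.  As types are nonempty, \<open>n \<ge> 2\<close> is automatic.\<close>

definition Q :: "'a::comm_ring_1^('e::finite option) \<Rightarrow> 'a" where
  "Q v = (\<Sum>i\<in>UNIV. (v $ Some i)\<^sup>2) - (v $ None)\<^sup>2"

definition SO_Q :: "('a::comm_ring_1^('e::finite option)^('e option)) set" where
  "SO_Q = {A. (\<forall>v. Q (A *v v) = Q v) \<and> det A = 1}"

definition SO_Q_0 :: "(real^('e::finite option)^('e option)) set" where
  "SO_Q_0 = connected_component_set SO_Q (mat 1)"

text \<open>The point \<open>(x, t)\<close>, \<open>t > 0\<close>, of the upper half space corresponds to the point
  \<open>half_space_vec x t / (2 t)\<close> of the hyperboloid \<open>Q = -1\<close>, \<open>x\<^sub>n\<^sub>+\<^sub>1 > 0\<close>; this is an isometry.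
  Its extension to the boundary sends \<open>x\<close> to the isotropic line through
  \<open>half_space_vec x 0\<close>, and \<open>\<infinity>\<close> (encoded as \<open>None\<close>) to the line through the limit of
  \<open>half_space_vec x 0 / norm x ^ 2\<close>.\<close>

definition half_space_vec :: "real^'d \<Rightarrow> real \<Rightarrow> real^('d option option)" where
  "half_space_vec x t = (\<chi> k. case k of
      None \<Rightarrow> (norm x)\<^sup>2 + t\<^sup>2 + 1
    | Some None \<Rightarrow> (norm x)\<^sup>2 + t\<^sup>2 - 1
    | Some (Some i) \<Rightarrow> 2 * x $ i)"

fun boundary_vec :: "(real^'d) option \<Rightarrow> real^('d option option)" where
  "boundary_vec (Some x) = half_space_vec x 0"
| "boundary_vec None = (\<chi> k. case k of None \<Rightarrow> 1 | Some None \<Rightarrow> 1 | Some (Some i) \<Rightarrow> 0)"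

definition boundary_act ::
    "real^('d option option)^('d option option) \<Rightarrow> (real^'d) option \<Rightarrow> (real^'d) option" where
  "boundary_act g \<xi> = (THE \<eta>. \<exists>c. c \<noteq> 0 \<and> g *v boundary_vec \<xi> = c *\<^sub>R boundary_vec \<eta>)"

text \<open>No fixed point in hyperbolic space (linearity makes the factor \<open>2 t\<close> irrelevant) and
  exactly two on its boundary. Rotation about the axis is allowed.\<close>

definition hyperbolic_element :: "real^('d option option)^('d::finite option option) \<Rightarrow> bool" where
  "hyperbolic_element g \<longleftrightarrow> g \<in> SO_Q_0 \<and>
     \<not> (\<exists>x t. t > 0 \<and> g *v half_space_vec x t = half_space_vec x t) \<and>
     card {\<xi>. boundary_act g \<xi> = \<xi>} = 2"

text \<open>Interior and exterior as subsets of the sphere at infinity; the exterior contains \<open>\<infinity>\<close>.\<close>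

definition int_ball :: "(real^'d) set \<Rightarrow> (real^'d) option set" where
  "int_ball B = Some ` interior B"

definition ext_ball :: "(real^'d) set \<Rightarrow> (real^'d) option set" where
  "ext_ball B = - (Some ` B)"


section \<open>The two settings\<close>

text \<open>The simply connected cover of \<open>SO_Q\<close>, as a matrix group over \<open>\<rat>\<close> with a central isogeny
  over \<open>\<rat>\<close>. For complex semisimple groups, algebraic and topological simple
  connectedness agree. Such a group consists of matrices of determinant 1, so it is
  closed in the space of all matrices, and regular functions on it are polynomials in the entries.\<close>

definition simply_connected_cover ::
    "(complex^'m^'m) set \<Rightarrow> (complex^'m^'m \<Rightarrow> complex^('e::finite option)^('e option)) \<Rightarrow> bool" where
  "simply_connected_cover Gt \<pi> \<longleftrightarrow>
     subgroup Gt GL \<and> zariski_closed_over \<rat> Gt \<and> simply_connected Gt \<and>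
     (\<forall>i j. (\<lambda>A. \<pi> A $ i $ j) \<in> mpoly_funs \<rat>) \<and>
     (\<forall>A\<in>Gt. \<forall>B\<in>Gt. \<pi> (A ** B) = \<pi> A ** \<pi> B) \<and>
     \<pi> ` Gt = SO_Q \<and> finite {A \<in> Gt. \<pi> A = mat 1}"

locale schottky_setting =
  fixes N\<^sub>0 N\<^sub>1 :: nat
    and D :: "nat \<Rightarrow> (real^'d::finite) set"
    and g :: "nat \<Rightarrow> real^('d option option)^('d option option)"
    and Gt :: "(complex^'m^'m) set"
    and \<pi> :: "complex^'m^'m \<Rightarrow> complex^('d option option)^('d option option)"
    and gt :: "nat \<Rightarrow> complex^'m^'m"
  assumes N\<^sub>0_pos: "1 \<le> N\<^sub>0"
    and N\<^sub>1_le: "N\<^sub>1 \<le> N\<^sub>0"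
    and balls: "\<And>j. j \<in> {1..2 * N\<^sub>0} \<Longrightarrow> \<exists>c r. 0 < r \<and> D j = cball c r"
    and balls_disjoint: "disjoint_family_on D {1..2 * N\<^sub>0}"
    and hyperbolic: "\<And>j. j \<in> {1..N\<^sub>0 + N\<^sub>1} \<Longrightarrow> hyperbolic_element (g j)"
    and ping_pong: "\<And>j. j \<in> {1..N\<^sub>0} \<Longrightarrow>
          boundary_act (g j) ` ext_ball (D (j + N\<^sub>0)) = int_ball (D j)"
    and inverses: "\<And>j. j \<in> {1..N\<^sub>1} \<Longrightarrow> g (N\<^sub>0 + j) = matrix_inv (g j)"
    and dense: "zariski_dense_in (complexify ` semigroup_gen (g ` {1..N\<^sub>0 + N\<^sub>1})) SO_Q"
    and cover: "simply_connected_cover Gt \<pi>"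
    and integral_lifts: "\<And>j. j \<in> {1..N\<^sub>0 + N\<^sub>1} \<Longrightarrow>
          gt j \<in> Gt \<and> (\<forall>k l. gt j $ k $ l \<in> \<int>) \<and> \<pi> (gt j) = complexify (g j)"

definition SL2 :: "(complex^2^2) set" where
  "SL2 = {A. det A = 1}"

definition cf_matrix :: "complex \<Rightarrow> complex^2^2" where
  "cf_matrix a = vector [vector [0, 1], vector [1, a]]"

text \<open>\<open>e\<close> is the relabelling of the generators by \<open>1, \<dots>, N\<close>.\<close>

locale continued_fractions_setting =
  fixes S :: "complex set"
    and N :: nat
    and e :: "nat \<Rightarrow> complex \<times> complex"
    and g :: "nat \<Rightarrow> complex^2^2"
  assumes finite_S: "finite S"
    and S_gaussian: "S \<subseteq> {of_nat m + \<i> * of_int k |m k. 1 \<le> m}"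
    and S_not_real: "\<not> S \<subseteq> {of_nat m |m. 1 \<le> m}"
    and N_eq: "N = (card S)\<^sup>2"
    and relabel: "bij_betw e {1..N} (S \<times> S)"
    and generators: "\<And>j. j \<in> {1..N} \<Longrightarrow> g j = cf_matrix (fst (e j)) ** cf_matrix (snd (e j))"
    and dense: "zariski_dense_in (semigroup_gen (g ` {1..N})) SL2"


section \<open>Return trajectory subgroups\<close>

text \<open>Admissibility of words in \<open>{1..N}\<close>, relative to the relation \<open>R\<close> allowed between
  consecutive letters.\<close>

definition admissible :: "nat \<Rightarrow> (nat \<Rightarrow> nat \<Rightarrow> bool) \<Rightarrow> nat list \<Rightarrow> bool" where
  "admissible N R w \<longleftrightarrow> set w \<subseteq> {1..N} \<and> successively R w"

definition schottky_rel :: "nat \<Rightarrow> nat \<Rightarrow> nat \<Rightarrow> bool" where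
  "schottky_rel N\<^sub>0 a b \<longleftrightarrow> \<bar>int a - int b\<bar> \<noteq> int N\<^sub>0"

definition free_rel :: "nat \<Rightarrow> nat \<Rightarrow> bool" where
  "free_rel a b \<longleftrightarrow> True"

definition mat_prod :: "('a::semiring_1^'n^'n) list \<Rightarrow> 'a^'n^'n" where
  "mat_prod Ms = foldr (**) Ms (mat 1)"

text \<open>The lists \<open>as = [\<alpha>\<^sub>1, \<dots>, \<alpha>\<^sub>p]\<close> and \<open>bs = [\<beta>\<^sub>1, \<dots>, \<beta>\<^sub>p]\<close> are in the order in which they
  occur in the products, hence reversed in the trajectories. The subgroup they generate in
  \<open>GL\<close> is the one they generate in the group \<open>\<langle>\<Gamma>\<rangle>\<close>.\<close>

definition return_trajectory_subgroup ::
    "nat \<Rightarrow> (nat \<Rightarrow> nat \<Rightarrow> bool) \<Rightarrow> (nat \<Rightarrow> 'a::field^'n^'n) \<Rightarrow> nat \<Rightarrow> nat \<Rightarrow> nat \<Rightarrow> ('a^'n^'n) set" where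
  "return_trajectory_subgroup N R g p y z =
     generate GL
       {mat_prod (map g as) ** mat_prod (map (\<lambda>b. matrix_inv (g b)) (rev bs)) | as bs.
          length as = p \<and> length bs = p \<and>
          admissible N R (y # rev as @ [z]) \<and> admissible N R (y # rev bs @ [z])}"

end

theory Submission
  imports Defs "HOL-Computational_Algebra.Polynomial"
begin

text \<open>Schottky setting, over \<open>\<real>\<close>: let \<open>T\<^sup>p(y,z)\<close> be the tangent space at \<open>1\<close> of the Zariski closure
  of \<open>H\<^sup>p(y,z)\<close>. Appending \<open>y\<close> to a word shows that \<open>T\<^sup>p(y,z) \<subseteq> T\<^sup>p\<^sup>+\<^sup>1(y',z)\<close> for admissible \<open>y' y\<close>, and
  prepending \<open>z\<close> that \<open>Ad(g\<^sub>z) T\<^sup>p(y,z) \<subseteq> T\<^sup>p\<^sup>+\<^sup>1(y,z')\<close> for admissible \<open>z z'\<close>. By finite dimensionality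
  the spaces stabilise as \<open>p\<close> grows, and as any two letters are joined by an admissible path of
  length two, to one space \<open>T\<close> independent of \<open>y\<close> and \<open>z\<close>. It is invariant under \<open>Ad(\<Gamma>)\<close>, hence
  under \<open>Ad(SO\<^sub>Q)\<close>, and nonzero, as ping-pong shows that \<open>g\<^sub>1 g\<^sub>2\<^sup>-\<^sup>1 \<in> H\<^sup>1(1,1)\<close> has infinite order. By
  irreducibility over \<open>\<real>\<close> it is the whole Lie algebra, which forces \<open>H\<^sup>p(y,z)\<close> to be dense.

  Continued fractions setting: \<open>g\<^sub>a\<^sub>,\<^sub>b\<close> is the product of a lower and an upper unipotent matrix with
  parameters \<open>a\<close> and \<open>b\<close>, so the quotients \<open>g\<^sub>i g\<^sub>j\<^sup>-\<^sup>1\<close> already yield all unipotent matrices in the closure.\<close>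

section \<open>Polynomial functions and Zariski closures\<close>

text \<open>What makes the argument run is dimension: prepending \<open>z\<close> compares the
  groups only up to conjugation by \<open>g z\<close>, but a linear injection of a
  finite-dimensional space into itself is onto, so for tangent spaces the twist disappears. The real
  field matters for irreducibility: for n = 3 the complex Lie algebra so(4) is a sum of two ideals,
  so a nonzero invariant complex subspace could be proper. The price is a passage between real and
  complex points.

  The two links between group and Lie algebra are proved by polynomial algebra instead of Lie
  theory. A group with zero tangent space is finite by Nakayama's lemma. If the tangent space is
  everything, equations of the group vanish to infinite order at the identity along curves in
  \<open>SO_Q\<close>; Cayley curves replace exponentials because they are rational, so that
  infinite order already means identically zero. This reaches the identity component only, which is
  enough as the generators lie in it.\<close>

abbreviation mpolys :: "('a::comm_ring_1^'n^'m \<Rightarrow> 'a) set" where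
  "mpolys \<equiv> mpoly_funs UNIV"

lemma mpolys_const [simp]: "(\<lambda>A. c) \<in> mpolys"
  by (rule mpoly_funs.const) simp

lemmas mpolys_entry [simp] = mpoly_funs.entry[where K=UNIV]
lemmas mpolys_add = mpoly_funs.add[where K=UNIV]
lemmas mpolys_mult = mpoly_funs.mult[where K=UNIV]

lemma mpolys_minus:
  assumes "f \<in> mpolys" "h \<in> mpolys" shows "(\<lambda>A. f A - h A) \<in> mpolys"
proof -
  have "(\<lambda>A. f A + (-1) * h A) \<in> mpolys"
    by (intro mpolys_add mpolys_mult mpolys_const assms)
  then show ?thesis by simp
qed

lemma mpolys_sum:
  "(\<And>i. i \<in> I \<Longrightarrow> f i \<in> mpolys) \<Longrightarrow> (\<lambda>A. \<Sum>i\<in>I. f i A) \<in> mpolys"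
proof (induction I rule: infinite_finite_induct)
  case (insert i I)
  then have "(\<lambda>A. f i A + (\<Sum>i\<in>I. f i A)) \<in> mpolys"
    by (intro mpolys_add) simp_all
  then show ?case using insert by simp
qed simp_all

lemma mpolys_prod:
  "(\<And>i. i \<in> I \<Longrightarrow> f i \<in> mpolys) \<Longrightarrow> (\<lambda>A. \<Prod>i\<in>I. f i A) \<in> mpolys"
proof (induction I rule: infinite_finite_induct)
  case (insert i I)
  then have "(\<lambda>A. f i A * (\<Prod>i\<in>I. f i A)) \<in> mpolys"
    by (intro mpolys_mult) simp_all
  then show ?case using insert by simp
qed simp_all

lemma mpolys_compose:
  assumes "f \<in> mpolys" "\<And>i j. (\<lambda>A. \<phi> A $ i $ j) \<in> mpolys"
  shows "(\<lambda>A. f (\<phi> A)) \<in> mpolys"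
  using assms by induction (simp_all add: mpolys_add mpolys_mult)

lemma mpolys_mat_mult:
  assumes "\<And>i j. (\<lambda>A. \<phi> A $ i $ j) \<in> mpolys" "\<And>i j. (\<lambda>A. \<psi> A $ i $ j) \<in> mpolys"
  shows "(\<lambda>A. (\<phi> A ** \<psi> A) $ i $ j) \<in> mpolys"
  unfolding matrix_matrix_mult_def by (simp add: assms mpolys_sum mpolys_mult)

lemma mpolys_det:
  assumes "\<And>i j. (\<lambda>A. \<phi> A $ i $ j) \<in> mpolys"
  shows "(\<lambda>A. det (\<phi> A)) \<in> mpolys"
  unfolding det_def by (intro mpolys_sum mpolys_mult mpolys_prod mpolys_const assms)

definition vanishing :: "('a::comm_ring_1^'n^'m) set \<Rightarrow> ('a^'n^'m \<Rightarrow> 'a) set" where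
  "vanishing H = {f \<in> mpolys. \<forall>x\<in>H. f x = 0}"

text \<open>Defined over an arbitrary commutative ring so that closures over the reals, where the
  tangent spaces live, can stand beside the complex closures that define density.\<close>

definition zariski_closure :: "('a::comm_ring_1^'n^'m) set \<Rightarrow> ('a^'n^'m) set" where
  "zariski_closure H = {x. \<forall>f\<in>vanishing H. f x = 0}"

lemma vanishingI: "f \<in> mpolys \<Longrightarrow> (\<And>x. x \<in> H \<Longrightarrow> f x = 0) \<Longrightarrow> f \<in> vanishing H"
  by (simp add: vanishing_def)

lemma vanishingD: "f \<in> vanishing H \<Longrightarrow> x \<in> H \<Longrightarrow> f x = 0"
  by (simp add: vanishing_def)

lemma vanishing_mpolys: "f \<in> vanishing H \<Longrightarrow> f \<in> mpolys"
  by (simp add: vanishing_def)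

lemma vanishing_antimono: "H \<subseteq> K \<Longrightarrow> vanishing K \<subseteq> vanishing H"
  by (auto simp: vanishing_def)

lemma zariski_closure_subset: "H \<subseteq> zariski_closure H"
  by (auto simp: zariski_closure_def vanishing_def)

lemma zariski_hull_eq_closure: "zariski_closed_over UNIV hull H = zariski_closure H"
proof (rule hull_unique)
  show "H \<subseteq> zariski_closure H" by (rule zariski_closure_subset)
  show "zariski_closed_over UNIV (zariski_closure H)"
    unfolding zariski_closed_over_def
    by (rule exI[of _ "vanishing H"]) (auto simp: zariski_closure_def vanishing_def)
  fix S assume S: "H \<subseteq> S" "zariski_closed_over UNIV S"
  then obtain F where F: "F \<subseteq> mpolys" "S = {A. \<forall>f\<in>F. f A = 0}"
    by (auto simp: zariski_closed_over_def)
  then have "F \<subseteq> vanishing H" using S by (auto simp: vanishing_def)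
  then show "zariski_closure H \<subseteq> S" using F by (auto simp: zariski_closure_def)
qed

lemma zariski_dense_in_iff:
  "zariski_dense_in H X \<longleftrightarrow> H \<subseteq> X \<and> zariski_closure H = X"
  by (simp add: zariski_dense_in_def zariski_hull_eq_closure)

lemma zariski_closure_mono: "H \<subseteq> K \<Longrightarrow> zariski_closure H \<subseteq> zariski_closure K"
  unfolding zariski_closure_def using vanishing_antimono[of H K] by blast

lemma vanishing_zariski_closure: "vanishing (zariski_closure H) = vanishing H"
  unfolding vanishing_def[of "zariski_closure H"] zariski_closure_def
  by (auto simp: vanishing_def)

lemma zariski_closure_idem: "zariski_closure (zariski_closure H) = zariski_closure H"
  unfolding zariski_closure_def[of "zariski_closure H"] vanishing_zariski_closure
  by (rule zariski_closure_def[symmetric])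

text \<open>Both settings use this with \<open>G\<close> the given dense semigroup: it then suffices
  to find its elements in the closure of \<open>H\<close>.\<close>

lemma zariski_dense_in_trans:
  assumes "zariski_dense_in G X" "H \<subseteq> X" "G \<subseteq> zariski_closure H"
  shows "zariski_dense_in H X"
proof -
  have X: "zariski_closure G = X" and cl: "zariski_closure X = X"
    using assms(1) zariski_closure_idem[of G] by (auto simp: zariski_dense_in_iff)
  have "zariski_closure H \<subseteq> X"
    using zariski_closure_mono[OF assms(2)] cl by simp
  moreover have "X \<subseteq> zariski_closure H"
    using zariski_closure_mono[OF assms(3)] X by (simp add: zariski_closure_idem)
  ultimately show ?thesis using assms by (simp add: zariski_dense_in_iff)
qed

lemma mpolys_translate:
  fixes f :: "'a::comm_ring_1^'n^'n \<Rightarrow> 'a"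
  assumes "f \<in> mpolys"
  shows "(\<lambda>y. f (x ** y)) \<in> mpolys" "(\<lambda>y. f (y ** x)) \<in> mpolys"
  by (rule mpolys_compose[OF assms], rule mpolys_mat_mult; simp)+

text \<open>Two passes: a fixed left factor in \<open>H\<close> permits any right factor in the
  closure, and then, with that right factor fixed, the left factor moves to the closure too.\<close>

lemma zariski_closure_mult:
  fixes H :: "('a::comm_ring_1^'n^'n) set"
  assumes mult: "\<And>x y. x \<in> H \<Longrightarrow> y \<in> H \<Longrightarrow> x ** y \<in> H"
    and "x \<in> zariski_closure H" "y \<in> zariski_closure H"
  shows "x ** y \<in> zariski_closure H"
proof -
  have 1: "h ** y \<in> zariski_closure H" if "h \<in> H" for h
  proof -
    have "(\<lambda>y. f (h ** y)) \<in> vanishing H" if "f \<in> vanishing H" for f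
      using that \<open>h \<in> H\<close> mult by (auto simp: vanishing_def mpolys_translate)
    then show ?thesis using assms(3) by (auto simp: zariski_closure_def)
  qed
  have "(\<lambda>x. f (x ** y)) \<in> vanishing H" if "f \<in> vanishing H" for f
    using that 1 by (auto simp: vanishing_def zariski_closure_def mpolys_translate)
  then show ?thesis using assms(2) by (auto simp: zariski_closure_def)
qed

text \<open>A polynomial of degree \<open>d\<close> in entries with common denominator
  \<open>q\<close> has denominator \<open>q ^ d\<close>. Denominators are multiplied out to avoid
  division, and the identity is asked only on \<open>S\<close>, later the set where \<open>q\<close>
  does not vanish.\<close>

lemma mpolys_rational_curve:
  fixes f :: "'a::comm_ring_1^'n^'m \<Rightarrow> 'a"
  assumes "f \<in> mpolys"
    and entries: "\<And>i j. \<exists>p. \<forall>t\<in>S. poly q t * M t $ i $ j = poly p t"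
  shows "\<exists>d p. \<forall>t\<in>S. poly q t ^ d * f (M t) = poly p t"
  using assms(1)
proof (induction rule: mpoly_funs.induct)
  case (const c)
  show ?case by (rule exI[of _ 0], rule exI[of _ "[:c:]"]) simp
next
  case (entry i j)
  obtain p where "\<forall>t\<in>S. poly q t * M t $ i $ j = poly p t" using entries by blast
  then show ?case by (intro exI[of _ 1] exI[of _ p]) simp
next
  case (add f h)
  obtain d p where 1: "\<forall>t\<in>S. poly q t ^ d * f (M t) = poly p t" using add.IH by blast
  obtain d' p' where 2: "\<forall>t\<in>S. poly q t ^ d' * h (M t) = poly p' t" using add.IH by blast
  have "poly q t ^ (d + d') * (f (M t) + h (M t)) = poly (q ^ d' * p + q ^ d * p') t"
    if "t \<in> S" for t
    using 1[rule_format, OF that, symmetric] 2[rule_format, OF that, symmetric]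
    by (simp add: power_add algebra_simps)
  then show ?case by blast
next
  case (mult f h)
  obtain d p where 1: "\<forall>t\<in>S. poly q t ^ d * f (M t) = poly p t" using mult.IH by blast
  obtain d' p' where 2: "\<forall>t\<in>S. poly q t ^ d' * h (M t) = poly p' t" using mult.IH by blast
  have "poly q t ^ (d + d') * (f (M t) * h (M t)) = poly (p * p') t"
    if "t \<in> S" for t
    using 1[rule_format, OF that, symmetric] 2[rule_format, OF that, symmetric]
    by (simp add: power_add algebra_simps)
  then show ?case by blast
qed

lemma mpolys_polynomial_curve:
  fixes f :: "'a::comm_ring_1^'n^'m \<Rightarrow> 'a"
  assumes "f \<in> mpolys" "\<And>i j. \<exists>p. \<forall>t. M t $ i $ j = poly p t"
  shows "\<exists>p. \<forall>t. f (M t) = poly p t"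
  using mpolys_rational_curve[OF assms(1), of UNIV 1 M] assms(2) by simp

text \<open>This is the comultiplication of matrix coordinates: entries of \<open>x ** y\<close> are
  sums of products, and such sums are closed under addition and multiplication. So all translates of
  \<open>f\<close> lie in the span of finitely many functions \<open>\<phi> i\<close>. Indices are
  natural numbers to keep the index type fixed through the induction.\<close>

lemma mpolys_translates_finite_rank:
  fixes f :: "'a::comm_ring_1^'n^'n \<Rightarrow> 'a"
  assumes "f \<in> mpolys"
  shows "\<exists>(I::nat set) c \<phi>. finite I \<and> (\<forall>x y :: 'a^'n^'n. f (x ** y) = (\<Sum>i\<in>I. c i x * \<phi> i y))"
  using assms
proof (induction rule: mpoly_funs.induct)
  case (const c)
  show ?case by (rule exI[of _ "{0}"], rule exI[of _ "\<lambda>_ _. c"], rule exI[of _ "\<lambda>_ _. 1"]) simp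
next
  case (entry i j)
  obtain e :: "'n \<Rightarrow> nat" where e: "inj e"
    using finite_imp_inj_to_nat_seg[of "UNIV::'n set"] by auto
  define c where "c = (\<lambda>k (x::'a^'n^'n). x $ i $ (inv_into UNIV e k))"
  define \<phi> where "\<phi> = (\<lambda>k (y::'a^'n^'n). y $ (inv_into UNIV e k) $ j)"
  have "(x ** y) $ i $ j = (\<Sum>k\<in>range e. c k x * \<phi> k y)" for x y
    by (simp add: sum.reindex e matrix_matrix_mult_def c_def \<phi>_def)
  then show ?case
    by (intro exI[of _ "range e"] exI[of _ c] exI[of _ \<phi>]) simp
next
  case (add f h)
  obtain I c \<phi> where 1: "finite (I::nat set)" "\<forall>x y :: 'a^'n^'n. f (x ** y) = (\<Sum>i\<in>I. c i x * \<phi> i y)"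
    using add.IH by blast
  obtain I' c' \<phi>' where 2: "finite (I'::nat set)" "\<forall>x y :: 'a^'n^'n. h (x ** y) = (\<Sum>i\<in>I'. c' i x * \<phi>' i y)"
    using add.IH by blast
  \<comment> \<open>Even and odd indices encode the disjoint union of the two index sets.\<close>
  define J where "J = (\<lambda>i. 2 * i) ` I \<union> (\<lambda>i. 2 * i + 1) ` I'"
  define k where "k = (\<lambda>i x. if even i then c (i div 2) x else c' (i div 2) x)"
  define \<psi> where "\<psi> = (\<lambda>i x. if even i then \<phi> (i div 2) x else \<phi>' (i div 2) x)"
  have "(\<Sum>i\<in>J. k i x * \<psi> i y) = f (x ** y) + h (x ** y)" for x y :: "'a^'n^'n"
  proof -
    have "(\<Sum>i\<in>J. k i x * \<psi> i y)
      = (\<Sum>i\<in>(\<lambda>i. 2 * i) ` I. k i x * \<psi> i y) + (\<Sum>i\<in>(\<lambda>i. 2 * i + 1) ` I'. k i x * \<psi> i y)"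
      unfolding J_def
    proof (intro sum.union_disjoint)
      show "(\<lambda>i. 2 * i) ` I \<inter> (\<lambda>i. 2 * i + 1) ` I' = {}"
      proof -
        have "2 * i \<noteq> 2 * j + 1" for i j :: nat by presburger
        then show ?thesis by blast
      qed
    qed (use 1 2 in auto)
    also have "\<dots> = f (x ** y) + h (x ** y)"
      using 1(2) 2(2) by (simp add: sum.reindex inj_on_def k_def \<psi>_def)
    finally show ?thesis .
  qed
  moreover have "finite J" using 1(1) 2(1) by (simp add: J_def)
  ultimately show ?case by (intro exI[of _ J] exI[of _ k] exI[of _ \<psi>]) simp
next
  case (mult f h)
  obtain I c \<phi> where 1: "finite (I::nat set)" "\<forall>x y :: 'a^'n^'n. f (x ** y) = (\<Sum>i\<in>I. c i x * \<phi> i y)"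
    using mult.IH by blast
  obtain I' c' \<phi>' where 2: "finite (I'::nat set)" "\<forall>x y :: 'a^'n^'n. h (x ** y) = (\<Sum>i\<in>I'. c' i x * \<phi>' i y)"
    using mult.IH by blast
  define J where "J = prod_encode ` (I \<times> I')"
  define k where "k = (\<lambda>n x. c (fst (prod_decode n)) x * c' (snd (prod_decode n)) x)"
  define \<psi> where "\<psi> = (\<lambda>n x. \<phi> (fst (prod_decode n)) x * \<phi>' (snd (prod_decode n)) x)"
  have "(\<Sum>i\<in>J. k i x * \<psi> i y) = f (x ** y) * h (x ** y)" for x y :: "'a^'n^'n"
  proof -
    have "(\<Sum>i\<in>J. k i x * \<psi> i y)
      = (\<Sum>(i, j)\<in>I \<times> I'. (c i x * c' j x) * (\<phi> i y * \<phi>' j y))"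
      unfolding J_def
      by (simp add: sum.reindex inj_prod_encode inj_on_subset[OF inj_prod_encode] k_def \<psi>_def
          case_prod_unfold o_def)
    also have "\<dots> = f (x ** y) * h (x ** y)"
      unfolding 1(2)[rule_format] 2(2)[rule_format] sum_product sum.cartesian_product
      by (rule sum.cong) (simp_all add: case_prod_unfold mult_ac)
    finally show ?thesis .
  qed
  moreover have "finite J" using 1(1) 2(1) by (simp add: J_def)
  ultimately show ?case by (intro exI[of _ J] exI[of _ k] exI[of _ \<psi>]) simp
qed

section \<open>Matrix inverses and subgroups of the general linear group\<close>

lemma matrix_inv_unique:
  fixes A B :: "'a::field^'n^'n"
  assumes "A ** B = mat 1" shows "matrix_inv A = B"
proof -
  have "A ** matrix_inv A = mat 1 \<and> matrix_inv A ** A = mat 1"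
    unfolding matrix_inv_def
    by (rule someI[of _ B]) (use assms matrix_left_right_inverse in auto)
  then show ?thesis
    by (metis assms matrix_mul_assoc matrix_mul_lid matrix_mul_rid)
qed

lemma matrix_inv:
  fixes A :: "'a::field^'n^'n"
  assumes "invertible A"
  shows "A ** matrix_inv A = mat 1" "matrix_inv A ** A = mat 1"
  using assms matrix_inv_unique matrix_left_right_inverse unfolding invertible_def by metis+

lemma group_GL: "group (GL :: ('a::field^'n^'n) monoid)"
proof (rule groupI)
  fix x :: "'a^'n^'n" assume "x \<in> carrier GL"
  then show "\<exists>y\<in>carrier GL. y \<otimes>\<^bsub>GL\<^esub> x = \<one>\<^bsub>GL\<^esub>"
    by (auto simp: GL_def invertible_def)
next
  show "\<one>\<^bsub>GL\<^esub> \<in> carrier (GL :: ('a^'n^'n) monoid)"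
    by (auto simp: GL_def invertible_def)
qed (simp_all add: GL_def invertible_mult matrix_mul_assoc)

lemma inv_GL:
  fixes A :: "'a::field^'n^'n"
  assumes "invertible A"
  shows "inv\<^bsub>GL\<^esub> A = matrix_inv A"
proof (rule group.inv_equality[OF group_GL])
  show "matrix_inv A \<in> carrier GL"
    using matrix_inv[OF assms] by (auto simp: GL_def invertible_def)
qed (use assms in \<open>simp_all add: GL_def matrix_inv\<close>)

lemma subgroup_GL_iff:
  fixes H :: "('a::field^'n^'n) set"
  shows "subgroup H GL \<longleftrightarrow> mat 1 \<in> H \<and> (\<forall>x\<in>H. \<forall>y\<in>H. x ** y \<in> H) \<and>
     (\<forall>x\<in>H. invertible x \<and> matrix_inv x \<in> H)"
proof -
  have inv: "inv\<^bsub>GL\<^esub> x \<in> H \<longleftrightarrow> matrix_inv x \<in> H" if "invertible x" for x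
    using inv_GL[OF that] by simp
  show ?thesis
  proof
    assume "subgroup H GL"
    then interpret subgroup H "GL :: ('a^'n^'n) monoid" .
    have H: "invertible x" if "x \<in> H" for x
      using subset that by (auto simp: GL_def)
    show "mat 1 \<in> H \<and> (\<forall>x\<in>H. \<forall>y\<in>H. x ** y \<in> H) \<and> (\<forall>x\<in>H. invertible x \<and> matrix_inv x \<in> H)"
      using one_closed m_closed m_inv_closed inv H by (simp add: GL_def)
  next
    assume H: "mat 1 \<in> H \<and> (\<forall>x\<in>H. \<forall>y\<in>H. x ** y \<in> H) \<and> (\<forall>x\<in>H. invertible x \<and> matrix_inv x \<in> H)"
    then have "inv\<^bsub>GL\<^esub> x \<in> H" if "x \<in> H" for x
      using that inv by simp
    with H show "subgroup H GL"
      by unfold_locales (auto simp: GL_def)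
  qed
qed


section \<open>Tangent spaces at the identity\<close>

lemma bounded_bilinear_matrix_mult:
  "bounded_bilinear ((**) :: real^'n^'m \<Rightarrow> real^'k^'n \<Rightarrow> real^'k^'m)"
proof -
  have "bilinear ((**) :: real^'n^'m \<Rightarrow> real^'k^'n \<Rightarrow> real^'k^'m)"
    unfolding bilinear_def
    by (auto intro!: linearI simp: matrix_matrix_mult_def vec_eq_iff sum.distrib
        sum_distrib_left algebra_simps)
  then show ?thesis by (simp add: bilinear_conv_bounded_bilinear)
qed

interpretation matrix_mult: bounded_bilinear "(**) :: real^'n^'m \<Rightarrow> real^'k^'n \<Rightarrow> real^'k^'m"
  by (rule bounded_bilinear_matrix_mult)

abbreviation deriv_at :: "(real^'n^'m \<Rightarrow> real) \<Rightarrow> real^'n^'m \<Rightarrow> real^'n^'m \<Rightarrow> real" where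
  "deriv_at f x \<equiv> frechet_derivative f (at x)"

lemma has_derivative_entry: "((\<lambda>A::real^'n^'m. A $ i $ j) has_derivative (\<lambda>B. B $ i $ j)) (at x)"
  by (rule bounded_linear_imp_has_derivative)
     (rule bounded_linear_compose[OF bounded_linear_vec_nth bounded_linear_vec_nth])

lemma mpolys_has_derivative:
  assumes "f \<in> mpolys"
  shows "(f has_derivative deriv_at f x) (at x)"
proof -
  have "\<exists>f'. (f has_derivative f') (at x)"
    using assms
  proof (induction rule: mpoly_funs.induct)
    case (const c)
    then show ?case using has_derivative_const by blast
  next
    case (entry i j)
    then show ?case using has_derivative_entry by blast
  next
    case (add f h)
    then show ?case using has_derivative_add by blast
  next
    case (mult f h)
    then show ?case using has_derivative_mult by blast
  qed
  then show ?thesis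
    using frechet_derivative_works differentiable_def by blast
qed

lemma deriv_at_unique: "(f has_derivative f') (at x) \<Longrightarrow> deriv_at f x = f'"
  by (metis frechet_derivative_at)

lemma deriv_at_const: "deriv_at (\<lambda>A. c) x = (\<lambda>B. 0)"
  by (rule deriv_at_unique) (rule has_derivative_const)

lemma deriv_at_entry: "deriv_at (\<lambda>A. A $ i $ j) x = (\<lambda>B. B $ i $ j)"
  by (rule deriv_at_unique) (rule has_derivative_entry)

lemma deriv_at_add:
  "f \<in> mpolys \<Longrightarrow> h \<in> mpolys \<Longrightarrow> deriv_at (\<lambda>A. f A + h A) x = (\<lambda>B. deriv_at f x B + deriv_at h x B)"
  by (rule deriv_at_unique) (intro has_derivative_add mpolys_has_derivative)

lemma deriv_at_mult:
  "f \<in> mpolys \<Longrightarrow> h \<in> mpolys \<Longrightarrow>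
    deriv_at (\<lambda>A. f A * h A) x = (\<lambda>B. f x * deriv_at h x B + deriv_at f x B * h x)"
  by (rule deriv_at_unique) (intro has_derivative_mult mpolys_has_derivative)

lemma linear_deriv_at: "f \<in> mpolys \<Longrightarrow> linear (deriv_at f x)"
  using mpolys_has_derivative has_derivative_linear by blast

text \<open>Differentiating along a polynomial vector field \<open>\<phi>\<close> keeps polynomials
  polynomial; the case of interest is the left-invariant field \<open>x ** B\<close>.\<close>

lemma mpolys_deriv_at:
  assumes "f \<in> mpolys" "\<And>i j. (\<lambda>A. \<phi> A $ i $ j) \<in> mpolys"
  shows "(\<lambda>x. deriv_at f x (\<phi> x)) \<in> mpolys"
  using assms(1)
  by (induction rule: mpoly_funs.induct)
     (simp_all add: deriv_at_const deriv_at_entry deriv_at_add deriv_at_mult assms(2)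
        mpolys_add mpolys_mult)

lemma deriv_at_linear_comp:
  fixes L :: "real^'n^'n \<Rightarrow> real^'n^'n"
  assumes "f \<in> mpolys" "linear L"
  shows "deriv_at (\<lambda>y. f (L y)) x B = deriv_at f (L x) (L B)"
proof -
  have "((\<lambda>y. f (L y)) has_derivative (\<lambda>B. deriv_at f (L x) (L B))) (at x)"
    by (rule has_derivative_compose[OF _ mpolys_has_derivative[OF assms(1)]])
       (simp add: assms(2) linear_imp_has_derivative)
  then show ?thesis by (simp add: deriv_at_unique)
qed

lemma mpolys_curve_derivative:
  assumes "f \<in> mpolys" "(M has_vector_derivative M') (at t)"
  shows "((\<lambda>t. f (M t)) has_real_derivative deriv_at f (M t) M') (at t)"
proof -
  have "((\<lambda>t. f (M t)) has_derivative (\<lambda>h. deriv_at f (M t) (h *\<^sub>R M'))) (at t)"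
    by (rule has_derivative_compose[OF _ mpolys_has_derivative[OF assms(1)]])
       (use assms(2) in \<open>simp add: has_vector_derivative_def\<close>)
  then show ?thesis
    by (simp add: has_field_derivative_def linear_cmul[OF linear_deriv_at[OF assms(1)]]
        mult.commute[of _ "deriv_at f (M t) M'"])
qed

definition tangent_space :: "(real^'n^'n) set \<Rightarrow> (real^'n^'n) set" where
  "tangent_space H = {B. \<forall>f\<in>vanishing H. deriv_at f (mat 1) B = 0}"

lemma subspace_tangent_space: "subspace (tangent_space H)"
  by (auto simp: subspace_def tangent_space_def linear_0[OF linear_deriv_at]
      linear_add[OF linear_deriv_at] linear_cmul[OF linear_deriv_at] vanishing_mpolys)

lemma tangent_space_mono: "H \<subseteq> K \<Longrightarrow> tangent_space H \<subseteq> tangent_space K"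
  using vanishing_antimono[of H K] by (auto simp: tangent_space_def)

text \<open>Chain rule for \<open>f (g ** y ** g')\<close>, an equation of \<open>H\<close> whenever
  \<open>f\<close> is one of \<open>K\<close>; the hypothesis \<open>g ** g' = mat 1\<close> keeps
  the base point at the identity.\<close>

lemma tangent_space_conj:
  fixes g :: "real^'n^'n"
  assumes "g ** g' = mat 1" and HK: "\<And>h. h \<in> H \<Longrightarrow> g ** h ** g' \<in> K" and "B \<in> tangent_space H"
  shows "g ** B ** g' \<in> tangent_space K"
  unfolding tangent_space_def
proof safe
  fix f :: "real^'n^'n \<Rightarrow> real" assume f: "f \<in> vanishing K"
  have lin: "linear (\<lambda>y. g ** y ** g')"
    by (auto intro!: linearI simp: matrix_mult.add_left matrix_mult.add_right
        matrix_mult.scaleR_left matrix_mult.scaleR_right)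
  have fm: "f \<in> mpolys" using f by (rule vanishing_mpolys)
  have "(\<lambda>y. f (g ** y ** g')) \<in> vanishing H"
  proof (rule vanishingI)
    show "(\<lambda>y. f (g ** y ** g')) \<in> mpolys"
      by (rule mpolys_compose[OF fm]) (intro mpolys_mat_mult mpolys_const mpolys_entry)
  qed (use HK f vanishingD in blast)
  then have "deriv_at (\<lambda>y. f (g ** y ** g')) (mat 1) B = 0"
    using assms(3) by (simp add: tangent_space_def)
  then show "deriv_at f (mat 1) (g ** B ** g') = 0"
    by (simp add: deriv_at_linear_comp[OF fm lin] assms(1))
qed

text \<open>For \<open>x \<in> H\<close> the translate \<open>f (x ** y)\<close> is again an
  equation of \<open>H\<close>, so \<open>B\<close> kills its differential at the identity, which is
  the derivative of \<open>f\<close> at \<open>x\<close> along \<open>x ** B\<close>. The ideal is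
  thus stable under left-invariant derivations, which can be iterated.\<close>

lemma tangent_derivation_vanishing:
  fixes H :: "(real^'n^'n) set"
  assumes mult: "\<And>x y. x \<in> H \<Longrightarrow> y \<in> H \<Longrightarrow> x ** y \<in> H"
    and f: "f \<in> vanishing H" and B: "B \<in> tangent_space H"
  shows "(\<lambda>x. deriv_at f x (x ** B)) \<in> vanishing H"
proof (rule vanishingI)
  have fm: "f \<in> mpolys" using f by (rule vanishing_mpolys)
  show "(\<lambda>x. deriv_at f x (x ** B)) \<in> mpolys"
    by (rule mpolys_deriv_at[OF fm]) (intro mpolys_mat_mult mpolys_const mpolys_entry)
  fix x assume x: "x \<in> H"
  have "(\<lambda>y. f (x ** y)) \<in> vanishing H"
    by (rule vanishingI, rule mpolys_translate(1)[OF fm]) (rule vanishingD[OF f mult[OF x]])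
  then have "deriv_at (\<lambda>y. f (x ** y)) (mat 1) B = 0"
    using B by (simp add: tangent_space_def)
  moreover have "linear ((**) x :: real^'n^'n \<Rightarrow> real^'n^'n)"
    by (auto intro!: linearI simp: matrix_mult.add_right matrix_mult.scaleR_right)
  ultimately show "deriv_at f x (x ** B) = 0"
    by (simp add: deriv_at_linear_comp[OF fm])
qed

text \<open>First-order expansion with polynomial coefficients \<open>q\<close>; these are not
  unique, but their values at \<open>x\<close> are the partial derivatives. They provide the matrix
  for the determinant form of Nakayama's lemma.\<close>

lemma mpolys_expansion:
  fixes x :: "real^'n^'n"
  assumes "f \<in> mpolys"
  shows "\<exists>q. (\<forall>p. q p \<in> mpolys) \<and>
    (\<forall>y. f y = f x + (\<Sum>p\<in>UNIV. q p y * (y - x) $ fst p $ snd p)) \<and>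
    (\<forall>B. deriv_at f x B = (\<Sum>p\<in>UNIV. q p x * B $ fst p $ snd p))"
  using assms
proof (induction rule: mpoly_funs.induct)
  case (const c)
  show ?case by (rule exI[of _ "\<lambda>_ _. 0"]) (simp add: deriv_at_const)
next
  case (entry i j)
  have "(\<Sum>p\<in>UNIV. (if p = (i, j) then 1 else 0) * B $ fst p $ snd p) = B $ i $ j"
    for B :: "real^'n^'n"
    by (subst sum.remove[of _ "(i, j)"]) (auto intro!: sum.neutral)
  then show ?case
    by (intro exI[of _ "\<lambda>p _. if p = (i, j) then 1 else 0"])
       (simp add: deriv_at_entry del: vector_minus_component, simp)
next
  case (add f h)
  obtain q where q: "\<forall>p. q p \<in> mpolys"
    "\<And>y. f y = f x + (\<Sum>p\<in>UNIV. q p y * (y - x) $ fst p $ snd p)"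
    "\<forall>B. deriv_at f x B = (\<Sum>p\<in>UNIV. q p x * B $ fst p $ snd p)" using add.IH by blast
  obtain r where r: "\<forall>p. r p \<in> mpolys"
    "\<And>y. h y = h x + (\<Sum>p\<in>UNIV. r p y * (y - x) $ fst p $ snd p)"
    "\<forall>B. deriv_at h x B = (\<Sum>p\<in>UNIV. r p x * B $ fst p $ snd p)" using add.IH by blast
  have "f y + h y = f x + h x + (\<Sum>p\<in>UNIV. (q p y + r p y) * (y - x) $ fst p $ snd p)" for y
    using q(2)[of y] r(2)[of y]
    by (simp add: distrib_right sum.distrib del: vector_minus_component)
  moreover have "deriv_at (\<lambda>A. f A + h A) x B = (\<Sum>p\<in>UNIV. (q p x + r p x) * B $ fst p $ snd p)" for B
    using q(3) r(3) add.hyps by (simp add: deriv_at_add distrib_right sum.distrib)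
  moreover have "\<forall>p. (\<lambda>y. q p y + r p y) \<in> mpolys"
    using q(1) r(1) by (intro allI mpolys_add) auto
  ultimately show ?case
    by (intro exI[of _ "\<lambda>p y. q p y + r p y"] conjI) blast+
next
  case (mult f h)
  obtain q where q: "\<forall>p. q p \<in> mpolys"
    "\<And>y. f y = f x + (\<Sum>p\<in>UNIV. q p y * (y - x) $ fst p $ snd p)"
    "\<forall>B. deriv_at f x B = (\<Sum>p\<in>UNIV. q p x * B $ fst p $ snd p)" using mult.IH by blast
  obtain r where r: "\<forall>p. r p \<in> mpolys"
    "\<And>y. h y = h x + (\<Sum>p\<in>UNIV. r p y * (y - x) $ fst p $ snd p)"
    "\<forall>B. deriv_at h x B = (\<Sum>p\<in>UNIV. r p x * B $ fst p $ snd p)" using mult.IH by blast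
  have "f y * h y = f x * h x + (\<Sum>p\<in>UNIV. (f y * r p y + q p y * h x) * (y - x) $ fst p $ snd p)" for y
  proof -
    have "f y * h y = f x * h x + f y * (h y - h x) + (f y - f x) * h x"
      by (simp add: algebra_simps)
    also have "h y - h x = (\<Sum>p\<in>UNIV. r p y * (y - x) $ fst p $ snd p)"
      using r(2)[of y] by simp
    also have "f y - f x = (\<Sum>p\<in>UNIV. q p y * (y - x) $ fst p $ snd p)"
      using q(2)[of y] by simp
    finally show ?thesis
      by (simp add: sum_distrib_left sum_distrib_right distrib_left distrib_right sum.distrib mult_ac
          del: vector_minus_component)
  qed
  moreover have "deriv_at (\<lambda>A. f A * h A) x B
      = (\<Sum>p\<in>UNIV. (f x * r p x + q p x * h x) * B $ fst p $ snd p)" for B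
    using q(3) r(3) mult.hyps
    by (simp add: deriv_at_mult sum_distrib_left sum_distrib_right distrib_left distrib_right sum.distrib mult_ac)
  moreover have "\<forall>p. (\<lambda>y. f y * r p y + q p y * h x) \<in> mpolys"
    using q(1) r(1) mult.hyps by (intro allI mpolys_add mpolys_mult mpolys_const) auto
  ultimately show ?case
    by (intro exI[of _ "\<lambda>p y. f y * r p y + q p y * h x"] conjI) blast+
qed

text \<open>The gradients at the identity of the equations of \<open>H\<close> form a subspace; a
  nonzero vector orthogonal to it would be tangent, so it is the whole space and contains each
  matrix unit.\<close>

lemma trivial_tangent_space_coordinate:
  fixes H :: "(real^'n^'n) set"
  assumes "tangent_space H = {0}"
  shows "\<exists>f\<in>vanishing H. \<forall>B. deriv_at f (mat 1) B = B $ i $ j"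
proof -
  define grad where "grad f = (\<Sum>b\<in>Basis. deriv_at f (mat 1) b *\<^sub>R b)" for f :: "real^'n^'n \<Rightarrow> real"
  have grad: "deriv_at f (mat 1) B = grad f \<bullet> B" if "f \<in> mpolys" for f B
  proof -
    have "deriv_at f (mat 1) B = deriv_at f (mat 1) (\<Sum>b\<in>Basis. (B \<bullet> b) *\<^sub>R b)"
      by (simp add: euclidean_representation)
    also have "\<dots> = grad f \<bullet> B"
      using linear_deriv_at[OF that]
      by (simp add: linear_sum linear_cmul grad_def inner_sum_left inner_sum_right inner_commute mult.commute)
    finally show ?thesis .
  qed
  define G where "G = grad ` vanishing H"
  have "subspace G"
    unfolding G_def subspace_def
  proof safe
    have "(\<lambda>_. 0) \<in> vanishing H" by (auto intro: vanishingI)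
    moreover have "grad (\<lambda>_. 0) = 0" by (simp add: grad_def deriv_at_const)
    ultimately show "0 \<in> grad ` vanishing H" by force
  next
    fix f h assume fh: "f \<in> vanishing H" "h \<in> vanishing H"
    then have "(\<lambda>x. f x + h x) \<in> vanishing H" by (auto simp: vanishing_def mpolys_add)
    moreover have "grad (\<lambda>x. f x + h x) = grad f + grad h"
      using fh by (simp add: grad_def deriv_at_add vanishing_mpolys scaleR_left_distrib sum.distrib)
    ultimately show "grad f + grad h \<in> grad ` vanishing H" by (metis imageI)
  next
    fix c f assume f: "f \<in> vanishing H"
    then have "(\<lambda>x. c * f x) \<in> vanishing H" by (auto simp: vanishing_def mpolys_mult)
    moreover have "grad (\<lambda>x. c * f x) = c *\<^sub>R grad f"
      using f by (simp add: grad_def deriv_at_mult deriv_at_const vanishing_mpolys scaleR_sum_right)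
    ultimately show "c *\<^sub>R grad f \<in> grad ` vanishing H" by (metis imageI)
  qed
  have "span G = UNIV"
  proof (rule ccontr)
    assume "span G \<noteq> UNIV"
    then obtain a where a: "a \<noteq> 0" "span G \<subseteq> {x. a \<bullet> x = 0}"
      using span_not_univ_subset_hyperplane by blast
    have "a \<in> tangent_space H"
      unfolding tangent_space_def
    proof safe
      fix f assume f: "f \<in> vanishing H"
      then have "grad f \<in> span G" by (simp add: G_def span_base)
      then have "a \<bullet> grad f = 0" using a by blast
      then show "deriv_at f (mat 1) a = 0"
        using grad[OF vanishing_mpolys[OF f]] by (simp add: inner_commute)
    qed
    then show False using a assms by blast
  qed
  then have "axis i (axis j 1) \<in> G"
    using \<open>subspace G\<close> by (metis UNIV_I span_eq_iff)
  then obtain f where f: "f \<in> vanishing H" "grad f = axis i (axis j 1)"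
    by (auto simp: G_def)
  then have "deriv_at f (mat 1) B = B $ i $ j" for B
    using grad[OF vanishing_mpolys[OF f(1)], of B] by (simp add: inner_axis')
  with f(1) show ?thesis by (intro bexI[of _ f]) simp_all
qed

text \<open>Gaussian elimination: a variable \<open>b\<close> with nonzero coefficient in equation
  \<open>i\<close> is solved for and substituted into the other equations.\<close>

lemma homogeneous_system_nontrivial_solution:
  fixes k :: "'i \<Rightarrow> 'b \<Rightarrow> 'a::field"
  assumes "finite I" "finite A" "card I < card A"
  shows "\<exists>x. (\<exists>a\<in>A. x a \<noteq> 0) \<and> (\<forall>i\<in>I. (\<Sum>a\<in>A. x a * k i a) = 0)"
  using assms
proof (induction I arbitrary: A k rule: finite_induct)
  case empty
  then have "A \<noteq> {}" by auto
  then show ?case by (intro exI[of _ "\<lambda>_. 1"]) auto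
next
  case (insert i I)
  show ?case
  proof (cases "\<forall>a\<in>A. k i a = 0")
    case True
    have "card I < card A" using insert by simp
    then obtain x where "\<exists>a\<in>A. x a \<noteq> 0" "\<forall>i\<in>I. (\<Sum>a\<in>A. x a * k i a) = 0"
      using insert.IH[OF insert.prems(1)] by blast
    then show ?thesis using True by (intro exI[of _ x]) simp
  next
    case False
    then obtain b where b: "b \<in> A" "k i b \<noteq> 0" by blast
    define B where "B = A - {b}"
    have B: "finite B" "A = insert b B" "b \<notin> B" using b insert.prems by (auto simp: B_def)
    have "card I < card B" using insert B by simp
    then obtain x where x: "\<exists>a\<in>B. x a \<noteq> 0"
      "\<forall>j\<in>I. (\<Sum>a\<in>B. x a * (k j a - k j b * k i a / k i b)) = 0"
      using insert.IH[OF B(1), of "\<lambda>j a. k j a - k j b * k i a / k i b"] by blast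
    define y where "y = x(b := - (\<Sum>a\<in>B. x a * k i a) / k i b)"
    have y: "(\<Sum>a\<in>A. y a * k j a) = (\<Sum>a\<in>B. x a * k j a) - (\<Sum>a\<in>B. x a * k i a) / k i b * k j b" for j
    proof -
      have "(\<Sum>a\<in>B. y a * k j a) = (\<Sum>a\<in>B. x a * k j a)"
        by (rule sum.cong) (use B in \<open>auto simp: y_def\<close>)
      then show ?thesis using B by (simp add: y_def)
    qed
    have "(\<Sum>a\<in>A. y a * k j a) = 0" if "j \<in> insert i I" for j
    proof (cases "j = i")
      case True
      then show ?thesis using y[of i] b by simp
    next
      case False
      then have "0 = (\<Sum>a\<in>B. x a * (k j a - k j b * k i a / k i b))" using x that by simp
      also have "\<dots> = (\<Sum>a\<in>A. y a * k j a)"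
        unfolding y by (simp add: algebra_simps sum_subtractf sum_divide_distrib sum_distrib_left)
      finally show ?thesis by simp
    qed
    moreover have "\<exists>a\<in>A. y a \<noteq> 0" using x(1) B by (auto simp: y_def)
    ultimately show ?thesis by blast
  qed
qed

text \<open>If the tangent space is trivial, Nakayama's lemma in its determinant form yields a polynomial
  function that is \<open>1\<close> at the identity and \<open>0\<close> elsewhere on \<open>H\<close>. Its translates are linearly
  independent, but they lie in a finite-dimensional space.\<close>

lemma trivial_tangent_space_imp_finite:
  fixes H :: "(real^'n^'n) set"
  assumes H: "subgroup H GL" and T: "tangent_space H = {0}"
  shows "finite H"
proof (rule ccontr)
  assume inf: "infinite H"
  have one: "mat 1 \<in> H" and mult: "\<And>x y. x \<in> H \<Longrightarrow> y \<in> H \<Longrightarrow> x ** y \<in> H"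
    and inv: "\<And>x. x \<in> H \<Longrightarrow> invertible x \<and> matrix_inv x \<in> H"
    using H[unfolded subgroup_GL_iff] by blast+
  have "\<forall>p::'n\<times>'n. \<exists>f\<in>vanishing H. \<forall>B. deriv_at f (mat 1) B = B $ fst p $ snd p"
    using trivial_tangent_space_coordinate[OF T] by blast
  then obtain f where f: "\<And>p::'n\<times>'n. f p \<in> vanishing H"
    "\<And>p B. deriv_at (f p) (mat 1) B = B $ fst p $ snd p" by metis
  have "\<forall>p. \<exists>q. (\<forall>r. q r \<in> mpolys) \<and>
    (\<forall>y. f p y = f p (mat 1) + (\<Sum>r\<in>UNIV. q r y * (y - mat 1) $ fst r $ snd r)) \<and>
    (\<forall>B. deriv_at (f p) (mat 1) B = (\<Sum>r\<in>UNIV. q r (mat 1) * B $ fst r $ snd r))"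
    using mpolys_expansion vanishing_mpolys f(1) by blast
  from choice[OF this] obtain q where q': "\<forall>p. (\<forall>r. q p r \<in> mpolys) \<and>
    (\<forall>y. f p y = f p (mat 1) + (\<Sum>r\<in>UNIV. q p r y * (y - mat 1) $ fst r $ snd r)) \<and>
    (\<forall>B. deriv_at (f p) (mat 1) B = (\<Sum>r\<in>UNIV. q p r (mat 1) * B $ fst r $ snd r))"
    by (rule exE)
  then have q: "\<And>p r. q p r \<in> mpolys"
    "\<And>p y. f p y = f p (mat 1) + (\<Sum>r\<in>UNIV. q p r y * (y - mat 1) $ fst r $ snd r)"
    "\<And>p B. deriv_at (f p) (mat 1) B = (\<Sum>r\<in>UNIV. q p r (mat 1) * B $ fst r $ snd r)"
    by blast+
  \<comment> \<open>On \<open>H\<close> both \<open>f p y\<close> and \<open>f p (mat 1)\<close>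
    vanish, so \<open>W y\<close> annihilates the vector of entries of \<open>y - mat 1\<close>;
    where the determinant is nonzero, \<open>y\<close> is the identity.\<close>
  define W where "W y = (\<chi> p r. q p r y)" for y
  define \<delta> where "\<delta> y = det (W y)" for y
  have \<delta>m: "\<delta> \<in> mpolys"
    unfolding \<delta>_def by (rule mpolys_det) (simp add: W_def q(1))
  have "q p r (mat 1) = (if p = r then 1 else 0)" for p r
  proof -
    define B :: "real^'n^'n" where "B = (\<chi> i j. if (i, j) = r then 1 else 0)"
    have B: "B $ fst s $ snd s = (if s = r then 1 else 0)" for s by (simp add: B_def)
    have "(if p = r then 1 else 0) = (\<Sum>s\<in>UNIV. q p s (mat 1) * B $ fst s $ snd s)"
      using f(2)[of p B] q(3)[of p B] B[of p] by simp
    also have "\<dots> = q p r (mat 1)" by (simp add: B if_distrib cong: if_cong)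
    finally show ?thesis by simp
  qed
  then have "W (mat 1) = mat 1" by (simp add: W_def mat_def vec_eq_iff)
  then have \<delta>1: "\<delta> (mat 1) = 1" by (simp add: \<delta>_def)
  have \<delta>0: "\<delta> y = 0" if "y \<in> H" "y \<noteq> mat 1" for y
  proof (rule ccontr)
    assume "\<delta> y \<noteq> 0"
    then have "invertible (W y)" by (simp add: \<delta>_def invertible_det_nz)
    then have "\<exists>B. B ** W y = mat 1" by (auto simp: invertible_def)
    then have ker: "\<And>v. W y *v v = 0 \<Longrightarrow> v = 0"
      by (simp add: matrix_left_invertible_ker)
    define v where "v = (\<chi> r. (y - mat 1) $ fst r $ snd r)"
    have "W y *v v = 0"
      using q(2)[of _ y] vanishingD[OF f(1) that(1)] vanishingD[OF f(1) one]
      by (simp add: vec_eq_iff matrix_vector_mult_def W_def v_def)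
    from ker[OF this] have "\<forall>i j. y $ i $ j = (mat 1 :: real^'n^'n) $ i $ j"
      by (simp add: v_def vec_eq_iff)
    with that(2) show False by (simp add: vec_eq_iff)
  qed
  obtain I c \<phi> where I: "finite (I::nat set)"
    "\<forall>x y :: real^'n^'n. \<delta> (x ** y) = (\<Sum>i\<in>I. c i x * \<phi> i y)"
    using mpolys_translates_finite_rank[OF \<delta>m] by blast
  \<comment> \<open>With one element more than there are \<open>\<phi> i\<close>, their values on
    \<open>A\<close> satisfy a linear relation; evaluated through
    \<open>\<delta> (matrix_inv b ** a)\<close>, which is the Kronecker delta on \<open>A\<close>,
    it forces every coefficient to vanish.\<close>
  obtain A where A: "A \<subseteq> H" "finite A" "card A = Suc (card I)"
    using infinite_arbitrarily_large[OF inf] by blast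
  obtain x where x: "\<exists>a\<in>A. x a \<noteq> 0" "\<forall>i\<in>I. (\<Sum>a\<in>A. x a * \<phi> i a) = 0"
    using homogeneous_system_nontrivial_solution[OF I(1) A(2), of \<phi>] A(3) by auto
  have "x b = 0" if "b \<in> A" for b
  proof -
    have b: "b \<in> H" "invertible b" using that A inv by auto
    have \<delta>b: "\<delta> (matrix_inv b ** a) = (if a = b then 1 else 0)" if "a \<in> A" for a
    proof (cases "a = b")
      case True
      then show ?thesis using \<delta>1 b by (simp add: matrix_inv)
    next
      case False
      have "matrix_inv b ** a \<noteq> mat 1"
      proof
        assume "matrix_inv b ** a = mat 1"
        then have "b ** (matrix_inv b ** a) = b" by simp
        then show False using False b by (simp add: matrix_mul_assoc matrix_inv)
      qed
      then show ?thesis using \<delta>0 mult inv b that A False by auto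
    qed
    have "0 = (\<Sum>i\<in>I. c i (matrix_inv b) * (\<Sum>a\<in>A. x a * \<phi> i a))" using x by simp
    also have "\<dots> = (\<Sum>a\<in>A. x a * (\<Sum>i\<in>I. c i (matrix_inv b) * \<phi> i a))"
      unfolding sum_distrib_left by (subst sum.swap) (simp add: mult_ac)
    also have "\<dots> = (\<Sum>a\<in>A. x a * \<delta> (matrix_inv b ** a))" using I by simp
    also have "\<dots> = (\<Sum>a\<in>A. if a = b then x a else 0)"
      by (rule sum.cong) (simp_all add: \<delta>b)
    also have "\<dots> = x b" using that A by simp
    finally show ?thesis by simp
  qed
  with x(1) show False by blast
qed


section \<open>The orthogonal group and its Lie algebra\<close>

definition form_sign :: "'e option \<Rightarrow> 'a::comm_ring_1" where
  "form_sign i = (case i of None \<Rightarrow> -1 | Some _ \<Rightarrow> 1)"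

lemma form_sign_simps [simp]: "form_sign None = -1" "form_sign (Some i) = 1"
  by (simp_all add: form_sign_def)

lemma form_sign_square [simp]: "form_sign i * form_sign i = 1" "form_sign i * (form_sign i * x) = x"
  by (cases i; simp add: form_sign_def)+

definition bform :: "'a::comm_ring_1^('e::finite option) \<Rightarrow> 'a^('e option) \<Rightarrow> 'a" where
  "bform u v = (\<Sum>i\<in>UNIV. form_sign i * u $ i * v $ i)"

text \<open>The adjoint with respect to \<open>bform\<close>, that is J A^T J for the signature
  matrix J. It stands in for \<open>matrix_inv\<close> on \<open>SO_Q\<close> because its entries
  are linear in those of \<open>A\<close>, so that conjugation becomes a polynomial map.\<close>

definition form_adjoint :: "'a::comm_ring_1^('e::finite option)^('e option) \<Rightarrow> 'a^('e option)^('e option)" where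
  "form_adjoint A = (\<chi> i j. form_sign i * form_sign j * A $ j $ i)"

lemma Q_eq_bform: "Q v = bform v v"
  by (simp add: Q_def bform_def UNIV_option_conv sum.reindex power2_eq_square)

lemma bform_adjoint: "bform (A *v u) v = bform u (form_adjoint A *v v)"
  unfolding bform_def matrix_vector_mult_def form_adjoint_def
  by (simp add: sum_distrib_left sum_distrib_right mult_ac, subst sum.swap, simp add: mult_ac)

lemma form_adjoint_entry: "form_adjoint A $ i $ j = form_sign i * form_sign j * A $ j $ i"
  by (simp add: form_adjoint_def)

lemma form_adjoint_mult: "form_adjoint (A ** B) = form_adjoint B ** form_adjoint A"
  by (simp add: vec_eq_iff form_adjoint_def matrix_matrix_mult_def sum_distrib_left mult_ac)

lemma form_adjoint_one [simp]: "form_adjoint (mat 1) = mat 1"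
  by (auto simp: vec_eq_iff form_adjoint_def mat_def)

lemma form_adjoint_adjoint [simp]: "form_adjoint (form_adjoint A) = A"
  by (simp add: vec_eq_iff form_adjoint_def mult_ac)

lemma form_adjoint_add: "form_adjoint (A + B) = form_adjoint A + form_adjoint B"
  by (simp add: vec_eq_iff form_adjoint_def algebra_simps)

lemma form_adjoint_diff: "form_adjoint (A - B) = form_adjoint A - form_adjoint B"
  by (simp add: vec_eq_iff form_adjoint_def algebra_simps)

lemma form_adjoint_scaleR: "form_adjoint (c *\<^sub>R A) = c *\<^sub>R form_adjoint A" for A :: "real^_^_"
  by (simp add: vec_eq_iff form_adjoint_def)

lemma linear_form_adjoint: "linear (form_adjoint :: real^('e::finite option)^('e option) \<Rightarrow> _)"
  by (rule linearI) (simp_all add: form_adjoint_add form_adjoint_scaleR)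

lemma det_form_adjoint: "det (form_adjoint A) = det (A :: 'a::field^('e::finite option)^('e option))"
proof -
  define J :: "'a^('e option)^('e option)" where "J = (\<chi> i j. if i = j then form_sign i else 0)"
  have "form_adjoint A = J ** transpose A ** J"
    by (simp add: vec_eq_iff form_adjoint_def matrix_matrix_mult_def J_def transpose_def
        if_distrib if_distribR mult_ac cong: if_cong)
  then have "det (form_adjoint A) = det (J ** J) * det A"
    by (simp add: det_mul)
  moreover have "J ** J = mat 1"
  proof -
    have "(J ** J) $ i $ j = (\<Sum>k\<in>UNIV. if k = i then (if i = j then 1 else 0) else 0)" for i j
      unfolding matrix_matrix_mult_def J_def vec_lambda_beta by (rule sum.cong) auto
    then show ?thesis by (simp add: vec_eq_iff mat_def)
  qed
  ultimately show ?thesis by simp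
qed

lemma SO_Q_I: "form_adjoint A ** A = mat 1 \<Longrightarrow> det A = 1 \<Longrightarrow> A \<in> SO_Q"
  by (simp add: SO_Q_def Q_eq_bform bform_adjoint matrix_vector_mul_assoc)

lemma bform_axis: "bform (axis i 1) v = form_sign i * v $ i"
  unfolding bform_def
  by (subst sum.remove[of _ i]) (auto intro!: sum.neutral simp: axis_def)

lemma bform_add: "bform (u + u') v = bform u v + bform u' v" "bform u (v + v') = bform u v + bform u v'"
  by (simp_all add: bform_def algebra_simps sum.distrib)

lemma bform_commute: "bform u v = bform v u"
  by (simp add: bform_def mult_ac)

lemma SO_Q_D:
  fixes A :: "real^('e::finite option)^('e option)"
  assumes "A \<in> SO_Q"
  shows "form_adjoint A ** A = mat 1" "A ** form_adjoint A = mat 1" "det A = 1"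
proof -
  have Q: "bform (A *v v) (A *v v) = bform v v" for v
    using assms by (simp add: SO_Q_def Q_eq_bform)
  have bf: "bform (A *v u) (A *v v) = bform u v" for u v
    using Q[of "u + v"] Q[of u] Q[of v] bform_commute[of u v] bform_commute[of "A *v u" "A *v v"]
    by (simp add: bform_add matrix_vector_right_distrib)
  have "(form_adjoint A *v (A *v v)) $ i = v $ i" for v i
  proof -
    have "form_sign i * (form_adjoint A *v (A *v v)) $ i = form_sign i * v $ i"
      using bf[of "axis i 1" v] by (simp add: bform_adjoint bform_axis)
    then show ?thesis by (cases i) (simp_all add: form_sign_def)
  qed
  then show 1: "form_adjoint A ** A = mat 1"
    by (simp add: matrix_eq vec_eq_iff matrix_vector_mul_assoc[symmetric])
  then show "A ** form_adjoint A = mat 1" by (simp add: matrix_left_right_inverse)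
  show "det A = 1" using assms by (simp add: SO_Q_def)
qed

lemma matrix_inv_SO_Q:
  "A \<in> SO_Q \<Longrightarrow> matrix_inv A = form_adjoint (A :: real^('e::finite option)^('e option))"
  by (rule matrix_inv_unique) (rule SO_Q_D)

lemma subgroup_SO_Q: "subgroup (SO_Q :: (real^('e::finite option)^('e option)) set) GL"
  unfolding subgroup_GL_iff
proof safe
  show "mat 1 \<in> (SO_Q :: (real^('e::finite option)^('e option)) set)"
    by (rule SO_Q_I) simp_all
next
  fix x y :: "real^('e::finite option)^('e option)" assume xy: "x \<in> SO_Q" "y \<in> SO_Q"
  have "form_adjoint (x ** y) ** (x ** y) = form_adjoint y ** (form_adjoint x ** x) ** y"
    by (simp only: form_adjoint_mult matrix_mul_assoc)
  then show "x ** y \<in> SO_Q"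
    using xy by (intro SO_Q_I) (simp_all add: SO_Q_D det_mul)
next
  fix x :: "real^('e::finite option)^('e option)" assume x: "x \<in> SO_Q"
  show "invertible x" using SO_Q_D[OF x] by (auto simp: invertible_def)
  show "matrix_inv x \<in> SO_Q"
    unfolding matrix_inv_SO_Q[OF x] using x by (intro SO_Q_I) (simp_all add: SO_Q_D det_form_adjoint)
qed

lemma SO_Q_mult: "x \<in> SO_Q \<Longrightarrow> y \<in> SO_Q \<Longrightarrow> x ** y \<in> SO_Q" for x :: "real^('e::finite option)^('e option)"
  using subgroup_SO_Q unfolding subgroup_GL_iff by blast

definition so_Q :: "(real^('e::finite option)^('e option)) set" where
  "so_Q = {B. form_adjoint B = - B}"

text \<open>Differentiating the equation \<open>form_adjoint A ** A = mat 1\<close> at the identity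
  gives \<open>form_adjoint B + B = 0\<close>.\<close>

lemma tangent_space_SO_Q:
  assumes "H \<subseteq> SO_Q"
  shows "tangent_space H \<subseteq> so_Q"
proof
  fix B assume B: "B \<in> tangent_space H"
  have "(form_adjoint B + B) $ i $ j = 0" for i j
  proof -
    define f where "f = (\<lambda>A :: real^('a option)^('a option). (form_adjoint A ** A - mat 1) $ i $ j)"
    have "(\<lambda>A :: real^('a option)^('a option). (form_adjoint A ** A) $ i $ j) \<in> mpolys"
      by (intro mpolys_mat_mult mpolys_entry) (simp add: form_adjoint_entry mpolys_mult)
    then have "f \<in> vanishing H"
      unfolding f_def vector_minus_component
    proof (intro vanishingI mpolys_minus mpolys_const)
      fix x assume "x \<in> H"
      then have "form_adjoint x ** x = mat 1" using assms SO_Q_D(1) by blast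
      then show "(form_adjoint x ** x) $ i $ j - mat 1 $ i $ j = 0" by simp
    qed
    then have 0: "deriv_at f (mat 1) B = 0" using B by (simp add: tangent_space_def)
    have "((\<lambda>A :: real^('a option)^('a option). form_adjoint A ** A - mat 1) has_derivative (\<lambda>B. form_adjoint B + B)) (at (mat 1))"
    proof -
      have "((\<lambda>A :: real^('a option)^('a option). form_adjoint A ** A) has_derivative
          (\<lambda>B. form_adjoint (mat 1) ** B + form_adjoint B ** mat 1)) (at (mat 1))"
        by (rule matrix_mult.FDERIV[OF linear_imp_has_derivative[OF linear_form_adjoint] has_derivative_ident])
      then show ?thesis
        by (auto intro!: derivative_eq_intros simp: add.commute)
    qed
    then have "(f has_derivative (\<lambda>B. (form_adjoint B + B) $ i $ j)) (at (mat 1))"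
      unfolding f_def by (rule has_derivative_compose[OF _ has_derivative_entry])
    from deriv_at_unique[OF this] 0 show ?thesis by simp
  qed
  then show "B \<in> so_Q"
    by (simp add: so_Q_def vec_eq_iff eq_neg_iff_add_eq_0)
qed

definition unit_matrix :: "'n \<Rightarrow> 'm \<Rightarrow> real^'m^'n" where
  "unit_matrix i j = axis i (axis j 1)"

lemma matrix_unit_expansion:
  fixes A :: "real^'m^'n"
  shows "A = (\<Sum>i\<in>UNIV. \<Sum>j\<in>UNIV. A $ i $ j *\<^sub>R unit_matrix i j)"
proof -
  have unit: "unit_matrix i j $ k $ l = (if i = k then if j = l then 1 else 0 else 0)"
    for i k :: 'n and j l :: 'm
    by (simp add: unit_matrix_def axis_def)
  have "(\<Sum>i\<in>UNIV. \<Sum>j\<in>UNIV. A $ i $ j *\<^sub>R unit_matrix i j) $ k $ l = A $ k $ l" for k l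
  proof -
    have "(\<Sum>i\<in>UNIV. \<Sum>j\<in>UNIV. A $ i $ j *\<^sub>R unit_matrix i j) $ k $ l
        = (\<Sum>i\<in>UNIV. \<Sum>j\<in>UNIV. A $ i $ j * unit_matrix i j $ k $ l)"
      by (simp only: sum_component vector_scaleR_component real_scaleR_def)
    also have "\<dots> = (\<Sum>i\<in>UNIV. if i = k then A $ i $ l else 0)"
    proof (rule sum.cong[OF refl])
      fix i
      have "(\<Sum>j\<in>UNIV. A $ i $ j * unit_matrix i j $ k $ l)
          = (\<Sum>j\<in>UNIV. if j = l then (if i = k then A $ i $ j else 0) else 0)"
        by (rule sum.cong) (auto simp: unit)
      then show "(\<Sum>j\<in>UNIV. A $ i $ j * unit_matrix i j $ k $ l) = (if i = k then A $ i $ l else 0)"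
        by simp
    qed
    finally show ?thesis by simp
  qed
  then show ?thesis by (simp add: vec_eq_iff)
qed

definition so_Q_gen :: "'e option \<Rightarrow> 'e option \<Rightarrow> real^('e::finite option)^('e option)" where
  "so_Q_gen i j = unit_matrix i j - form_adjoint (unit_matrix i j)"

lemma so_Q_gen: "so_Q_gen i j \<in> so_Q"
  by (simp add: so_Q_def so_Q_gen_def form_adjoint_diff)

text \<open>Here \<open>B\<close> is half of \<open>B - form_adjoint B\<close>, whence the factor
  1/2, and the matrix unit expansion is antisymmetrised term by term. The spanning family is
  redundant, which is harmless.\<close>

lemma so_Q_expansion:
  assumes "B \<in> so_Q"
  shows "B = (\<Sum>i\<in>UNIV. \<Sum>j\<in>UNIV. (B $ i $ j / 2) *\<^sub>R so_Q_gen i j)"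
proof -
  have "form_adjoint B = (\<Sum>i\<in>UNIV. \<Sum>j\<in>UNIV. B $ i $ j *\<^sub>R form_adjoint (unit_matrix i j))"
    by (subst matrix_unit_expansion[of B])
       (simp add: linear_sum[OF linear_form_adjoint] form_adjoint_scaleR)
  then have "B - form_adjoint B = (\<Sum>i\<in>UNIV. \<Sum>j\<in>UNIV. B $ i $ j *\<^sub>R so_Q_gen i j)"
    by (subst (1) matrix_unit_expansion[of B]) (simp add: so_Q_gen_def scaleR_diff_right sum_subtractf)
  also have "\<dots> = 2 *\<^sub>R (\<Sum>i\<in>UNIV. \<Sum>j\<in>UNIV. (B $ i $ j / 2) *\<^sub>R so_Q_gen i j)"
    by (simp add: scaleR_sum_right)
  also have "B - form_adjoint B = 2 *\<^sub>R B" using assms by (simp add: so_Q_def scaleR_2)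
  finally show ?thesis by simp
qed


section \<open>The Cayley transform\<close>

lemma continuous_det: "continuous (at A) (det :: real^'n^'n \<Rightarrow> real)"
  using has_derivative_continuous[OF mpolys_has_derivative[OF mpolys_det[of "\<lambda>A. A"]], of A]
  by simp

text \<open>The Cayley curve \<open>c t = (1 + t A) (1 - t A)\<^sup>-\<^sup>1 = 2 (1 - t A)\<^sup>-\<^sup>1 - 1\<close>.\<close>

definition resolvent :: "real^'n^'n \<Rightarrow> real \<Rightarrow> real^'n^'n" where
  "resolvent A t = matrix_inv (mat 1 - t *\<^sub>R A)"

definition cayley :: "real^'n^'n \<Rightarrow> real \<Rightarrow> real^'n^'n" where
  "cayley A t = 2 *\<^sub>R resolvent A t - mat 1"

definition cayley_domain :: "real^'n^'n \<Rightarrow> real set" where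
  "cayley_domain A = {t. det (mat 1 - t *\<^sub>R A) \<noteq> 0}"

lemma zero_in_cayley_domain [simp]: "0 \<in> cayley_domain A"
  by (simp add: cayley_domain_def)

lemma resolvent:
  assumes "t \<in> cayley_domain A"
  shows "(mat 1 - t *\<^sub>R A) ** resolvent A t = mat 1" "resolvent A t ** (mat 1 - t *\<^sub>R A) = mat 1"
  using assms matrix_inv[of "mat 1 - t *\<^sub>R A"]
  by (simp_all add: cayley_domain_def resolvent_def invertible_det_nz)

lemma cayley_zero [simp]: "cayley A 0 = mat 1"
proof -
  have "resolvent A 0 = mat 1" unfolding resolvent_def by (rule matrix_inv_unique) simp
  then show ?thesis by (simp add: cayley_def scaleR_2)
qed

text \<open>Cramer's rule: column \<open>j\<close> of the resolvent solves a linear system with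
  right-hand side \<open>axis j 1\<close>, so the determinant is a common denominator of all
  entries.\<close>

lemma resolvent_rational:
  "\<exists>q p. (\<forall>t. det (mat 1 - t *\<^sub>R A) = poly q t) \<and>
    (\<forall>t\<in>cayley_domain A. \<forall>i j. poly q t * resolvent A t $ i $ j = poly (p i j) t)"
proof -
  have entry: "\<exists>r. \<forall>t. (mat 1 - t *\<^sub>R A) $ i $ j = poly r t" for i j
    by (rule exI[of _ "[: mat 1 $ i $ j, - (A $ i $ j) :]"]) simp
  have det: "det \<in> mpolys" for x :: "real^'n^'n"
    using mpolys_det[of "\<lambda>A. A"] by simp
  obtain q where q: "\<forall>t. det (mat 1 - t *\<^sub>R A) = poly q t"
    using mpolys_polynomial_curve[OF det entry] by blast
  have "\<exists>r. \<forall>t. det (\<chi> k l. if l = i then axis j 1 $ k else (mat 1 - t *\<^sub>R A) $ k $ l) = poly r t" for i j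
  proof (rule mpolys_polynomial_curve[OF det])
    fix k l
    show "\<exists>r. \<forall>t. (\<chi> k l. if l = i then axis j 1 $ k else (mat 1 - t *\<^sub>R A) $ k $ l) $ k $ l = poly r t"
    proof (cases "l = i")
      case True
      then show ?thesis by (intro exI[of _ "[:axis j 1 $ k:]"]) simp
    next
      case False
      then show ?thesis using entry[of k l] by simp
    qed
  qed
  then obtain p where p: "\<And>i j t. det (\<chi> k l. if l = i then axis j 1 $ k else (mat 1 - t *\<^sub>R A) $ k $ l) = poly (p i j) t"
    by metis
  have "poly q t * resolvent A t $ i $ j = poly (p i j) t" if t: "t \<in> cayley_domain A" for t i j
  proof -
    have d: "det (mat 1 - t *\<^sub>R A) \<noteq> 0" using t by (simp add: cayley_domain_def)
    have "(mat 1 - t *\<^sub>R A) *v (resolvent A t *v axis j 1) = axis j 1"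
      by (simp add: matrix_vector_mul_assoc resolvent(1)[OF t])
    then have "resolvent A t *v axis j 1 = (\<chi> i. poly (p i j) t / poly q t)"
      unfolding cramer[OF d] using p q by simp
    moreover have "(resolvent A t *v axis j 1) $ i = resolvent A t $ i $ j"
      by (simp add: matrix_vector_mul_component inner_axis)
    ultimately show ?thesis using d q by (auto simp: field_simps)
  qed
  then show ?thesis using q by blast
qed

lemma open_cayley_domain: "open (cayley_domain A)"
proof -
  obtain q where q: "\<forall>t. det (mat 1 - t *\<^sub>R A) = poly q t"
    using resolvent_rational by blast
  then have "cayley_domain A = {t. poly q t \<noteq> 0}" by (simp add: cayley_domain_def)
  also have "open \<dots>" by (intro open_Collect_neq continuous_intros)
  finally show ?thesis .
qed

text \<open>Rationality yields differentiability; the value of the derivative then comes from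
  differentiating \<open>(mat 1 - t *\<^sub>R A) ** resolvent A t = mat 1\<close>.\<close>

lemma resolvent_has_vector_derivative:
  assumes t: "t \<in> cayley_domain A"
  shows "(resolvent A has_vector_derivative resolvent A t ** A ** resolvent A t) (at t)"
proof -
  obtain q p where q: "\<forall>t. det (mat 1 - t *\<^sub>R A) = poly q t"
    and p: "\<forall>t\<in>cayley_domain A. \<forall>i j. poly q t * resolvent A t $ i $ j = poly (p i j) t"
    using resolvent_rational by blast
  have q0: "poly q t \<noteq> 0" if "t \<in> cayley_domain A" for t
    using q that by (simp add: cayley_domain_def)
  define h where "h i j t = poly (p i j) t / poly q t" for i j t
  have h: "(\<Sum>i\<in>UNIV. \<Sum>j\<in>UNIV. h i j s *\<^sub>R unit_matrix i j) = resolvent A s" if "s \<in> cayley_domain A" for s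
  proof -
    have "h i j s = resolvent A s $ i $ j" for i j
      using p[rule_format, OF that, of i j] q0[OF that] by (simp add: h_def field_simps)
    then show ?thesis using matrix_unit_expansion[of "resolvent A s"] by simp
  qed
  have "\<exists>d. (h i j has_real_derivative d) (at t)" for i j
    unfolding h_def using q0[OF t]
    by (intro exI) (rule DERIV_divide[OF poly_DERIV poly_DERIV])
  then obtain d where d: "\<And>i j. (h i j has_real_derivative d i j) (at t)" by metis
  define D where "D = (\<Sum>i\<in>UNIV. \<Sum>j\<in>UNIV. d i j *\<^sub>R unit_matrix i j)"
  have "((\<lambda>s. \<Sum>i\<in>UNIV. \<Sum>j\<in>UNIV. h i j s *\<^sub>R unit_matrix i j) has_vector_derivative D) (at t)"
    unfolding D_def
    by (intro has_vector_derivative_sum has_vector_derivative_scaleR[where g'=0, simplified] d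
        has_vector_derivative_const)
  then have D: "(resolvent A has_vector_derivative D) (at t)"
    by (rule has_vector_derivative_transform_within_open[OF _ open_cayley_domain t h])
  have lin: "((\<lambda>s. mat 1 - s *\<^sub>R A) has_vector_derivative - A) (at t)"
    by (auto intro!: derivative_eq_intros)
  have "((\<lambda>s. (mat 1 - s *\<^sub>R A) ** resolvent A s) has_vector_derivative
      (mat 1 - t *\<^sub>R A) ** D + (- A) ** resolvent A t) (at t)"
    by (rule matrix_mult.has_vector_derivative[OF lin D])
  moreover have "((\<lambda>s. (mat 1 - s *\<^sub>R A) ** resolvent A s) has_vector_derivative 0) (at t)"
    by (rule has_vector_derivative_transform_within_open[OF has_vector_derivative_const[of "mat 1"]
          open_cayley_domain t]) (simp add: resolvent)
  ultimately have "(mat 1 - t *\<^sub>R A) ** D + (- A) ** resolvent A t = 0"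
    by (rule vector_derivative_unique_at)
  then have "(mat 1 - t *\<^sub>R A) ** D = A ** resolvent A t"
    by (simp add: matrix_mult.minus_left)
  then have "resolvent A t ** ((mat 1 - t *\<^sub>R A) ** D) = resolvent A t ** (A ** resolvent A t)"
    by simp
  then have "D = resolvent A t ** A ** resolvent A t"
    unfolding matrix_mul_assoc resolvent(2)[OF t] by simp
  then show ?thesis using D by simp
qed

lemma cayley_has_vector_derivative:
  assumes "t \<in> cayley_domain A"
  shows "(cayley A has_vector_derivative 2 *\<^sub>R (resolvent A t ** A ** resolvent A t)) (at t)"
  unfolding cayley_def
  by (rule has_vector_derivative_eq_rhs)
     (rule has_vector_derivative_diff[OF has_vector_derivative_scaleR[OF DERIV_const
          resolvent_has_vector_derivative[OF assms]] has_vector_derivative_const], simp)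

text \<open>With \<open>L = mat 1 - t *\<^sub>R A\<close>, skewness makes
  \<open>form_adjoint L = mat 1 + t *\<^sub>R A\<close>, which commutes with \<open>L\<close>; the
  curve is \<open>form_adjoint L\<close> times the inverse of \<open>L\<close>, and both have the
  same determinant.\<close>

lemma cayley_in_SO_Q:
  fixes A :: "real^('e::finite option)^('e option)"
  assumes A: "A \<in> so_Q" and t: "t \<in> cayley_domain A"
  shows "cayley A t \<in> SO_Q"
proof -
  define L where "L = mat 1 - t *\<^sub>R A"
  define R where "R = resolvent A t"
  have LR: "L ** R = mat 1" "R ** L = mat 1" using resolvent[OF t] by (simp_all add: L_def R_def)
  have qL: "form_adjoint L = mat 1 + t *\<^sub>R A"
  proof -
    have "form_adjoint L = mat 1 - t *\<^sub>R form_adjoint A"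
      unfolding L_def form_adjoint_diff form_adjoint_scaleR by simp
    then show ?thesis using A by (simp add: so_Q_def)
  qed
  have c: "cayley A t = form_adjoint L ** R"
  proof -
    have "form_adjoint L = 2 *\<^sub>R mat 1 - L" unfolding qL by (simp add: L_def scaleR_2)
    then have "form_adjoint L ** R = 2 *\<^sub>R R - L ** R"
      by (simp add: matrix_mult.diff_left matrix_mult.scaleR_left)
    then show ?thesis unfolding LR(1) by (simp add: cayley_def R_def)
  qed
  have comm: "L ** form_adjoint L = form_adjoint L ** L"
    unfolding qL by (simp add: L_def matrix_mult.diff_left matrix_mult.diff_right matrix_mult.add_left
        matrix_mult.add_right matrix_mult.scaleR_left matrix_mult.scaleR_right algebra_simps)
  have "form_adjoint (cayley A t) ** cayley A t = form_adjoint R ** (L ** form_adjoint L) ** R"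
    by (simp add: c form_adjoint_mult matrix_mul_assoc)
  also have "\<dots> = form_adjoint (L ** R) ** (L ** R)"
    by (simp add: comm form_adjoint_mult matrix_mul_assoc)
  finally have 1: "form_adjoint (cayley A t) ** cayley A t = mat 1" by (simp add: LR)
  have "det (cayley A t) = det (L ** R)" by (simp add: c det_mul det_form_adjoint)
  then show ?thesis using 1 by (intro SO_Q_I) (simp_all add: LR)
qed

lemma resolvent_continuous:
  "t \<in> cayley_domain A \<Longrightarrow> continuous (at t) (resolvent A)"
  using resolvent_has_vector_derivative has_vector_derivative_continuous by blast

text \<open>The logarithmic derivative of the curve, with \<open>form_adjoint\<close> in the role of
  the inverse. Lying in the Lie algebra, it expresses differentiation along the curve by
  left-invariant derivations with continuous coefficients.\<close>

definition cayley_velocity :: "real^('e::finite option)^('e option) \<Rightarrow> real \<Rightarrow> real^('e option)^('e option)" where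
  "cayley_velocity A t = form_adjoint (cayley A t) ** (2 *\<^sub>R (resolvent A t ** A ** resolvent A t))"

lemma cayley_velocity:
  assumes A: "A \<in> so_Q" and t: "t \<in> cayley_domain A"
  shows "cayley A t ** cayley_velocity A t = 2 *\<^sub>R (resolvent A t ** A ** resolvent A t)"
    and "cayley_velocity A t \<in> so_Q"
    and "continuous (at t) (cayley_velocity A)"
proof -
  define c where "c = cayley A"
  define c' where "c' = 2 *\<^sub>R (resolvent A t ** A ** resolvent A t)"
  have c: "c t \<in> SO_Q" using cayley_in_SO_Q[OF A t] by (simp add: c_def)
  show "cayley A t ** cayley_velocity A t = 2 *\<^sub>R (resolvent A t ** A ** resolvent A t)"
    using SO_Q_D(2)[OF c] by (simp add: c_def cayley_velocity_def matrix_mul_assoc)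
  have d: "(c has_vector_derivative c') (at t)"
    using cayley_has_vector_derivative[OF t] by (simp add: c_def c'_def)
  have "((\<lambda>t. form_adjoint (c t)) has_vector_derivative form_adjoint c') (at t)"
    using bounded_linear.has_vector_derivative[OF _ d] linear_form_adjoint linear_conv_bounded_linear
    by blast
  from matrix_mult.has_vector_derivative[OF this d]
  have "((\<lambda>t. form_adjoint (c t) ** c t) has_vector_derivative
      form_adjoint (c t) ** c' + form_adjoint c' ** c t) (at t)" .
  moreover have "((\<lambda>t. form_adjoint (c t) ** c t) has_vector_derivative 0) (at t)"
    by (rule has_vector_derivative_transform_within_open[OF has_vector_derivative_const[of "mat 1"]
          open_cayley_domain t]) (simp add: c_def SO_Q_D(1)[OF cayley_in_SO_Q[OF A]])
  ultimately have "form_adjoint (c t) ** c' + form_adjoint c' ** c t = 0"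
    by (rule vector_derivative_unique_at)
  then have "form_adjoint c' ** c t = - (form_adjoint (c t) ** c')"
    by (simp add: add.commute eq_neg_iff_add_eq_0)
  then show "cayley_velocity A t \<in> so_Q"
    by (simp add: so_Q_def cayley_velocity_def form_adjoint_mult flip: c_def c'_def)
  have "continuous (at t) (\<lambda>t. form_adjoint (cayley A t))"
    unfolding cayley_def
    by (intro linear_continuous_compose[OF _ linear_form_adjoint] continuous_intros resolvent_continuous t)
  then show "continuous (at t) (cayley_velocity A)"
    unfolding cayley_velocity_def
    by (intro matrix_mult.continuous continuous_intros resolvent_continuous t)
qed

text \<open>Dividing out the exact power of t leaves a factor nonzero at 0, contradicting the bound
  with the next exponent. The hypothesis is one-sided since the curve is estimated for t >= 0
  only.\<close>

lemma poly_eq_zero_if_flat: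
  fixes p :: "real poly"
  assumes "\<tau> > 0" and flat: "\<And>k. \<exists>C. \<forall>t\<in>{0..\<tau>}. \<bar>poly p t\<bar> \<le> C * t ^ k"
  shows "p = 0"
proof (rule ccontr)
  assume "p \<noteq> 0"
  define n where "n = Polynomial.order 0 p"
  obtain r where r: "p = [:- 0, 1:] ^ n * r" "\<not> [:- 0, 1:] dvd r"
    using order_decomp[OF \<open>p \<noteq> 0\<close>, of 0] unfolding n_def by blast
  have r0: "poly r 0 \<noteq> 0" using r(2) by (simp add: poly_eq_0_iff_dvd)
  obtain C where C: "\<forall>t\<in>{0..\<tau>}. \<bar>poly p t\<bar> \<le> C * t ^ Suc n" using flat by blast
  have le: "\<bar>poly r t\<bar> \<le> C * t" if "0 < t" "t \<le> \<tau>" for t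
  proof -
    have "\<bar>t ^ n * poly r t\<bar> \<le> C * t ^ Suc n" using C that r(1) by simp
    then have "t ^ n * \<bar>poly r t\<bar> \<le> t ^ n * (C * t)" using that by (simp add: abs_mult mult_ac)
    then show ?thesis using that by (simp add: mult_le_cancel_left_pos)
  qed
  have "((\<lambda>t. \<bar>poly r t\<bar>) \<longlongrightarrow> \<bar>poly r 0\<bar>) (at_right 0)"
    by (intro tendsto_intros tendsto_poly) 
  moreover have "((\<lambda>t. C * t) \<longlongrightarrow> C * 0) (at_right 0)"
    by (intro tendsto_intros)
  moreover have "eventually (\<lambda>t. \<bar>poly r t\<bar> \<le> C * t) (at_right 0)"
    using eventually_at_right_real[OF \<open>\<tau> > 0\<close>] by eventually_elim (use le in auto)
  ultimately have "\<bar>poly r 0\<bar> \<le> C * 0"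
    by (intro tendsto_le[of "at_right 0"]) auto
  with r0 show False by simp
qed

text \<open>A function in an ideal stable under all derivations coming from the Lie algebra vanishes to
  infinite order along the Cayley curve at \<open>t = 0\<close>, and it is rational on this curve.\<close>

lemma vanishing_on_cayley_curve:
  fixes H :: "(real^('e::finite option)^('e option)) set"
  assumes one: "mat 1 \<in> H" and mult: "\<And>x y. x \<in> H \<Longrightarrow> y \<in> H \<Longrightarrow> x ** y \<in> H"
    and T: "so_Q \<subseteq> tangent_space H"
    and A: "A \<in> so_Q" and f: "f \<in> vanishing H" and t: "t \<in> cayley_domain A"
  shows "f (cayley A t) = 0"
proof -
  obtain \<tau> where \<tau>: "\<tau> > 0" "{0..\<tau>} \<subseteq> cayley_domain A"
  proof -
    obtain \<epsilon> where \<epsilon>: "\<epsilon> > 0" "ball 0 \<epsilon> \<subseteq> cayley_domain A"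
      using open_cayley_domain zero_in_cayley_domain openE by blast
    have "{0..\<epsilon> / 2} \<subseteq> ball 0 \<epsilon>" using \<epsilon>(1) by (auto simp: dist_real_def)
    then show ?thesis using that[of "\<epsilon> / 2"] \<epsilon> by auto
  qed
  have "\<exists>K\<ge>0. \<forall>t\<in>{0..\<tau>}. \<forall>i j. \<bar>cayley_velocity A t $ i $ j\<bar> \<le> K"
  proof -
    have "continuous_on {0..\<tau>} (cayley_velocity A)"
      using cayley_velocity(3)[OF A] \<tau>(2) by (intro continuous_at_imp_continuous_on) blast
    then have "bounded (cayley_velocity A ` {0..\<tau>})"
      by (intro compact_imp_bounded compact_continuous_image) auto
    then obtain K where K: "\<forall>t\<in>{0..\<tau>}. norm (cayley_velocity A t) \<le> K"
      by (auto simp: bounded_iff)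
    have "\<bar>cayley_velocity A t $ i $ j\<bar> \<le> K" if "t \<in> {0..\<tau>}" for t i j
      using K that Finite_Cartesian_Product.norm_nth_le[of "cayley_velocity A t" i] Finite_Cartesian_Product.norm_nth_le[of "cayley_velocity A t $ i" j]
      by fastforce
    moreover have "0 \<le> K" using K[rule_format, of 0] \<tau>(1) by (intro order_trans[OF norm_ge_zero]) simp
    ultimately show ?thesis by blast
  qed
  then obtain K where K: "K \<ge> 0" "\<And>t i j. t \<in> {0..\<tau>} \<Longrightarrow> \<bar>cayley_velocity A t $ i $ j\<bar> \<le> K"
    by blast
  have flat: "\<exists>C. \<forall>t\<in>{0..\<tau>}. \<bar>h (cayley A t)\<bar> \<le> C * t ^ k" if "h \<in> vanishing H" for h k
    using that
  proof (induction k arbitrary: h)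
    case 0
    have "continuous_on {0..\<tau>} (\<lambda>t. h (cayley A t))"
      using mpolys_curve_derivative[OF vanishing_mpolys[OF 0] cayley_has_vector_derivative] \<tau>(2)
      by (intro continuous_at_imp_continuous_on) (blast intro: DERIV_isCont)
    then have "bounded ((\<lambda>t. h (cayley A t)) ` {0..\<tau>})"
      by (intro compact_imp_bounded compact_continuous_image) auto
    then show ?case by (auto simp: bounded_iff)
  next
    case (Suc k)
    \<comment> \<open>Each \<open>D i j\<close> is again an equation of \<open>H\<close>, so the
      bound of order \<open>k\<close> applies to it; the mean value theorem, with \<open>h\<close>
      zero at the identity, then gains one power of t.\<close>
    define D where "D i j x = deriv_at h x (x ** so_Q_gen i j)" for i j x
    have "D i j \<in> vanishing H" for i j
      unfolding D_def
      by (rule tangent_derivation_vanishing[OF mult Suc.prems]) (use T so_Q_gen in auto)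
    then have "\<forall>i j. \<exists>C. \<forall>t\<in>{0..\<tau>}. \<bar>D i j (cayley A t)\<bar> \<le> C * t ^ k"
      using Suc.IH by blast
    then obtain C where C: "\<And>i j t. t \<in> {0..\<tau>} \<Longrightarrow> \<bar>D i j (cayley A t)\<bar> \<le> C i j * t ^ k"
      by metis
    define M where "M = (\<Sum>i\<in>UNIV. \<Sum>j\<in>UNIV. K * \<bar>C i j\<bar>)"
    define F' where "F' t = deriv_at h (cayley A t) (2 *\<^sub>R (resolvent A t ** A ** resolvent A t))" for t
    have hm: "h \<in> mpolys" using Suc.prems by (rule vanishing_mpolys)
    have F: "((\<lambda>t. h (cayley A t)) has_real_derivative F' t) (at t)" if "t \<in> {0..\<tau>}" for t
      unfolding F'_def using that \<tau>(2)
      by (intro mpolys_curve_derivative[OF hm] cayley_has_vector_derivative) auto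
    have F'_le: "\<bar>F' t\<bar> \<le> M * t ^ k" if t: "t \<in> {0..\<tau>}" for t
    proof -
      have tS: "t \<in> cayley_domain A" using t \<tau>(2) by blast
      define V where "V = cayley_velocity A t"
      have "F' t = deriv_at h (cayley A t) (cayley A t ** V)"
        by (simp add: F'_def V_def cayley_velocity(1)[OF A tS])
      also have "cayley A t ** V = (\<Sum>i\<in>UNIV. \<Sum>j\<in>UNIV. (V $ i $ j / 2) *\<^sub>R (cayley A t ** so_Q_gen i j))"
        by (subst so_Q_expansion[of V])
           (simp_all add: V_def cayley_velocity(2)[OF A tS] matrix_mult.sum_right matrix_mult.scaleR_right)
      also have "deriv_at h (cayley A t) \<dots> = (\<Sum>i\<in>UNIV. \<Sum>j\<in>UNIV. (V $ i $ j / 2) * D i j (cayley A t))"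
        by (simp add: linear_sum[OF linear_deriv_at[OF hm]] linear_cmul[OF linear_deriv_at[OF hm]] D_def)
      also have "\<bar>\<dots>\<bar> \<le> (\<Sum>i\<in>UNIV. \<Sum>j\<in>UNIV. \<bar>(V $ i $ j / 2) * D i j (cayley A t)\<bar>)"
        by (rule order_trans[OF sum_abs]) (intro sum_mono sum_abs)
      also have "\<dots> \<le> (\<Sum>i\<in>UNIV. \<Sum>j\<in>UNIV. K * \<bar>C i j\<bar> * t ^ k)"
      proof (intro sum_mono)
        fix i j
        have "\<bar>V $ i $ j / 2\<bar> \<le> K" using K(2)[OF t, of i j] K(1) by (simp add: V_def)
        moreover have "\<bar>D i j (cayley A t)\<bar> \<le> \<bar>C i j\<bar> * t ^ k"
          using C[OF t, of i j] t by (meson abs_ge_self atLeastAtMost_iff mult_right_mono order_trans zero_le_power)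
        ultimately have "\<bar>V $ i $ j / 2\<bar> * \<bar>D i j (cayley A t)\<bar> \<le> K * (\<bar>C i j\<bar> * t ^ k)"
          using K(1) by (intro mult_mono) auto
        then show "\<bar>V $ i $ j / 2 * D i j (cayley A t)\<bar> \<le> K * \<bar>C i j\<bar> * t ^ k"
          by (simp add: abs_mult mult.assoc)
      qed
      also have "\<dots> = M * t ^ k" by (simp add: M_def sum_distrib_right)
      finally show ?thesis .
    qed
    have M: "0 \<le> M" using K(1) by (simp add: M_def sum_nonneg)
    have "\<bar>h (cayley A t)\<bar> \<le> M * t ^ Suc k" if t: "t \<in> {0..\<tau>}" for t
    proof (cases "t = 0")
      case True
      then show ?thesis using vanishingD[OF Suc.prems one] by simp
    next
      case False
      then have "0 < t" using t by simp
      have "\<exists>z. 0 < z \<and> z < t \<and> h (cayley A t) - h (cayley A 0) = (t - 0) * F' z"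
        by (rule MVT2[OF \<open>0 < t\<close>]) (use F t in auto)
      then obtain z where z: "0 < z" "z < t" "h (cayley A t) = t * F' z"
        using vanishingD[OF Suc.prems one] by auto
      have "\<bar>F' z\<bar> \<le> M * z ^ k" using F'_le z t by auto
      also have "\<dots> \<le> M * t ^ k" using z M by (intro mult_left_mono power_mono) auto
      finally have "t * \<bar>F' z\<bar> \<le> t * (M * t ^ k)" using \<open>0 < t\<close> by simp
      then show ?thesis using z(3) \<open>0 < t\<close> by (simp add: abs_mult mult_ac)
    qed
    then show ?case by blast
  qed
  obtain q p where q: "\<forall>t. det (mat 1 - t *\<^sub>R A) = poly q t"
    and p: "\<forall>t\<in>cayley_domain A. \<forall>i j. poly q t * resolvent A t $ i $ j = poly (p i j) t"
    using resolvent_rational by blast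
  have "\<exists>d r. \<forall>t\<in>cayley_domain A. poly q t ^ d * f (cayley A t) = poly r t"
  proof (rule mpolys_rational_curve[OF vanishing_mpolys[OF f]])
    fix i j
    have "poly q t * cayley A t $ i $ j = poly (smult 2 (p i j) - smult (mat 1 $ i $ j) q) t"
      if "t \<in> cayley_domain A" for t
      using p[rule_format, OF that, of i j] by (simp add: cayley_def algebra_simps)
    then show "\<exists>r. \<forall>t\<in>cayley_domain A. poly q t * cayley A t $ i $ j = poly r t" by blast
  qed
  then obtain d r where r: "\<And>t. t \<in> cayley_domain A \<Longrightarrow> poly q t ^ d * f (cayley A t) = poly r t"
    by blast
  have "r = 0"
  proof (rule poly_eq_zero_if_flat[OF \<tau>(1)])
    fix k
    obtain C where C: "\<And>t. t \<in> {0..\<tau>} \<Longrightarrow> \<bar>f (cayley A t)\<bar> \<le> C * t ^ k" using flat[OF f] by blast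
    have "bounded (poly q ` {0..\<tau>})"
      by (intro compact_imp_bounded compact_continuous_image continuous_intros) auto
    then have "\<exists>L. \<forall>t\<in>{0..\<tau>}. \<bar>poly q t\<bar> \<le> L" by (simp add: bounded_iff)
    then obtain L where L: "\<And>t. t \<in> {0..\<tau>} \<Longrightarrow> \<bar>poly q t\<bar> \<le> L" by blast
    have "\<bar>poly r t\<bar> \<le> (L ^ d * C) * t ^ k" if t: "t \<in> {0..\<tau>}" for t
    proof -
      have "\<bar>poly q t ^ d\<bar> \<le> L ^ d" using L[OF t] by (simp add: power_abs power_mono)
      then have "\<bar>poly q t ^ d\<bar> * \<bar>f (cayley A t)\<bar> \<le> L ^ d * (C * t ^ k)"
        using C[OF t] by (intro mult_mono) auto
      then show ?thesis using r[of t] t \<tau>(2) by (auto simp: abs_mult[symmetric] mult.assoc)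
    qed
    then show "\<exists>C. \<forall>t\<in>{0..\<tau>}. \<bar>poly r t\<bar> \<le> C * t ^ k" by blast
  qed
  \<comment> \<open>As \<open>r\<close> is zero as a polynomial, the conclusion reaches the whole
    domain and not only the interval on which flatness was shown.\<close>
  then show ?thesis using r[OF t] q t by (simp add: cayley_domain_def)
qed

text \<open>Inverse of the Cayley transform: solving x = 2 (1 - A)^-1 - 1 gives A = 1 - 2 (1 +
  x)^-1, with \<open>Y\<close> the inverse of \<open>mat 1 + x\<close>. Skewness of \<open>A\<close>
  amounts to \<open>form_adjoint Y = mat 1 - Y\<close>.\<close>

lemma SO_Q_eq_cayley:
  fixes x :: "real^('e::finite option)^('e option)"
  assumes x: "x \<in> SO_Q" and "det (mat 1 + x) \<noteq> 0"
  shows "\<exists>A\<in>so_Q. 1 \<in> cayley_domain A \<and> x = cayley A 1"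
proof -
  have "invertible (mat 1 + x)" using assms(2) by (simp add: invertible_det_nz)
  then obtain Y where Y: "(mat 1 + x) ** Y = mat 1" "Y ** (mat 1 + x) = mat 1"
    by (auto simp: invertible_def)
  define A where "A = mat 1 - 2 *\<^sub>R Y"
  have "form_adjoint Y = mat 1 - Y"
  proof -
    have "form_adjoint (mat 1 + x) ** (mat 1 - Y) = mat 1"
    proof -
      have "mat 1 - Y = x ** Y" using Y(1) by (simp add: matrix_mult.add_left algebra_simps)
      moreover have "form_adjoint (mat 1 + x) ** x = mat 1 + x"
        using SO_Q_D(1)[OF x] by (simp add: form_adjoint_add matrix_mult.add_left)
      ultimately show ?thesis using Y(1) by (simp add: matrix_mul_assoc)
    qed
    moreover have "form_adjoint Y ** form_adjoint (mat 1 + x) = mat 1"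
      using Y(1) by (metis form_adjoint_mult form_adjoint_one)
    ultimately show ?thesis by (metis matrix_mul_assoc matrix_mul_lid matrix_mul_rid)
  qed
  then have "form_adjoint A = mat 1 - 2 *\<^sub>R (mat 1 - Y)"
    unfolding A_def form_adjoint_diff form_adjoint_scaleR by simp
  then have A: "A \<in> so_Q"
    by (simp add: so_Q_def A_def vec_eq_iff)
  have L: "(mat 1 - 1 *\<^sub>R A) ** ((1/2) *\<^sub>R (mat 1 + x)) = mat 1"
    using Y(2) by (simp add: A_def matrix_mult.scaleR_left matrix_mult.scaleR_right)
  then have "det (mat 1 - 1 *\<^sub>R A) \<noteq> 0"
    by (metis invertible_det_nz invertible_def matrix_left_right_inverse)
  moreover have "resolvent A 1 = (1/2) *\<^sub>R (mat 1 + x)"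
    unfolding resolvent_def by (rule matrix_inv_unique) (rule L)
  then have "x = cayley A 1" by (simp add: cayley_def)
  ultimately show ?thesis using A by (auto simp: cayley_domain_def)
qed

text \<open>Cayley curves from the identity reach the \<open>x\<close> without eigenvalue -1, which
  need not be the whole component. Connectedness spreads the result: for x and y near a point
  \<open>a\<close> the quotient x^-1 y is of this kind, because det (1 + x^-1 y) = det (x + y) is
  close to det (2 a), which is nonzero.\<close>

theorem SO_Q_0_subset_zariski_closure:
  fixes H :: "(real^('e::finite option)^('e option)) set"
  assumes H: "subgroup H GL" and T: "so_Q \<subseteq> tangent_space H"
  shows "SO_Q_0 \<subseteq> zariski_closure H"
proof
  have one: "mat 1 \<in> H" and mult: "\<And>x y. x \<in> H \<Longrightarrow> y \<in> H \<Longrightarrow> x ** y \<in> H"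
    using H[unfolded subgroup_GL_iff] by blast+
  have cay: "x \<in> zariski_closure H" if x: "x \<in> SO_Q" "det (mat 1 + x) \<noteq> 0" for x
  proof -
    obtain A where "A \<in> so_Q" "1 \<in> cayley_domain A" "x = cayley A 1" using SO_Q_eq_cayley[OF x] by blast
    then show ?thesis using vanishing_on_cayley_curve[OF one mult T] by (auto simp: zariski_closure_def)
  qed
  have id: "mat 1 \<in> (SO_Q :: (real^('e option)^('e option)) set)" by (rule SO_Q_I) simp_all
  fix b :: "real^('e option)^('e option)" assume b: "b \<in> SO_Q_0"
  show "b \<in> zariski_closure H"
  proof (rule connected_induction_simple[where P = "\<lambda>x. x \<in> zariski_closure H" and a = "mat 1"])
    show "connected (SO_Q_0 :: (real^('e option)^('e option)) set)"
      unfolding SO_Q_0_def by (rule connected_connected_component)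
    show "mat 1 \<in> (SO_Q_0 :: (real^('e option)^('e option)) set)"
      unfolding SO_Q_0_def using id by simp
    show "mat 1 \<in> zariski_closure H" using one zariski_closure_subset by blast
    show "b \<in> SO_Q_0" by (rule b)
    fix a :: "real^('e option)^('e option)" assume a: "a \<in> SO_Q_0"
    have sub: "SO_Q_0 \<subseteq> (SO_Q :: (real^('e option)^('e option)) set)"
      unfolding SO_Q_0_def by (rule connected_component_subset)
    have "det (2 *\<^sub>R a) \<noteq> 0"
    proof -
      have "((1/2) *\<^sub>R form_adjoint a) ** (2 *\<^sub>R a) = mat 1"
        using a sub SO_Q_D(1) by (auto simp: matrix_mult.scaleR_left matrix_mult.scaleR_right)
      then show ?thesis
        by (metis invertible_det_nz invertible_def matrix_left_right_inverse)
    qed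
    then obtain \<epsilon> where \<epsilon>: "\<epsilon> > 0" "\<And>z. dist (2 *\<^sub>R a) z < \<epsilon> \<Longrightarrow> det z \<noteq> 0"
      using continuous_at_avoid[OF continuous_det] by blast
    define U where "U = SO_Q_0 \<inter> ball a (\<epsilon> / 2)"
    have "y \<in> zariski_closure H" if xy: "x \<in> U" "y \<in> U" "x \<in> zariski_closure H" for x y
    proof -
      have x: "x \<in> SO_Q" and y: "y \<in> SO_Q" using xy sub by (auto simp: U_def)
      have "dist (2 *\<^sub>R a) (x + y) \<le> dist a x + dist a y"
        using dist_triangle_add[of a a x y] by (simp add: scaleR_2)
      also have "\<dots> < \<epsilon>" using xy by (simp add: U_def)
      finally have d: "det (x + y) \<noteq> 0" by (rule \<epsilon>(2))
      define w where "w = form_adjoint x ** y"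
      have "form_adjoint x ** (x + y) = mat 1 + w"
        using SO_Q_D(1)[OF x] by (simp add: w_def matrix_mult.add_right)
      then have "det (mat 1 + w) = det (x + y)"
        using SO_Q_D(3)[OF x] det_mul[of "form_adjoint x" "x + y"] by (simp add: det_form_adjoint)
      moreover have "w \<in> SO_Q"
        using SO_Q_mult subgroup_SO_Q x y unfolding subgroup_GL_iff
        by (auto simp: w_def matrix_inv_SO_Q[symmetric])
      ultimately have "w \<in> zariski_closure H" using cay d by simp
      with mult xy(3) have "x ** w \<in> zariski_closure H"
        by (rule zariski_closure_mult)
      moreover have "x ** w = y" using SO_Q_D(2)[OF x] by (simp add: w_def matrix_mul_assoc)
      ultimately show ?thesis by simp
    qed
    moreover have "openin (top_of_set SO_Q_0) U" "a \<in> U"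
      using a \<epsilon>(1) by (auto simp: U_def openin_open_Int)
    ultimately show "\<exists>T. openin (top_of_set SO_Q_0) T \<and> a \<in> T \<and>
        (\<forall>x\<in>T. \<forall>y\<in>T. x \<in> zariski_closure H \<longrightarrow> y \<in> zariski_closure H)"
      by blast
  qed
qed


section \<open>Irreducibility of the adjoint representation\<close>

text \<open>Turns membership into scalar equations, to which derivatives and polynomial identities
  can be applied.\<close>

lemma mem_subspace_if_orthogonal:
  fixes T :: "'a::euclidean_space set"
  assumes "subspace T" "\<And>C. (\<forall>y\<in>T. C \<bullet> y = 0) \<Longrightarrow> C \<bullet> x = 0"
  shows "x \<in> T"
proof -
  have "x \<in> T\<^sup>\<bottom>\<^sup>\<bottom>"
    using assms(2) by (simp add: orthogonal_comp_def orthogonal_def inner_commute)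
  then show ?thesis using orthogonal_comp_self[OF assms(1)] by simp
qed

text \<open>The derivative at 0 of \<open>cayley B t ** A ** form_adjoint (cayley B t)\<close> is
  twice the bracket, as the Cayley curve leaves the identity with velocity 2 B.\<close>

lemma Ad_invariant_imp_ad_invariant:
  fixes T :: "(real^('e::finite option)^('e option)) set"
  assumes T: "subspace T" and Ad: "\<And>x A. x \<in> SO_Q \<Longrightarrow> A \<in> T \<Longrightarrow> x ** A ** form_adjoint x \<in> T"
    and B: "B \<in> so_Q" and A: "A \<in> T"
  shows "B ** A - A ** B \<in> T"
proof (rule mem_subspace_if_orthogonal[OF T])
  fix C assume C: "\<forall>y\<in>T. C \<bullet> y = 0"
  define M where "M t = cayley B t ** A ** form_adjoint (cayley B t)" for t
  have "resolvent B 0 = mat 1" unfolding resolvent_def by (rule matrix_inv_unique) simp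
  then have c: "(cayley B has_vector_derivative 2 *\<^sub>R B) (at 0)"
    using cayley_has_vector_derivative[OF zero_in_cayley_domain, of B] by simp
  have "((\<lambda>t. form_adjoint (cayley B t)) has_vector_derivative form_adjoint (2 *\<^sub>R B)) (at 0)"
    using bounded_linear.has_vector_derivative[OF _ c] linear_form_adjoint linear_conv_bounded_linear
    by blast
  then have c': "((\<lambda>t. form_adjoint (cayley B t)) has_vector_derivative - (2 *\<^sub>R B)) (at 0)"
    using B unfolding form_adjoint_scaleR by (simp add: so_Q_def)
  have "((\<lambda>t. cayley B t ** A) has_vector_derivative (2 *\<^sub>R B) ** A) (at 0)"
    using matrix_mult.has_vector_derivative[OF c has_vector_derivative_const[of A]] by simp
  from matrix_mult.has_vector_derivative[OF this c']
  have "(M has_vector_derivative 2 *\<^sub>R (B ** A - A ** B)) (at 0)"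
    by (simp add: M_def[abs_def] matrix_mult.scaleR_left matrix_mult.scaleR_right
        matrix_mult.minus_right scaleR_diff_right algebra_simps)
  then have "((\<lambda>t. C \<bullet> M t) has_vector_derivative C \<bullet> (2 *\<^sub>R (B ** A - A ** B))) (at 0)"
    by (rule bounded_linear.has_vector_derivative[OF bounded_linear_inner_right])
  moreover have "((\<lambda>t. C \<bullet> M t) has_vector_derivative 0) (at 0)"
  proof (rule has_vector_derivative_transform_within_open[OF has_vector_derivative_const[of 0]
        open_cayley_domain zero_in_cayley_domain])
    fix t assume "t \<in> cayley_domain B"
    then have "M t \<in> T" unfolding M_def by (intro Ad cayley_in_SO_Q B A)
    then show "0 = C \<bullet> M t" using C by simp
  qed
  ultimately have "C \<bullet> (2 *\<^sub>R (B ** A - A ** B)) = 0"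
    by (rule vector_derivative_unique_at)
  then show "C \<bullet> (B ** A - A ** B) = 0" by simp
qed

section \<open>The exterior square model of the Lie algebra\<close>

lemma bform_simps:
  fixes u v w :: "real^('e::finite option)"
  shows "bform (u + w) v = bform u v + bform w v" "bform v (u + w) = bform v u + bform v w"
    "bform (u - w) v = bform u v - bform w v" "bform v (u - w) = bform v u - bform v w"
    "bform (- u) v = - bform u v" "bform u (- v) = - bform u v"
    "bform (c *\<^sub>R u) v = c * bform u v" "bform u (c *\<^sub>R v) = c * bform u v"
    "bform 0 v = 0" "bform v 0 = 0"
  by (simp_all add: bform_def algebra_simps sum.distrib sum_subtractf sum_distrib_left sum_negf)

lemma so_Q_bform:
  fixes A :: "real^('e::finite option)^('e option)"
  assumes "A \<in> so_Q"
  shows "bform (A *v u) v = - bform u (A *v v)" "bform (A *v u) u = 0" "bform u (A *v u) = 0"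
proof -
  have "(- A) *v v = - (A *v v)" for v
    by (simp add: vec_eq_iff matrix_vector_mult_def sum_negf)
  then show skew: "bform (A *v u) v = - bform u (A *v v)" for u v
    using assms by (simp add: bform_adjoint so_Q_def bform_simps)
  from skew[of u u] show "bform (A *v u) u = 0" "bform u (A *v u) = 0"
    using bform_commute[of "A *v u" u] by linarith+
qed

text \<open>The isomorphism from the exterior square to the Lie algebra; \<open>form_sign\<close>
  turns the second index into a covector, as \<open>wedge_mult_vec\<close> makes visible.\<close>

definition wedge :: "real^('e::finite option) \<Rightarrow> real^('e option) \<Rightarrow> real^('e option)^('e option)" where
  "wedge u v = (\<chi> i j. form_sign j * (v $ i * u $ j - u $ i * v $ j))"

lemma wedge_in_so_Q: "wedge u v \<in> so_Q"
  by (simp add: so_Q_def wedge_def form_adjoint_def vec_eq_iff algebra_simps)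

lemma wedge_mult_vec: "wedge u v *v x = bform u x *\<^sub>R v - bform v x *\<^sub>R u"
  by (simp add: vec_eq_iff wedge_def matrix_vector_mult_def bform_def sum_distrib_left
      sum_distrib_right sum_subtractf algebra_simps)

lemma wedge_simps:
  "wedge u u = 0" "wedge v u = - wedge u v"
  "wedge (u + w) v = wedge u v + wedge w v" "wedge v (u + w) = wedge v u + wedge v w"
  "wedge (u - w) v = wedge u v - wedge w v" "wedge v (u - w) = wedge v u - wedge v w"
  "wedge (c *\<^sub>R u) v = c *\<^sub>R wedge u v" "wedge u (c *\<^sub>R v) = c *\<^sub>R wedge u v"
  "wedge 0 v = 0" "wedge v 0 = 0" "wedge (- u) v = - wedge u v" "wedge u (- v) = - wedge u v"
  by (simp_all add: wedge_def vec_eq_iff algebra_simps)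

text \<open>The bracket acts on wedges as a derivation, so brackets of matrices reduce to
  computations with vectors.\<close>

lemma bracket_wedge:
  assumes "A \<in> so_Q"
  shows "A ** wedge u v - wedge u v ** A = wedge (A *v u) v + wedge u (A *v v)"
proof -
  have "(A ** wedge u v - wedge u v ** A) *v x = (wedge (A *v u) v + wedge u (A *v v)) *v x" for x
    by (simp add: matrix_vector_mult_diff_rdistrib matrix_vector_mult_add_rdistrib wedge_mult_vec
        matrix_vector_mul_assoc[symmetric] so_Q_bform(1)[OF assms] matrix_vector_mult_diff_distrib
        matrix_vector_mult_scaleR)
  then show ?thesis by (simp add: matrix_eq)
qed

lemma so_Q_gen_eq_wedge: "so_Q_gen i j = form_sign j *\<^sub>R wedge (axis j 1) (axis i 1)"
  by (simp add: vec_eq_iff so_Q_gen_def wedge_def form_adjoint_def unit_matrix_def axis_def algebra_simps)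

lemma so_Q_subset_if_wedges:
  fixes T :: "(real^('e::finite option)^('e option)) set"
  assumes "subspace T" "\<And>u v. wedge u v \<in> T"
  shows "so_Q \<subseteq> T"
proof
  fix B :: "real^('e option)^('e option)" assume "B \<in> so_Q"
  then have "B = (\<Sum>i\<in>UNIV. \<Sum>j\<in>UNIV. (B $ i $ j / 2) *\<^sub>R so_Q_gen i j)"
    by (rule so_Q_expansion)
  also have "\<dots> \<in> T"
    unfolding so_Q_gen_eq_wedge by (intro subspace_sum subspace_mul assms)
  finally show "B \<in> T" .
qed

text \<open>A hyperbolic pair \<open>p, m\<close> with orthogonal complement \<open>W\<close> grades the Lie algebra as
  \<open>p \<and> W\<close>, \<open>\<langle>p \<and> m\<rangle> + W \<and> W\<close>, \<open>m \<and> W\<close>. This yields irreducibility over the reals in all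
  dimensions, including \<open>n = 3\<close> where the complexified algebra is not simple.\<close>

locale hyperbolic_pair =
  fixes T :: "(real^('e::finite option)^('e option)) set" and p m :: "real^('e option)"
  assumes subspace: "subspace T"
    and ad: "\<And>A B. A \<in> T \<Longrightarrow> B \<in> so_Q \<Longrightarrow> B ** A - A ** B \<in> T"
    and pm: "bform p p = 0" "bform m m = 0" "bform p m = -2"
    and anisotropic: "\<And>v. bform p v = 0 \<Longrightarrow> bform m v = 0 \<Longrightarrow> bform v v = 0 \<Longrightarrow> v = 0"
begin

definition W :: "(real^('e option)) set" where
  "W = {v. bform p v = 0 \<and> bform m v = 0}"

lemma mp: "bform m p = -2"
  using pm(3) by (simp add: bform_commute)

lemma W_D: "v \<in> W \<Longrightarrow> bform p v = 0" "v \<in> W \<Longrightarrow> bform m v = 0"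
  "v \<in> W \<Longrightarrow> bform v p = 0" "v \<in> W \<Longrightarrow> bform v m = 0"
  by (auto simp: W_def bform_commute)

lemma decompose: "\<exists>a b w. w \<in> W \<and> x = a *\<^sub>R p + b *\<^sub>R m + w"
  by (rule exI[of _ "- bform m x / 2"], rule exI[of _ "- bform p x / 2"],
      rule exI[of _ "x - (- bform m x / 2) *\<^sub>R p - (- bform p x / 2) *\<^sub>R m"])
     (simp add: W_def bform_simps pm mp)

lemma bracket_mem: "wedge u v \<in> T \<Longrightarrow> A \<in> so_Q \<Longrightarrow> wedge (A *v u) v + wedge u (A *v v) \<in> T"
  using ad bracket_wedge by metis

lemma mem_if_scaleR_mem: "c *\<^sub>R x \<in> T \<Longrightarrow> c \<noteq> 0 \<Longrightarrow> x \<in> T"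
  using subspace_mul[OF subspace, of "c *\<^sub>R x" "1 / c"] by simp

text \<open>Bracketing with \<open>wedge m v\<close> gives a multiple of \<open>wedge p m\<close>,
  nonzero because \<open>W\<close> is anisotropic. This grading element yields p \<and> W and m
  \<and> W, and brackets between these two give W \<and> W.\<close>

lemma wedge_pW_imp_full:
  assumes "v \<in> W" "v \<noteq> 0" "wedge p v \<in> T"
  shows "so_Q \<subseteq> T"
proof -
  note W_D[simp] pm[simp] mp[simp] wedge_mult_vec[simp] wedge_simps(1,3-12)[simp]
  have vv: "bform v v \<noteq> 0" using assms W_D anisotropic by blast
  have "wedge (wedge m v *v p) v + wedge p (wedge m v *v v) \<in> T"
    by (intro bracket_mem assms wedge_in_so_Q)
  moreover have "wedge (wedge m v *v p) v + wedge p (wedge m v *v v) = - (bform v v *\<^sub>R wedge p m)"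
    using assms(1) by simp
  ultimately have "- bform v v *\<^sub>R wedge p m \<in> T" by simp
  then have 0: "wedge p m \<in> T" using vv mem_if_scaleR_mem[of "- bform v v" "wedge p m"] by simp
  have 1: "wedge p y \<in> T" if "y \<in> W" for y
  proof (rule mem_if_scaleR_mem)
    have "wedge (wedge p y *v p) m + wedge p (wedge p y *v m) \<in> T"
      by (intro bracket_mem 0 wedge_in_so_Q)
    moreover have "wedge (wedge p y *v p) m + wedge p (wedge p y *v m) = -2 *\<^sub>R wedge p y"
      using that by simp
    ultimately show "-2 *\<^sub>R wedge p y \<in> T" by (simp only:)
  qed simp
  have 2: "wedge m y \<in> T" if "y \<in> W" for y
  proof -
    have "wedge (wedge m y *v p) m + wedge p (wedge m y *v m) \<in> T"
      by (intro bracket_mem 0 wedge_in_so_Q)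
    moreover have "wedge (wedge m y *v p) m + wedge p (wedge m y *v m) = -2 *\<^sub>R wedge y m"
      using that by simp
    ultimately have "-2 *\<^sub>R wedge y m \<in> T" by (simp only:)
    then have "wedge y m \<in> T" by (rule mem_if_scaleR_mem) simp
    from subspace_neg[OF subspace this] show ?thesis
      by (simp only: wedge_simps(2)[symmetric])
  qed
  have 3: "wedge y z \<in> T" if "y \<in> W" "z \<in> W" for y z
  proof -
    have "wedge (wedge m y *v p) z + wedge p (wedge m y *v z) \<in> T"
      by (intro bracket_mem 1 that wedge_in_so_Q)
    then have "-2 *\<^sub>R wedge y z - bform y z *\<^sub>R wedge p m \<in> T" using that by simp
    then have "-2 *\<^sub>R wedge y z - bform y z *\<^sub>R wedge p m + bform y z *\<^sub>R wedge p m \<in> T"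
      by (intro subspace_add[OF subspace] subspace_mul[OF subspace] 0)
    then have "-2 *\<^sub>R wedge y z \<in> T" by (simp only: diff_add_cancel)
    then show ?thesis by (rule mem_if_scaleR_mem) simp
  qed
  have sym: "wedge y x \<in> T" if "wedge x y \<in> T" for x y
    using subspace_neg[OF subspace that] wedge_simps(2)[of y x] by simp
  have all: "wedge x y \<in> T" if "wedge x p \<in> T" "wedge x m \<in> T" "\<And>w. w \<in> W \<Longrightarrow> wedge x w \<in> T" for x y
  proof -
    obtain a b w where y: "w \<in> W" "y = a *\<^sub>R p + b *\<^sub>R m + w" using decompose by blast
    have "a *\<^sub>R wedge x p + b *\<^sub>R wedge x m + wedge x w \<in> T"
      using that y by (intro subspace_add[OF subspace] subspace_mul[OF subspace]) auto
    then show ?thesis by (simp add: y)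
  qed
  have zero: "0 \<in> T" using subspace_0[OF subspace] .
  have "wedge p y \<in> T" "wedge m y \<in> T" for y
    using all[of p y] all[of m y] 0 1 2 sym zero by auto
  moreover have "wedge w y \<in> T" if "w \<in> W" for w y
    using that all[of w y] 1 2 3 sym by auto
  ultimately have "wedge x y \<in> T" for x y
    using all[of x y] sym by blast
  then show ?thesis by (rule so_Q_subset_if_wedges[OF subspace])
qed

text \<open>For \<open>w\<close> a unit vector in \<open>W\<close>, \<open>ad (p \<and> w)\<^sup>2 A\<close> lies in \<open>p \<and> W\<close>.\<close>

lemma eigenvector_or_full:
  assumes A: "A \<in> T" "A \<in> so_Q" and w: "w \<in> W" "bform w w = 1"
  shows "so_Q \<subseteq> T \<or> (\<exists>a. A *v p = a *\<^sub>R p)"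
proof -
  obtain a b v where v: "v \<in> W" "A *v p = a *\<^sub>R p + b *\<^sub>R m + v" using decompose by blast
  have "bform p (A *v p) = 0" using so_Q_bform(3)[OF A(2)] .
  then have b: "b = 0" using v W_D by (simp add: bform_simps pm)
  define X where "X = wedge p w"
  have X: "X \<in> so_Q" by (simp add: X_def wedge_in_so_Q)
  have "- (X ** A - A ** X) \<in> T" using ad[OF A(1) X] subspace_neg[OF subspace] by blast
  then have Y: "wedge (A *v p) w + wedge p (A *v w) \<in> T" (is "?Y \<in> T")
    using bracket_wedge[OF A(2), of p w] by (simp add: X_def)
  have "X ** ?Y - ?Y ** X = (X ** wedge (A *v p) w - wedge (A *v p) w ** X) + (X ** wedge p (A *v w) - wedge p (A *v w) ** X)"
    by (simp add: matrix_mult.add_left matrix_mult.add_right algebra_simps)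
  also have "\<dots> = wedge (X *v (A *v p)) w + wedge (A *v p) (X *v w) + (wedge (X *v p) (A *v w) + wedge p (X *v (A *v w)))"
    by (simp only: bracket_wedge[OF X])
  also have "\<dots> = wedge p (v - (2 * bform w v) *\<^sub>R w)"
  proof -
    have Xp: "X *v p = 0" using w W_D by (simp add: X_def wedge_mult_vec pm)
    have Xw: "X *v w = - p" using w W_D by (simp add: X_def wedge_mult_vec)
    have XAp: "X *v (A *v p) = - bform w v *\<^sub>R p"
      using w W_D v b by (simp add: X_def wedge_mult_vec bform_simps pm)
    have "bform p (A *v w) = - bform w v"
      using so_Q_bform(1)[OF A(2), of p w] v b W_D w by (simp add: bform_simps bform_commute)
    then have XAw: "X *v (A *v w) = - bform w v *\<^sub>R w - bform w (A *v w) *\<^sub>R p"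
      by (simp add: X_def wedge_mult_vec)
    show ?thesis
      unfolding Xp Xw XAp XAw unfolding v(2) b
      using wedge_simps(2)[of v p]
      by (simp add: wedge_simps(1,3-12) so_Q_bform(3)[OF A(2)] algebra_simps)
         (simp add: vec_eq_iff wedge_def algebra_simps)
  qed
  finally have "wedge p (v - (2 * bform w v) *\<^sub>R w) \<in> T"
    using ad[OF Y X] by simp
  moreover have "v - (2 * bform w v) *\<^sub>R w \<in> W"
    using v w by (simp add: W_def bform_simps)
  \<comment> \<open>The vector is the reflection of \<open>v\<close> along the unit vector
    \<open>w\<close>, hence nonzero whenever \<open>v\<close> is.\<close>
  moreover have "v = 0" if "v - (2 * bform w v) *\<^sub>R w = 0"
  proof -
    have "bform w (v - (2 * bform w v) *\<^sub>R w) = - bform w v" by (simp add: bform_simps w)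
    then have "bform w v = 0" using that by (simp add: bform_simps)
    then show ?thesis using that by simp
  qed
  ultimately have "so_Q \<subseteq> T \<or> v = 0" using wedge_pW_imp_full by blast
  then show ?thesis using v b by auto
qed

end

lemma hyperbolic_pair_swap: "hyperbolic_pair T p m \<Longrightarrow> hyperbolic_pair T m p"
  unfolding hyperbolic_pair_def by (simp add: bform_commute)

text \<open>If \<open>T\<close> is not full, \<open>p\<close> and, by symmetry, \<open>m\<close> are
  eigenvectors of \<open>A\<close>. The bracket of \<open>A\<close> with \<open>wedge p v\<close>
  then lies in p \<and> W and must vanish, so \<open>A\<close> is the scalar -a on \<open>W\<close>;
  skewness forces first a, then b to be zero, and \<open>A\<close> would be zero.\<close>

lemma (in hyperbolic_pair) ideal_full:
  assumes A: "A \<in> T" "A \<in> so_Q" "A \<noteq> 0" and w: "w \<in> W" "bform w w = 1"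
  shows "so_Q \<subseteq> T"
proof (rule ccontr)
  assume no: "\<not> so_Q \<subseteq> T"
  interpret swap: hyperbolic_pair T m p by (rule hyperbolic_pair_swap) (rule hyperbolic_pair_axioms)
  have W': "swap.W = W" by (auto simp: W_def swap.W_def)
  obtain a where a: "A *v p = a *\<^sub>R p" using eigenvector_or_full[OF A(1,2) w] no by blast
  obtain b where b: "A *v m = b *\<^sub>R m" using swap.eigenvector_or_full[OF A(1,2)] w no W' by blast
  have Av: "A *v v = - a *\<^sub>R v" if v: "v \<in> W" for v
  proof -
    have AvW: "A *v v \<in> W"
      using so_Q_bform(1)[OF A(2), of p v] so_Q_bform(1)[OF A(2), of m v] a b W_D[OF v]
      by (simp add: W_def bform_simps)
    have "- (wedge p v ** A - A ** wedge p v) \<in> T"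
      using ad[OF A(1) wedge_in_so_Q] subspace_neg[OF subspace] by blast
    then have "wedge p (a *\<^sub>R v + A *v v) \<in> T"
      using bracket_wedge[OF A(2), of p v] by (simp add: a wedge_simps(1,3-12))
    moreover have "a *\<^sub>R v + A *v v \<in> W" using v AvW by (simp add: W_def bform_simps)
    ultimately have "a *\<^sub>R v + A *v v = 0" using wedge_pW_imp_full no by blast
    then show ?thesis by (simp add: add_eq_0_iff)
  qed
  have "a = 0" using so_Q_bform(3)[OF A(2), of w] Av[OF w(1)] w(2) by (simp add: bform_simps)
  moreover have "b = 0"
    using so_Q_bform(1)[OF A(2), of m p] a b \<open>a = 0\<close> by (simp add: bform_simps mp)
  ultimately have zero: "A *v p = 0" "A *v m = 0" "\<And>v. v \<in> W \<Longrightarrow> A *v v = 0"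
    using a b Av by simp_all
  have "A *v x = 0" for x
  proof -
    obtain c d w where "w \<in> W" "x = c *\<^sub>R p + d *\<^sub>R m + w" using decompose by blast
    then show ?thesis using zero by (simp add: matrix_vector_right_distrib matrix_vector_mult_scaleR)
  qed
  then show False using A(3) by (simp add: matrix_eq)
qed

theorem so_Q_irreducible:
  fixes T :: "(real^('d::finite option option)^('d option option)) set"
  assumes T: "subspace T" "T \<subseteq> so_Q" "A \<in> T" "A \<noteq> 0"
    and Ad: "\<And>x A. x \<in> SO_Q \<Longrightarrow> A \<in> T \<Longrightarrow> x ** A ** form_adjoint x \<in> T"
  shows "so_Q \<subseteq> T"
proof -
  \<comment> \<open>The isotropic vectors e_{n+1} + e_n and e_{n+1} - e_n; their orthogonal
    complement is spanned by the other coordinates, where the form is positive definite.\<close>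
  define p m :: "real^('d option option)"
    where "p = axis None 1 + axis (Some None) 1" and "m = axis None 1 - axis (Some None) 1"
  have bp: "bform p v = v $ Some None - v $ None" "bform m v = - v $ Some None - v $ None" for v
    by (simp_all add: p_def m_def bform_simps bform_axis)
  interpret hyperbolic_pair T p m
  proof
    fix v assume v: "bform p v = 0" "bform m v = 0" "bform v v = 0"
    then have v0: "v $ None = 0" "v $ Some None = 0" by (simp_all add: bp)
    have "(\<Sum>a\<in>UNIV. (v $ Some a)\<^sup>2) = 0"
      using v(3) v0 by (simp add: Q_eq_bform[symmetric] Q_def)
    then have "v $ Some a = 0" for a
      by (simp add: sum_nonneg_eq_0_iff)
    then have "v $ i = 0" for i
      using v0 by (cases i) simp_all
    then show "v = 0" by (simp add: vec_eq_iff)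
  qed (use T Ad Ad_invariant_imp_ad_invariant[OF T(1) Ad] in \<open>auto simp: bp\<close>, simp_all add: p_def m_def axis_def)
  \<comment> \<open>A unit vector of \<open>W\<close> exists since \<open>'d\<close> is nonempty,
    that is, n >= 2.\<close>
  define w :: "real^('d option option)" where "w = axis (Some (Some undefined)) 1"
  have "w \<in> W" "bform w w = 1"
    by (simp_all add: W_def bp w_def axis_def bform_axis[unfolded axis_def])
  then show ?thesis using ideal_full T by blast
qed


section \<open>Return trajectory subgroups of orthogonal groups\<close>

lemma mpolys_complexify:
  assumes "f \<in> mpolys"
  shows "\<exists>F\<in>mpolys. \<forall>x. F (complexify x) = complex_of_real (f x)"
  using assms
proof (induction rule: mpoly_funs.induct)
  case (const c)
  show ?case by (rule bexI[of _ "\<lambda>_. complex_of_real c"]) simp_all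
next
  case (entry i j)
  show ?case by (rule bexI[of _ "\<lambda>A. A $ i $ j"]) (simp_all add: map_matrix_def)
next
  case (add f h)
  then obtain F G where "F \<in> mpolys" "\<forall>x. F (complexify x) = complex_of_real (f x)"
    "G \<in> mpolys" "\<forall>x. G (complexify x) = complex_of_real (h x)" by blast
  then show ?case by (intro bexI[of _ "\<lambda>A. F A + G A"]) (simp_all add: mpolys_add)
next
  case (mult f h)
  then obtain F G where "F \<in> mpolys" "\<forall>x. F (complexify x) = complex_of_real (f x)"
    "G \<in> mpolys" "\<forall>x. G (complexify x) = complex_of_real (h x)" by blast
  then show ?case by (intro bexI[of _ "\<lambda>A. F A * G A"]) (simp_all add: mpolys_mult)
qed

lemma mpolys_Re_Im:
  assumes "F \<in> mpolys"
  shows "(\<lambda>x. Re (F (complexify x))) \<in> mpolys \<and> (\<lambda>x. Im (F (complexify x))) \<in> mpolys"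
  using assms
  by (induction rule: mpoly_funs.induct)
     (simp_all add: map_matrix_def mpolys_add mpolys_mult mpolys_minus)

text \<open>On real matrices the real and imaginary parts of a complex equation are real
  polynomials, and both vanish on \<open>H\<close>.\<close>

lemma complexify_zariski_closure:
  assumes "x \<in> zariski_closure H"
  shows "complexify x \<in> zariski_closure (complexify ` H)"
  unfolding zariski_closure_def
proof safe
  fix F assume F: "F \<in> vanishing (complexify ` H)"
  have "(\<lambda>x. Re (F (complexify x))) \<in> vanishing H" "(\<lambda>x. Im (F (complexify x))) \<in> vanishing H"
    using F mpolys_Re_Im[of F] by (simp_all add: vanishing_def)
  then have "Re (F (complexify x)) = 0" "Im (F (complexify x)) = 0"
    using assms by (auto simp: zariski_closure_def)
  then show "F (complexify x) = 0" by (simp add: complex_eq_iff)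
qed

lemma complexify_mult: "complexify (A ** B) = complexify A ** complexify B"
  by (simp add: map_matrix_def matrix_matrix_mult_def vec_eq_iff)

lemma complexify_in_SO_Q:
  fixes x :: "real^('e::finite option)^('e option)"
  assumes "x \<in> SO_Q"
  shows "complexify x \<in> SO_Q"
proof (rule SO_Q_I)
  have "form_adjoint (complexify x) = complexify (form_adjoint x)"
    by (auto simp: form_adjoint_def map_matrix_def vec_eq_iff form_sign_def split: option.splits)
  then have "form_adjoint (complexify x) ** complexify x = complexify (mat 1)"
    by (simp add: complexify_mult[symmetric] SO_Q_D(1)[OF assms])
  also have "\<dots> = mat 1" by (simp add: map_matrix_def mat_def vec_eq_iff)
  finally show "form_adjoint (complexify x) ** complexify x = mat 1" .
  have "det (complexify x) = complex_of_real (det x)"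
    by (simp add: det_def map_matrix_def)
  then show "det (complexify x) = 1" by (simp add: SO_Q_D[OF assms])
qed

text \<open>A real equation of \<open>G\<close> extends to a complex polynomial with the same values
  on real points.\<close>

lemma SO_Q_subset_real_zariski_closure:
  fixes G :: "(real^('e::finite option)^('e option)) set"
  assumes "zariski_dense_in (complexify ` G) SO_Q"
  shows "SO_Q \<subseteq> zariski_closure G"
  unfolding zariski_closure_def
proof safe
  fix x f assume x: "x \<in> (SO_Q :: (real^('e option)^('e option)) set)" and f: "f \<in> vanishing G"
  obtain F where F: "F \<in> mpolys" "\<forall>x. F (complexify x) = complex_of_real (f x)"
    using mpolys_complexify[OF vanishing_mpolys[OF f]] by blast
  then have "F \<in> vanishing (complexify ` G)" using f by (auto simp: vanishing_def)
  moreover have "complexify x \<in> zariski_closure (complexify ` G)"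
    using assms complexify_in_SO_Q[OF x] by (simp add: zariski_dense_in_iff)
  ultimately have "F (complexify x) = 0" by (simp add: zariski_closure_def)
  then show "f x = 0" using F by simp
qed

text \<open>Orthogonality of the conjugate to a fixed \<open>C\<close> is a polynomial condition on
  \<open>x\<close>, because \<open>form_adjoint\<close> is polynomial, and so passes from
  \<open>G\<close> to its closure.\<close>

lemma Ad_invariant_dense:
  fixes T :: "(real^('e::finite option)^('e option)) set"
  assumes T: "subspace T" and G: "SO_Q \<subseteq> zariski_closure G"
    and Ad: "\<And>x A. x \<in> G \<Longrightarrow> A \<in> T \<Longrightarrow> x ** A ** form_adjoint x \<in> T"
    and x: "x \<in> SO_Q" and A: "A \<in> T"
  shows "x ** A ** form_adjoint x \<in> T"
proof (rule mem_subspace_if_orthogonal[OF T])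
  fix C assume C: "\<forall>y\<in>T. C \<bullet> y = 0"
  define f where "f y = C \<bullet> (y ** A ** form_adjoint y)" for y
  have "(\<lambda>y. (y ** A ** form_adjoint y) $ i $ j) \<in> mpolys" for i j
    by (intro mpolys_mat_mult mpolys_entry mpolys_const) (simp add: form_adjoint_entry mpolys_mult)
  then have "f \<in> mpolys"
    unfolding f_def inner_vec_def inner_real_def by (intro mpolys_sum mpolys_mult mpolys_const)
  then have "f \<in> vanishing G"
    using C Ad A by (intro vanishingI) (auto simp: f_def)
  then have "f x = 0" using G x by (auto simp: zariski_closure_def)
  then show "C \<bullet> (x ** A ** form_adjoint x) = 0" by (simp add: f_def)
qed

lemma increasing_subspaces_stabilise:
  fixes T :: "nat \<Rightarrow> 'a::euclidean_space set"
  assumes "\<And>n. subspace (T n)" "\<And>n. T n \<subseteq> T (Suc n)"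
  shows "\<exists>n0. \<forall>n\<ge>n0. T n = T n0"
proof -
  have mono: "T m \<subseteq> T n" if "m \<le> n" for m n
    using assms(2) that by (rule lift_Suc_mono_le)
  have "finite (range (\<lambda>n. dim (T n)))"
    by (rule finite_subset[of _ "{..DIM('a)}"]) (auto simp: dim_subset_UNIV)
  then obtain n0 where n0: "dim (T n0) = Max (range (\<lambda>n. dim (T n)))"
    by (metis (mono_tags, lifting) Max_in empty_not_UNIV image_iff image_is_empty)
  have "T n = T n0" if "n \<ge> n0" for n
  proof -
    have "dim (T n) \<le> dim (T n0)"
      unfolding n0 by (rule Max_ge) (use \<open>finite _\<close> in auto)
    then show ?thesis using subspace_dim_equal[OF assms(1,1) mono[OF that]] by simp
  qed
  then show ?thesis by blast
qed

section \<open>Words, trajectories and their quotients\<close>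

lemma mat_prod_Nil [simp]: "mat_prod [] = mat 1"
  and mat_prod_Cons [simp]: "mat_prod (A # As) = A ** mat_prod As"
  by (simp_all add: mat_prod_def)

lemma mat_prod_append: "mat_prod (As @ Bs) = mat_prod As ** mat_prod Bs"
  by (induction As) (simp_all add: matrix_mul_assoc)

text \<open>Words in product order: the last letter is next to \<open>y\<close> and the first next
  to \<open>z\<close>, so extending a trajectory at \<open>y\<close> appends and extending it at
  \<open>z\<close> prepends.\<close>

definition trajectories :: "nat \<Rightarrow> (nat \<Rightarrow> nat \<Rightarrow> bool) \<Rightarrow> nat \<Rightarrow> nat \<Rightarrow> nat \<Rightarrow> nat list set" where
  "trajectories N R p y z = {as. length as = p \<and> admissible N R (y # rev as @ [z])}"

definition word_quotient :: "(nat \<Rightarrow> 'a::field^'n^'n) \<Rightarrow> nat list \<Rightarrow> nat list \<Rightarrow> 'a^'n^'n" where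
  "word_quotient g as bs = mat_prod (map g as) ** mat_prod (map (\<lambda>b. matrix_inv (g b)) (rev bs))"

lemma return_trajectory_subgroup_eq:
  "return_trajectory_subgroup N R g p y z =
    generate GL {word_quotient g as bs | as bs. as \<in> trajectories N R p y z \<and> bs \<in> trajectories N R p y z}"
  unfolding return_trajectory_subgroup_def trajectories_def word_quotient_def
  by (rule arg_cong[of _ _ "generate GL"]) auto

lemma word_quotient_in_subgroup:
  assumes "as \<in> trajectories N R p y z" "bs \<in> trajectories N R p y z"
  shows "word_quotient g as bs \<in> return_trajectory_subgroup N R g p y z"
  unfolding return_trajectory_subgroup_eq using assms by (intro generate.incl) blast

lemma trajectories_letters: "as \<in> trajectories N R p y z \<Longrightarrow> set as \<subseteq> {1..N}"
  by (auto simp: trajectories_def admissible_def)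

lemma trajectories_snoc:
  "as \<in> trajectories N R p y z \<Longrightarrow> y' \<in> {1..N} \<Longrightarrow> R y' y \<Longrightarrow> as @ [y] \<in> trajectories N R (Suc p) y' z"
  by (auto simp: trajectories_def admissible_def successively_Cons)

lemma trajectories_Cons:
  assumes "as \<in> trajectories N R p y z" "z' \<in> {1..N}" "R z z'"
  shows "z # as \<in> trajectories N R (Suc p) y z'"
proof -
  have "admissible N R (w @ [z'])" if "admissible N R w" "last w = z" for w
    using that assms by (auto simp: admissible_def successively_append_iff)
  from this[of "y # rev as @ [z]"] show ?thesis
    using assms by (simp add: trajectories_def)
qed

text \<open>Equal last letters meet in the middle of the product and cancel, whereas equal first
  letters stay outside and conjugate.\<close>

lemma word_quotient_snoc:
  "invertible (g y) \<Longrightarrow> word_quotient g (as @ [y]) (bs @ [y]) = word_quotient g as bs"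
  by (simp add: word_quotient_def mat_prod_append matrix_mul_assoc)
     (metis matrix_inv(1) matrix_mul_assoc matrix_mul_rid)

lemma word_quotient_Cons:
  "word_quotient g (z # as) (z # bs) = g z ** word_quotient g as bs ** matrix_inv (g z)"
  by (simp add: word_quotient_def mat_prod_append matrix_mul_assoc)

lemma return_trajectory_subgroup_subset:
  fixes g :: "nat \<Rightarrow> 'a::field^'n^'n"
  assumes X: "subgroup X GL" and g: "\<And>i. i \<in> {1..N} \<Longrightarrow> g i \<in> X"
  shows "return_trajectory_subgroup N R g p y z \<subseteq> X"
  unfolding return_trajectory_subgroup_eq
proof (rule group.generate_subgroup_incl[OF group_GL _ X], safe)
  have one: "mat 1 \<in> X" and mult: "\<And>x y. x \<in> X \<Longrightarrow> y \<in> X \<Longrightarrow> x ** y \<in> X"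
    and inv: "\<And>x. x \<in> X \<Longrightarrow> matrix_inv x \<in> X"
    using X[unfolded subgroup_GL_iff] by blast+
  have prod: "mat_prod As \<in> X" if "set As \<subseteq> X" for As
    using that by (induction As) (auto intro: one mult)
  fix as bs assume "as \<in> trajectories N R p y z" "bs \<in> trajectories N R p y z"
  then have "set as \<subseteq> {1..N}" "set bs \<subseteq> {1..N}"
    using trajectories_letters by blast+
  then show "word_quotient g as bs \<in> X"
    unfolding word_quotient_def by (intro mult prod) (auto intro!: g inv)
qed

lemma subgroup_return_trajectory_subgroup:
  fixes g :: "nat \<Rightarrow> 'a::field^'n^'n"
  assumes "\<And>i. i \<in> {1..N} \<Longrightarrow> invertible (g i)"
  shows "subgroup (return_trajectory_subgroup N R g p y z) GL"
  unfolding return_trajectory_subgroup_eq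
proof (rule group.generate_is_subgroup[OF group_GL])
  have "subgroup (carrier GL) (GL :: ('a^'n^'n) monoid)"
    by (rule group.subgroup_self[OF group_GL])
  then have "return_trajectory_subgroup N R g p y z \<subseteq> carrier GL"
    by (rule return_trajectory_subgroup_subset) (simp add: GL_def assms)
  then show "{word_quotient g as bs |as bs. as \<in> trajectories N R p y z \<and> bs \<in> trajectories N R p y z} \<subseteq> carrier GL"
    using word_quotient_in_subgroup by blast
qed

lemma return_trajectory_subgroup_mono:
  fixes g :: "nat \<Rightarrow> 'a::field^'n^'n"
  assumes inv: "\<And>i. i \<in> {1..N} \<Longrightarrow> invertible (g i)"
    and "y \<in> {1..N}" "y' \<in> {1..N}" "R y' y"
  shows "return_trajectory_subgroup N R g p y z \<subseteq> return_trajectory_subgroup N R g (Suc p) y' z"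
  unfolding return_trajectory_subgroup_eq[of N R g p]
proof (rule group.generate_subgroup_incl[OF group_GL _ subgroup_return_trajectory_subgroup[OF inv]], safe)
  fix as bs assume w: "as \<in> trajectories N R p y z" "bs \<in> trajectories N R p y z"
  have "word_quotient g (as @ [y]) (bs @ [y]) \<in> return_trajectory_subgroup N R g (Suc p) y' z"
    using assms w by (intro word_quotient_in_subgroup trajectories_snoc)
  then show "word_quotient g as bs \<in> return_trajectory_subgroup N R g (Suc p) y' z"
    using assms by (simp add: word_quotient_snoc)
qed

text \<open>Lets conjugation into another return trajectory subgroup be checked on generators
  alone.\<close>

lemma subgroup_conj_vimage:
  fixes x :: "'a::field^'n^'n"
  assumes x: "invertible x" and K: "subgroup K GL"
  shows "subgroup {h. invertible h \<and> x ** h ** matrix_inv x \<in> K} GL"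
proof -
  have K': "mat 1 \<in> K" "\<And>x y. x \<in> K \<Longrightarrow> y \<in> K \<Longrightarrow> x ** y \<in> K" "\<And>x. x \<in> K \<Longrightarrow> matrix_inv x \<in> K"
    using K[unfolded subgroup_GL_iff] by blast+
  have cancel: "(x ** h ** matrix_inv x) ** (x ** k ** matrix_inv x) = x ** (h ** k) ** matrix_inv x" for h k
  proof -
    have "(x ** h ** matrix_inv x) ** (x ** k ** matrix_inv x)
      = x ** h ** (matrix_inv x ** x) ** k ** matrix_inv x"
      by (simp only: matrix_mul_assoc)
    then show ?thesis using matrix_inv[OF x] by (simp add: matrix_mul_assoc)
  qed
  have 1: "invertible (mat 1 :: 'a^'n^'n)" by (auto simp: invertible_def)
  show ?thesis
    unfolding subgroup_GL_iff
  proof safe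
    fix h k assume "invertible h" "invertible k" "x ** h ** matrix_inv x \<in> K" "x ** k ** matrix_inv x \<in> K"
    then show "invertible (h ** k)" "x ** (h ** k) ** matrix_inv x \<in> K"
      using K'(2) cancel by (simp_all add: invertible_mult flip: cancel)
  next
    fix h assume h: "invertible h" "x ** h ** matrix_inv x \<in> K"
    show "invertible (matrix_inv h)"
      using matrix_inv[OF h(1)] by (auto simp: invertible_def)
    have "(x ** h ** matrix_inv x) ** (x ** matrix_inv h ** matrix_inv x) = mat 1"
      using matrix_inv[OF h(1)] matrix_inv[OF x] by (simp add: cancel)
    then show "x ** matrix_inv h ** matrix_inv x \<in> K"
      using K'(3)[OF h(2)] matrix_inv_unique by metis
  qed (use K' 1 matrix_inv[OF x] in auto)
qed

lemma return_trajectory_subgroup_conj: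
  fixes g :: "nat \<Rightarrow> 'a::field^'n^'n"
  assumes inv: "\<And>i. i \<in> {1..N} \<Longrightarrow> invertible (g i)"
    and "z \<in> {1..N}" "z' \<in> {1..N}" "R z z'" and h: "h \<in> return_trajectory_subgroup N R g p y z"
  shows "g z ** h ** matrix_inv (g z) \<in> return_trajectory_subgroup N R g (Suc p) y z'"
proof -
  define K where "K = return_trajectory_subgroup N R g (Suc p) y z'"
  have K: "subgroup K GL" unfolding K_def by (rule subgroup_return_trajectory_subgroup[OF inv])
  have "return_trajectory_subgroup N R g p y z \<subseteq> {h. invertible h \<and> g z ** h ** matrix_inv (g z) \<in> K}"
    unfolding return_trajectory_subgroup_eq[of N R g p]
  proof (rule group.generate_subgroup_incl[OF group_GL _ subgroup_conj_vimage[OF inv K]], safe)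
    fix as bs assume w: "as \<in> trajectories N R p y z" "bs \<in> trajectories N R p y z"
    have "subgroup (return_trajectory_subgroup N R g p y z) GL"
      by (rule subgroup_return_trajectory_subgroup[OF inv])
    then show "invertible (word_quotient g as bs)"
      using word_quotient_in_subgroup[OF w] unfolding subgroup_GL_iff by blast
    have "word_quotient g (z # as) (z # bs) \<in> K"
      unfolding K_def using assms w by (intro word_quotient_in_subgroup trajectories_Cons)
    then show "g z ** word_quotient g as bs ** matrix_inv (g z) \<in> K"
      by (simp add: word_quotient_Cons)
  qed (rule assms)
  then show ?thesis using h by (auto simp: K_def)
qed

text \<open>The relation \<open>R\<close> is abstract to isolate what admissibility contributes:
  repetition of a letter gives increasing chains, symmetry and paths of length two make all
  endpoints equivalent. One infinite group, of any length and endpoints, provides a nonzero tangent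
  vector.\<close>

theorem return_trajectory_subgroups_dense:
  fixes g :: "nat \<Rightarrow> real^('d::finite option option)^('d option option)"
  assumes g0: "\<And>i. i \<in> {1..N} \<Longrightarrow> g i \<in> SO_Q_0"
    and dense: "zariski_dense_in (complexify ` semigroup_gen (g ` {1..N})) SO_Q"
    and refl: "\<And>a. R a a" and sym: "\<And>a b. R a b \<Longrightarrow> R b a"
    and connected: "\<And>a b. a \<in> {1..N} \<Longrightarrow> b \<in> {1..N} \<Longrightarrow> \<exists>c\<in>{1..N}. R a c \<and> R c b"
    and inf: "y0 \<in> {1..N}" "z0 \<in> {1..N}" "infinite (return_trajectory_subgroup N R g p0 y0 z0)"
    and yz: "y \<in> {1..N}" "z \<in> {1..N}"
  shows "\<exists>p0\<ge>1. \<forall>p>p0. zariski_dense_in (complexify ` return_trajectory_subgroup N R g p y z) SO_Q"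
proof -
  have "SO_Q_0 \<subseteq> (SO_Q :: (real^('d option option)^('d option option)) set)"
    unfolding SO_Q_0_def by (rule connected_component_subset)
  then have g: "g i \<in> SO_Q" if "i \<in> {1..N}" for i using g0[OF that] by blast
  then have inv: "invertible (g i)" if "i \<in> {1..N}" for i
    using subgroup_SO_Q that unfolding subgroup_GL_iff by blast
  define H where "H p y z = return_trajectory_subgroup N R g p y z" for p y z
  have H: "subgroup (H p y z) GL" for p y z
    unfolding H_def by (rule subgroup_return_trajectory_subgroup[OF inv])
  have HSO: "H p y z \<subseteq> SO_Q" for p y z
    unfolding H_def by (rule return_trajectory_subgroup_subset[OF subgroup_SO_Q g])
  define T where "T p y z = tangent_space (H p y z)" for p y z
  have T: "subspace (T p y z)" for p y z by (simp add: T_def subspace_tangent_space)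
  have T_mono: "T p y z \<subseteq> T (Suc p) y' z" if "y \<in> {1..N}" "y' \<in> {1..N}" "R y y'" for p y y' z
    unfolding T_def H_def
    by (rule tangent_space_mono, rule return_trajectory_subgroup_mono[OF inv]) (use that sym in auto)
  have T_conj: "g z ** A ** form_adjoint (g z) \<in> T (Suc p) y z'"
    if "z \<in> {1..N}" "z' \<in> {1..N}" "R z z'" "A \<in> T p y z" for p y z z' A
  proof -
    have "g z ** A ** matrix_inv (g z) \<in> T (Suc p) y z'"
      unfolding T_def
    proof (rule tangent_space_conj[of _ _ "H p y z"])
      show "A \<in> tangent_space (H p y z)" using that by (simp add: T_def)
      show "g z ** h ** matrix_inv (g z) \<in> H (Suc p) y z'" if "h \<in> H p y z" for h
        using that unfolding H_def
        by (intro return_trajectory_subgroup_conj[OF inv]) (use \<open>z \<in> _\<close> \<open>z' \<in> _\<close> \<open>R z z'\<close> in auto)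
    qed (rule matrix_inv(1)[OF inv[OF that(1)]])
    then show ?thesis using matrix_inv_SO_Q[OF g[OF that(1)]] by simp
  qed
  \<comment> \<open>The union over \<open>p\<close> absorbs the shift of length by one; it is a
    subspace because the chain is eventually constant.\<close>
  define U where "U y z = (\<Union>p. T p y z)" for y z
  have stable: "\<exists>n. \<forall>p\<ge>n. T p y z = U y z" if "y \<in> {1..N}" for y z
  proof -
    have mono: "T p y z \<subseteq> T (Suc p) y z" for p using T_mono[OF that that refl] .
    obtain n where n: "\<forall>p\<ge>n. T p y z = T n y z"
      using increasing_subspaces_stabilise[of "\<lambda>p. T p y z", OF T mono] by blast
    have "T p y z \<subseteq> T n y z" for p
    proof -
      have "T p y z \<subseteq> T (max n p) y z"
        by (rule lift_Suc_mono_le[of "\<lambda>p. T p y z", OF mono]) simp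
      then show ?thesis using n[rule_format, of "max n p"] by simp
    qed
    then have "U y z = T n y z" unfolding U_def by blast
    then show ?thesis using n by blast
  qed
  have U: "subspace (U y z)" if "y \<in> {1..N}" for y z
    using stable[OF that, of z] T by (metis le_refl)
  have U_y: "U y z \<subseteq> U y' z" if yy: "y \<in> {1..N}" "y' \<in> {1..N}" for y y' z
  proof -
    have step: "U a z \<subseteq> U b z" if "a \<in> {1..N}" "b \<in> {1..N}" "R a b" for a b
      using T_mono[OF that] unfolding U_def by blast
    obtain c where "c \<in> {1..N}" "R y c" "R c y'" using connected[OF yy] by blast
    then show ?thesis using step[of y c] step[of c y'] yy by blast
  qed
  have U_conj: "g z ** A ** form_adjoint (g z) \<in> U y z'"
    if "z \<in> {1..N}" "z' \<in> {1..N}" "R z z'" "A \<in> U y z" for y z z' A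
    using that T_conj[OF that(1-3)] unfolding U_def by blast
  have U_step: "U y z \<subseteq> U y z'" if "y \<in> {1..N}" "z \<in> {1..N}" "z' \<in> {1..N}" "R z z'" for y z z'
  proof -
    define L where "L A = g z ** A ** form_adjoint (g z)" for A
    have L: "linear L" unfolding L_def
      by (auto intro!: linearI simp: matrix_mult.add_left matrix_mult.add_right
        matrix_mult.scaleR_left matrix_mult.scaleR_right)
    have "inj L"
    proof (rule inj_on_inverseI)
      fix A
      have "form_adjoint (g z) ** L A ** g z = (form_adjoint (g z) ** g z) ** A ** (form_adjoint (g z) ** g z)"
        by (simp only: L_def matrix_mul_assoc)
      then show "form_adjoint (g z) ** L A ** g z = A" using SO_Q_D(1)[OF g[OF that(2)]] by simp
    qed
    have sub: "L ` U y z \<subseteq> U y z"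
      using U_conj[OF that(2,2) refl] by (auto simp: L_def)
    have "L ` U y z = U y z"
    proof (rule subspace_dim_equal)
      show "dim (L ` U y z) \<ge> dim (U y z)"
        using dim_image_eq[OF L, of "U y z"] \<open>inj L\<close> by (simp add: inj_on_subset)
    qed (use U[OF that(1)] linear_subspace_image[OF L] sub in auto)
    moreover have "L ` U y z \<subseteq> U y z'"
      using U_conj[OF that(2-4)] by (auto simp: L_def)
    ultimately show ?thesis by simp
  qed
  have U_z: "U y z \<subseteq> U y z'" if yzz: "y \<in> {1..N}" "z \<in> {1..N}" "z' \<in> {1..N}" for y z z'
  proof -
    obtain c where "c \<in> {1..N}" "R z c" "R c z'" using connected[OF yzz(2,3)] by blast
    then show ?thesis using U_step[of y z c] U_step[of y c z'] yzz by blast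
  qed
  define V where "V = U y z"
  have V: "U y' z' = V" if "y' \<in> {1..N}" "z' \<in> {1..N}" for y' z'
    unfolding V_def using U_y U_z that yz by (meson subset_antisym subset_trans)
  have subV: "subspace V" unfolding V_def by (rule U[OF yz(1)])
  have "x ** A ** form_adjoint x \<in> V" if "x \<in> semigroup_gen (g ` {1..N})" "A \<in> V" for x A
    using that
  proof (induction arbitrary: A rule: semigroup_gen.induct)
    case (gen x)
    then obtain i where i: "i \<in> {1..N}" "x = g i" by blast
    then show ?case using U_conj[OF i(1) i(1) refl, of A y] V[OF yz(1) i(1)] gen.prems by simp
  next
    case (prod x x')
    have "x ** (x' ** A ** form_adjoint x') ** form_adjoint x \<in> V" using prod by blast
    then show ?case by (simp add: form_adjoint_mult matrix_mul_assoc)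
  qed
  then have Ad: "x ** A ** form_adjoint x \<in> V" if "x \<in> SO_Q" "A \<in> V" for x A
    using Ad_invariant_dense[OF subV SO_Q_subset_real_zariski_closure[OF dense]] that by blast
  have V_so: "V \<subseteq> so_Q"
    unfolding V_def U_def T_def using tangent_space_SO_Q[OF HSO] by blast
  have "T p0 y0 z0 \<noteq> {0}"
    using trivial_tangent_space_imp_finite[OF H] inf(3) by (auto simp: T_def H_def)
  then obtain A where "A \<in> V" "A \<noteq> 0"
    using V[OF inf(1,2)] subspace_0[OF T] by (auto simp: U_def)
  then have "so_Q \<subseteq> V" using so_Q_irreducible[OF subV V_so] Ad by blast
  obtain n where n: "\<forall>p\<ge>n. T p y z = V" using stable[OF yz(1)] by (auto simp: V_def)
  have "zariski_dense_in (complexify ` H p y z) SO_Q" if "p \<ge> n" for p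
  proof (rule zariski_dense_in_trans[OF dense])
    show "complexify ` H p y z \<subseteq> SO_Q"
      using HSO complexify_in_SO_Q by blast
    have mult: "\<And>a b. a \<in> H p y z \<Longrightarrow> b \<in> H p y z \<Longrightarrow> a ** b \<in> H p y z"
      using H[unfolded subgroup_GL_iff] by blast
    \<comment> \<open>Only the identity component is reached; the generators lie in it and the
      closure is closed under products.\<close>
    have SO: "SO_Q_0 \<subseteq> zariski_closure (H p y z)"
      using SO_Q_0_subset_zariski_closure[OF H] n that \<open>so_Q \<subseteq> V\<close> by (auto simp: T_def)
    have "x \<in> zariski_closure (H p y z)" if "x \<in> semigroup_gen (g ` {1..N})" for x
      using that
    proof induction
      case (gen x)
      then show ?case using g0 SO by blast
    next
      case (prod x x')
      with mult show ?case by (intro zariski_closure_mult)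
    qed
    then show "complexify ` semigroup_gen (g ` {1..N}) \<subseteq> zariski_closure (complexify ` H p y z)"
      using complexify_zariski_closure by blast
  qed
  then show ?thesis unfolding H_def by (intro exI[of _ "max 1 n"]) simp
qed


section \<open>The Schottky setting\<close>

text \<open>The resolvent is an affine function of the Cayley transform, and commuting with it is
  the same as commuting with its inverse \<open>mat 1 - t *\<^sub>R A\<close>.\<close>

lemma commute_cayley_imp_commute:
  assumes t: "t \<in> cayley_domain A" "t \<noteq> 0" and x: "x ** cayley A t = cayley A t ** x"
  shows "x ** A = A ** x"
proof -
  define R where "R = resolvent A t"
  define L where "L = mat 1 - t *\<^sub>R A"
  have LR: "L ** R = mat 1" "R ** L = mat 1" using resolvent[OF t(1)] by (simp_all add: L_def R_def)
  have "2 *\<^sub>R (x ** R) = 2 *\<^sub>R (R ** x)"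
    using x by (simp only: cayley_def R_def[symmetric] matrix_mult.diff_left matrix_mult.diff_right
        matrix_mult.scaleR_left matrix_mult.scaleR_right matrix_mul_lid matrix_mul_rid diff_left_imp_eq
        diff_add_cancel) (metis diff_add_cancel)
  then have xR: "x ** R = R ** x" by (simp only: scaleR_cancel_left) simp
  have "L ** x = L ** (x ** R) ** L" by (simp add: matrix_mul_assoc[symmetric] LR)
  also have "\<dots> = x ** L" by (simp add: xR matrix_mul_assoc LR)
  finally have "t *\<^sub>R (A ** x) = t *\<^sub>R (x ** A)"
    by (simp add: L_def matrix_mult.diff_left matrix_mult.diff_right matrix_mult.scaleR_left
        matrix_mult.scaleR_right)
  then show ?thesis using t(2) by auto
qed

text \<open>Commutativity would pass to the Lie algebra, in one factor and then in the other, but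
  for three distinct axes the bracket of u \<and> v and u \<and> w is a nonzero multiple of v \<and>
  w. Three axes exist because n + 1 >= 3.\<close>

lemma SO_Q_not_commutative:
  "\<exists>x\<in>SO_Q. \<exists>y\<in>SO_Q. x ** y \<noteq> y ** (x :: real^('d::finite option option)^('d option option))"
proof (rule ccontr)
  assume "\<not> ?thesis"
  then have comm: "x ** y = y ** x" if "x \<in> SO_Q" "y \<in> SO_Q"
    for x y :: "real^('d option option)^('d option option)" using that by blast
  have ex: "\<exists>t. t \<in> cayley_domain A \<and> t \<noteq> 0" for A :: "real^('d option option)^('d option option)"
  proof -
    obtain \<epsilon> where "\<epsilon> > 0" "ball 0 \<epsilon> \<subseteq> cayley_domain A"
      using open_cayley_domain zero_in_cayley_domain openE by blast
    then show ?thesis by (intro exI[of _ "\<epsilon> / 2"]) (auto simp: subset_iff)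
  qed
  have 1: "x ** A = A ** x" if "x \<in> SO_Q" "A \<in> so_Q" for x A :: "real^('d option option)^('d option option)"
    using ex[of A] comm cayley_in_SO_Q that commute_cayley_imp_commute by blast
  have so: "B ** A = A ** B" if "B \<in> so_Q" "A \<in> so_Q" for A B :: "real^('d option option)^('d option option)"
  proof -
    obtain t where t: "t \<in> cayley_domain B" "t \<noteq> 0" using ex by blast
    have "A ** cayley B t = cayley B t ** A" using 1[OF cayley_in_SO_Q[OF that(1) t(1)] that(2)] by simp
    then show ?thesis using commute_cayley_imp_commute[OF t] by simp
  qed
  have axis: "axis i (1::real) $ j = (if i = j then 1 else 0)" for i j :: "'d option option"
    by (simp add: axis_def)
  define u v w :: "real^('d option option)"
    where "u = axis None 1" and "v = axis (Some None) 1" and "w = axis (Some (Some undefined)) 1"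
  have "wedge (wedge u v *v u) w + wedge u (wedge u v *v w) = 0"
    using bracket_wedge[OF wedge_in_so_Q, of u v u w] so[OF wedge_in_so_Q wedge_in_so_Q, of u v u w] by simp
  moreover have "wedge u v *v u = - v" "wedge u v *v w = 0"
    by (simp_all add: wedge_mult_vec u_def v_def w_def bform_axis axis)
  ultimately have "wedge v w = 0" by (simp add: wedge_simps(1,3-12))
  then have "wedge v w $ Some (Some undefined) $ Some None = 0" by simp
  then show False by (simp add: wedge_def v_def w_def axis)
qed

text \<open>Commuting with a fixed \<open>y\<close> is a polynomial condition, so it extends to the
  closure in one variable and then in the other.\<close>

lemma zariski_dense_semigroup_not_commutative:
  fixes G :: "(real^('d::finite option option)^('d option option)) set"
  assumes G: "SO_Q \<subseteq> zariski_closure G" and comm: "\<And>x y. x \<in> G \<Longrightarrow> y \<in> G \<Longrightarrow> x ** y = y ** x"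
  shows False
proof -
  have poly: "(\<lambda>x. (x ** y - y ** x) $ i $ j) \<in> mpolys" for y :: "real^('d option option)^('d option option)" and i j
    unfolding vector_minus_component by (intro mpolys_minus mpolys_mat_mult mpolys_entry mpolys_const)
  have extend: "x ** y = y ** x" if "x \<in> SO_Q" "\<And>x. x \<in> G \<Longrightarrow> x ** y = y ** x" for x y
  proof -
    have *: "(\<lambda>x. (x ** y - y ** x) $ i $ j) \<in> vanishing G" for i j
      using poly by (rule vanishingI) (simp add: that(2))
    have "\<forall>f\<in>vanishing G. f x = 0"
      using that(1) G by (auto simp: zariski_closure_def)
    from bspec[OF this *] have "x ** y - y ** x = 0" by (simp add: vec_eq_iff)
    then show ?thesis by simp
  qed
  have "x ** y = y ** x" if "x \<in> SO_Q" "y \<in> SO_Q"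
    for x y :: "real^('d option option)^('d option option)"
    using extend[OF that(1)] extend[OF that(2)] comm by metis
  then show False using SO_Q_not_commutative by blast
qed

lemma semigroup_gen_commute:
  fixes x y :: "'a::field^'n^'n"
  assumes comm: "\<And>x y. x \<in> S \<Longrightarrow> y \<in> S \<Longrightarrow> x ** y = y ** x"
    and x: "x \<in> semigroup_gen S" and y: "y \<in> semigroup_gen S"
  shows "x ** y = y ** x"
proof -
  have 1: "x ** y = y ** x" if "y \<in> S" "x \<in> semigroup_gen S" for x y
    using that(2)
  proof induction
    case (prod A B)
    have "A ** B ** y = A ** (B ** y)" by (simp only: matrix_mul_assoc)
    also have "\<dots> = A ** y ** B" by (simp only: prod matrix_mul_assoc)
    also have "\<dots> = y ** (A ** B)" by (simp only: prod matrix_mul_assoc)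
    finally show ?case .
  qed (use that comm in blast)
  show ?thesis
    using y
  proof induction
    case (prod A B)
    have "x ** (A ** B) = A ** x ** B" by (simp only: prod matrix_mul_assoc)
    also have "\<dots> = A ** (x ** B)" by (simp only: matrix_mul_assoc)
    also have "\<dots> = (A ** B) ** x" by (simp only: prod matrix_mul_assoc)
    finally show ?case .
  qed (use x 1 in blast)
qed

section \<open>Isotropic lines as boundary points, and ping-pong on them\<close>

lemma bform_self:
  "bform v v = (v $ Some None)\<^sup>2 + (\<Sum>i\<in>UNIV. (v $ Some (Some i))\<^sup>2) - (v $ None)\<^sup>2"
  for v :: "real^('d::finite option option)"
  by (simp add: Q_eq_bform[symmetric] Q_def UNIV_option_conv[where 'a='d] sum.reindex)

lemma norm_square_sum: "(norm x)\<^sup>2 = (\<Sum>i\<in>UNIV. (x $ i)\<^sup>2)" for x :: "real^'d"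
  by (simp add: norm_vec_def L2_set_def sum_nonneg)

lemma boundary_vec_simps:
  "boundary_vec (Some x) $ None = (norm x)\<^sup>2 + 1"
  "boundary_vec (Some x) $ Some None = (norm x)\<^sup>2 - 1"
  "boundary_vec (Some x) $ Some (Some i) = 2 * x $ i"
  "boundary_vec None $ None = 1" "boundary_vec None $ Some None = 1" "boundary_vec None $ Some (Some i) = 0"
  by (simp_all add: half_space_vec_def)

declare boundary_vec.simps [simp del]

lemma boundary_vec_isotropic: "bform (boundary_vec \<xi>) (boundary_vec \<xi>) = 0"
proof (cases \<xi>)
  case (Some x)
  have "(\<Sum>i\<in>UNIV. (2 * x $ i)\<^sup>2) = 4 * (norm x)\<^sup>2"
    by (simp add: norm_square_sum power_mult_distrib sum_distrib_left)
  then show ?thesis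
    by (simp add: Some bform_self boundary_vec_simps) (simp add: power2_eq_square algebra_simps)
qed (simp add: bform_self boundary_vec_simps)

lemma boundary_vec_nonzero: "boundary_vec \<xi> \<noteq> 0"
proof
  assume "boundary_vec \<xi> = 0"
  then have "boundary_vec \<xi> $ None = 0" by simp
  then show False
    by (cases \<xi>) (simp_all add: boundary_vec_simps add_nonneg_eq_0_iff)
qed

text \<open>Stereographic projection: \<open>a = b\<close> is the line of infinity, and otherwise
  dividing by \<open>a - b\<close> gives the point \<open>x\<close>. The scalar is
  \<open>(a - b) / 2\<close> because the corresponding difference for
  \<open>boundary_vec (Some x)\<close> is 2.\<close>

lemma isotropic_eq_boundary_vec:
  fixes v :: "real^('d::finite option option)"
  assumes v: "bform v v = 0" "v \<noteq> 0"
  shows "\<exists>\<xi> c. c \<noteq> 0 \<and> v = c *\<^sub>R boundary_vec \<xi>"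
proof -
  define a b where "a = v $ None" and "b = v $ Some None"
  have eqI: "v = x" if "a = x $ None" "b = x $ Some None" "\<And>i. v $ Some (Some i) = x $ Some (Some i)" for x
  proof -
    have "v $ i = x $ i" for i using that by (metis a_def b_def option.exhaust)
    then show ?thesis by (simp add: vec_eq_iff)
  qed
  have sum: "(\<Sum>i\<in>UNIV. (v $ Some (Some i))\<^sup>2) = a\<^sup>2 - b\<^sup>2"
    using v(1) by (simp add: bform_self a_def b_def)
  show ?thesis
  proof (cases "a = b")
    case True
    then have w: "v $ Some (Some i) = 0" for i
      using sum by (simp add: sum_nonneg_eq_0_iff)
    then have "v = a *\<^sub>R boundary_vec None"
      using True by (intro eqI) (simp_all add: boundary_vec_simps)
    then show ?thesis using v(2) by (intro exI[of _ None] exI[of _ a]) auto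
  next
    case False
    define x :: "real^'d" where "x = (\<chi> i. v $ Some (Some i) / (a - b))"
    have "(norm x)\<^sup>2 = (a\<^sup>2 - b\<^sup>2) / (a - b)\<^sup>2"
      by (simp add: norm_square_sum x_def power_divide sum flip: sum_divide_distrib)
    also have "\<dots> = (a + b) / (a - b)"
      using False by (simp add: power2_eq_square divide_simps) (simp add: algebra_simps)
    finally have n: "(norm x)\<^sup>2 = (a + b) / (a - b)" .
    have "v = ((a - b) / 2) *\<^sub>R boundary_vec (Some x)"
    proof (rule eqI)
      show "a = (((a - b) / 2) *\<^sub>R boundary_vec (Some x)) $ None"
        using False by (simp add: boundary_vec_simps n divide_simps)
      show "b = (((a - b) / 2) *\<^sub>R boundary_vec (Some x)) $ Some None"
        using False by (simp add: boundary_vec_simps n divide_simps)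
      show "v $ Some (Some i) = (((a - b) / 2) *\<^sub>R boundary_vec (Some x)) $ Some (Some i)" for i
        using False by (simp add: boundary_vec_simps x_def)
    qed
    then show ?thesis using False by (intro exI[of _ "Some x"] exI[of _ "(a - b) / 2"]) simp
  qed
qed

text \<open>The coordinates \<open>None\<close> and \<open>Some None\<close> differ by 2 for a
  finite point and by 0 for infinity; this separates the two kinds and, for finite points, fixes the
  scalar.\<close>

lemma boundary_vec_unique:
  assumes "c *\<^sub>R boundary_vec \<xi> = c' *\<^sub>R boundary_vec \<eta>" "c \<noteq> 0" "c' \<noteq> 0"
  shows "\<xi> = \<eta>"
proof -
  have comp: "c * boundary_vec \<xi> $ i = c' * boundary_vec \<eta> $ i" for i
    using arg_cong[OF assms(1), of "\<lambda>v. v $ i"] by simp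
  have diff: "boundary_vec \<zeta> $ None - boundary_vec \<zeta> $ Some None = (case \<zeta> of None \<Rightarrow> 0 | Some _ \<Rightarrow> 2)"
    for \<zeta> :: "(real^'a) option"
    by (cases \<zeta>) (simp_all add: boundary_vec_simps)
  have c: "c * (case \<xi> of None \<Rightarrow> 0 | Some _ \<Rightarrow> 2) = c' * (case \<eta> of None \<Rightarrow> 0 | Some _ \<Rightarrow> 2)"
    using comp[of None] comp[of "Some None"] by (simp add: diff[symmetric] right_diff_distrib)
  show ?thesis
  proof (cases \<xi>; cases \<eta>)
    fix x y assume xy: "\<xi> = Some x" "\<eta> = Some y"
    then have "c = c'" using c by simp
    then have "x $ i = y $ i" for i
      using comp[of "Some (Some i)"] assms(2) xy by (simp add: boundary_vec_simps)
    then show ?thesis using xy by (simp add: vec_eq_iff)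
  qed (use c assms in auto)
qed

lemma boundary_act_eqI:
  assumes "g *v boundary_vec \<xi> = c *\<^sub>R boundary_vec \<eta>" "c \<noteq> 0"
  shows "boundary_act g \<xi> = \<eta>"
  unfolding boundary_act_def
  by (rule the_equality) (use assms boundary_vec_unique in \<open>metis\<close>)+

lemma boundary_act_scalar:
  fixes g :: "real^('d::finite option option)^('d option option)"
  assumes "g \<in> SO_Q"
  shows "\<exists>c. c \<noteq> 0 \<and> g *v boundary_vec \<xi> = c *\<^sub>R boundary_vec (boundary_act g \<xi>)"
proof -
  have g: "form_adjoint g *v (g *v v) = v" for v
    by (simp add: matrix_vector_mul_assoc SO_Q_D[OF assms])
  have "bform (g *v boundary_vec \<xi>) (g *v boundary_vec \<xi>) = 0"
    by (simp add: bform_adjoint g boundary_vec_isotropic)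
  moreover have "g *v boundary_vec \<xi> \<noteq> 0"
    using g[of "boundary_vec \<xi>"] boundary_vec_nonzero[of \<xi>] by auto
  ultimately obtain c \<eta> where "c \<noteq> 0" "g *v boundary_vec \<xi> = c *\<^sub>R boundary_vec \<eta>"
    using isotropic_eq_boundary_vec by blast
  then show ?thesis using boundary_act_eqI by blast
qed

lemma boundary_act_mult:
  fixes g h :: "real^('d::finite option option)^('d option option)"
  assumes "g \<in> SO_Q" "h \<in> SO_Q"
  shows "boundary_act (g ** h) \<xi> = boundary_act g (boundary_act h \<xi>)"
proof -
  obtain c where c: "c \<noteq> 0" "h *v boundary_vec \<xi> = c *\<^sub>R boundary_vec (boundary_act h \<xi>)"
    using boundary_act_scalar[OF assms(2)] by blast
  obtain d where d: "d \<noteq> 0"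
    "g *v boundary_vec (boundary_act h \<xi>) = d *\<^sub>R boundary_vec (boundary_act g (boundary_act h \<xi>))"
    using boundary_act_scalar[OF assms(1)] by blast
  show ?thesis
    by (rule boundary_act_eqI[of _ _ "c * d"])
       (use c d in \<open>simp_all add: matrix_vector_mul_assoc[symmetric] matrix_vector_mult_scaleR\<close>)
qed

lemma boundary_act_one: "boundary_act (mat 1) \<xi> = \<xi>"
  by (rule boundary_act_eqI[of _ _ 1]) simp_all

text \<open>All positive powers of \<open>h\<close> send \<open>\<xi>\<close> into \<open>B\<close>,
  which does not contain it, so none of them is the identity.\<close>

lemma ping_pong_infinite_subgroup:
  fixes h :: "real^('d::finite option option)^('d option option)"
  assumes H: "subgroup H GL" and h: "h \<in> H" "h \<in> SO_Q"
    and maps: "boundary_act h ` A \<subseteq> B" "B \<subseteq> A" and \<xi>: "\<xi> \<in> A" "\<xi> \<notin> B"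
  shows "infinite H"
proof
  assume "finite H"
  have H': "mat 1 \<in> H" "\<And>x y. x \<in> H \<Longrightarrow> y \<in> H \<Longrightarrow> x ** y \<in> H" "\<And>x. x \<in> H \<Longrightarrow> invertible x"
    using H[unfolded subgroup_GL_iff] by blast+
  define P where "P k = ((**) h ^^ k) (mat 1)" for k
  have P0: "P 0 = mat 1" and P_Suc: "P (Suc k) = h ** P k" for k by (simp_all add: P_def)
  have P_H: "P k \<in> H" for k by (induction k) (auto simp: P0 P_Suc H' h)
  have P_SO: "P k \<in> SO_Q" for k
    using subgroup_SO_Q h unfolding subgroup_GL_iff by (induction k) (auto simp: P0 P_Suc)
  have P_add: "P (i + k) = P i ** P k" for i k
    by (induction i) (simp_all add: P0 P_Suc matrix_mul_assoc)
  have P_B: "boundary_act (P (Suc k)) \<xi> \<in> B" for k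
  proof (induction k)
    case 0
    then show ?case using maps \<xi> by (auto simp: P_Suc P0)
  next
    case (Suc k)
    then have "boundary_act h (boundary_act (P (Suc k)) \<xi>) \<in> B" using maps by blast
    then show ?case by (simp only: P_Suc[of "Suc k"] boundary_act_mult[OF h(2) P_SO])
  qed
  have "\<not> inj P"
    using \<open>finite H\<close> P_H by (metis finite_imageD finite_subset image_subsetI infinite_UNIV_nat)
  then obtain i j where ij: "i < j" "P i = P j"
    unfolding inj_def by (metis linorder_neqE_nat)
  define k where "k = j - i - 1"
  have "i + Suc k = j" using ij by (simp add: k_def)
  then have "P i ** P (Suc k) = P i ** mat 1"
    using ij(2) P_add[of i "Suc k"] by simp
  then have "matrix_inv (P i) ** (P i ** P (Suc k)) = matrix_inv (P i) ** (P i ** mat 1)" by simp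
  then have "P (Suc k) = mat 1"
    by (simp only: matrix_mul_assoc matrix_inv(2)[OF H'(3)[OF P_H]] matrix_mul_lid matrix_mul_rid)
  then have "boundary_act (P (Suc k)) \<xi> = \<xi>" by (simp add: boundary_act_one)
  then show False using P_B[of k] \<xi>(2) by simp
qed

section \<open>The Schottky generators\<close>

context schottky_setting
begin

lemma generator_in_SO_Q_0: "i \<in> {1..N\<^sub>0 + N\<^sub>1} \<Longrightarrow> g i \<in> SO_Q_0"
  using hyperbolic by (simp add: hyperbolic_element_def)

lemma generator_in_SO_Q: "i \<in> {1..N\<^sub>0 + N\<^sub>1} \<Longrightarrow> g i \<in> SO_Q"
  using generator_in_SO_Q_0[of i] connected_component_subset unfolding SO_Q_0_def by blast

text \<open>Otherwise all generators are \<open>g 1\<close> or its inverse, and the semigroup is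
  commutative, contrary to density. The bound supplies the second generator for ping-pong and the
  connecting letters for trajectories.\<close>

lemma two_le_N\<^sub>0: "2 \<le> N\<^sub>0"
proof (rule ccontr)
  assume "\<not> 2 \<le> N\<^sub>0"
  then have N0: "N\<^sub>0 = 1" using N\<^sub>0_pos by simp
  have g1: "g 1 \<in> SO_Q" using generator_in_SO_Q N0 by simp
  have inv: "invertible (g 1)"
    using g1 subgroup_SO_Q unfolding subgroup_GL_iff by blast
  have gens: "g i = g 1 \<or> g i = matrix_inv (g 1)" if "i \<in> {1..N\<^sub>0 + N\<^sub>1}" for i
  proof (cases "i = 1")
    case False
    then have "i = N\<^sub>0 + 1" "1 \<in> {1..N\<^sub>1}" using that N0 N\<^sub>1_le by auto
    then show ?thesis using inverses[of 1] N0 by simp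
  qed simp
  have "x ** y = y ** x" if "x \<in> g ` {1..N\<^sub>0 + N\<^sub>1}" "y \<in> g ` {1..N\<^sub>0 + N\<^sub>1}" for x y
  proof -
    have "x = g 1 \<or> x = matrix_inv (g 1)" "y = g 1 \<or> y = matrix_inv (g 1)"
      using that gens by blast+
    then show ?thesis using matrix_inv[OF inv] by auto
  qed
  then have "x ** y = y ** x"
    if "x \<in> semigroup_gen (g ` {1..N\<^sub>0 + N\<^sub>1})" "y \<in> semigroup_gen (g ` {1..N\<^sub>0 + N\<^sub>1})" for x y
    using semigroup_gen_commute that by blast
  then show False
    using zariski_dense_semigroup_not_commutative[OF SO_Q_subset_real_zariski_closure[OF dense]] by blast
qed

text \<open>Ping-pong from the exterior of \<open>D 2\<close> to the interior of \<open>D 1\<close>,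
  with infinity as base point: the inverse of \<open>g 2\<close> takes the exterior of
  \<open>D 2\<close> into \<open>D (2 + N\<^sub>0)\<close>, which avoids
  \<open>D (1 + N\<^sub>0)\<close>, so \<open>g 1\<close> sends it into the interior of
  \<open>D 1\<close>.\<close>

lemma infinite_return_trajectory_subgroup:
  "infinite (return_trajectory_subgroup (N\<^sub>0 + N\<^sub>1) (schottky_rel N\<^sub>0) g 1 1 1)"
proof (rule ping_pong_infinite_subgroup)
  let ?H = "return_trajectory_subgroup (N\<^sub>0 + N\<^sub>1) (schottky_rel N\<^sub>0) g 1 1 1"
  have inv: "invertible (g i)" if "i \<in> {1..N\<^sub>0 + N\<^sub>1}" for i
    using generator_in_SO_Q[OF that] subgroup_SO_Q unfolding subgroup_GL_iff by blast
  show "subgroup ?H GL" by (rule subgroup_return_trajectory_subgroup[OF inv])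
  \<comment> \<open>Both one-letter words are admissible, as the letters 1 and 2 are at distance at
    most 1 and \<open>N\<^sub>0\<close> is at least 2.\<close>
  have "[1] \<in> trajectories (N\<^sub>0 + N\<^sub>1) (schottky_rel N\<^sub>0) 1 1 1"
    "[2] \<in> trajectories (N\<^sub>0 + N\<^sub>1) (schottky_rel N\<^sub>0) 1 1 1"
    using two_le_N\<^sub>0 by (simp_all add: trajectories_def admissible_def schottky_rel_def)
  from word_quotient_in_subgroup[OF this, of g]
  show "g 1 ** matrix_inv (g 2) \<in> ?H" by (simp add: word_quotient_def)
  have 12: "1 \<in> {1..N\<^sub>0 + N\<^sub>1}" "2 \<in> {1..N\<^sub>0 + N\<^sub>1}" using two_le_N\<^sub>0 by auto
  have SO: "g 1 \<in> SO_Q" "g 2 \<in> SO_Q" "matrix_inv (g 2) \<in> SO_Q"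
    using generator_in_SO_Q[OF 12(1)] generator_in_SO_Q[OF 12(2)] subgroup_SO_Q
    unfolding subgroup_GL_iff by blast+
  then show "g 1 ** matrix_inv (g 2) \<in> SO_Q" by (intro SO_Q_mult)
  have disj: "D i \<inter> D j = {}" if "i \<in> {1..2 * N\<^sub>0}" "j \<in> {1..2 * N\<^sub>0}" "i \<noteq> j" for i j
    using balls_disjoint that by (auto simp: disjoint_family_on_def)
  have int_sub: "int_ball (D j) \<subseteq> Some ` D j" for j
    unfolding int_ball_def by (intro image_mono interior_subset)
  have sub_ext: "Some ` D i \<subseteq> ext_ball (D j)" if "i \<in> {1..2 * N\<^sub>0}" "j \<in> {1..2 * N\<^sub>0}" "i \<noteq> j" for i j
    using disj[OF that] by (auto simp: ext_ball_def)
  show "boundary_act (g 1 ** matrix_inv (g 2)) ` ext_ball (D 2) \<subseteq> int_ball (D 1)"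
  proof safe
    fix \<xi> assume \<xi>: "\<xi> \<in> ext_ball (D 2)"
    define \<eta> where "\<eta> = boundary_act (matrix_inv (g 2)) \<xi>"
    have "boundary_act (g 2) \<eta> = \<xi>"
      using boundary_act_mult[OF SO(2,3), of \<xi>] matrix_inv[OF inv[OF 12(2)]]
      by (simp add: \<eta>_def boundary_act_one)
    then have "\<eta> \<notin> ext_ball (D (2 + N\<^sub>0))"
      using ping_pong[of 2] two_le_N\<^sub>0 int_sub[of 2] \<xi> by (auto simp: ext_ball_def)
    then have "\<eta> \<in> Some ` D (2 + N\<^sub>0)" by (simp add: ext_ball_def)
    then have "\<eta> \<in> ext_ball (D (1 + N\<^sub>0))"
      using sub_ext[of "2 + N\<^sub>0" "1 + N\<^sub>0"] two_le_N\<^sub>0 by auto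
    then have "boundary_act (g 1) \<eta> \<in> int_ball (D 1)"
      using ping_pong[of 1] two_le_N\<^sub>0 by auto
    then show "boundary_act (g 1 ** matrix_inv (g 2)) \<xi> \<in> int_ball (D 1)"
      using boundary_act_mult[OF SO(1,3), of \<xi>] by (simp add: \<eta>_def)
  qed
  show "int_ball (D 1) \<subseteq> ext_ball (D 2)"
    using int_sub[of 1] sub_ext[of 1 2] two_le_N\<^sub>0 by auto
  show "None \<in> ext_ball (D 2)" "None \<notin> int_ball (D 1)"
    by (auto simp: ext_ball_def int_ball_def)
qed

theorem dense_return_trajectory_subgroups:
  assumes "y \<in> {1..N\<^sub>0 + N\<^sub>1}" "z \<in> {1..N\<^sub>0 + N\<^sub>1}"
  shows "\<exists>p\<^sub>0\<ge>1. \<forall>p>p\<^sub>0. zariski_dense_in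
    (complexify ` return_trajectory_subgroup (N\<^sub>0 + N\<^sub>1) (schottky_rel N\<^sub>0) g p y z) SO_Q"
proof (rule return_trajectory_subgroups_dense[OF generator_in_SO_Q_0 dense])
  show "schottky_rel N\<^sub>0 a a" for a using N\<^sub>0_pos by (simp add: schottky_rel_def)
  show "schottky_rel N\<^sub>0 b a" if "schottky_rel N\<^sub>0 a b" for a b
    using that by (simp add: schottky_rel_def abs_minus_commute)
  show "\<exists>c\<in>{1..N\<^sub>0 + N\<^sub>1}. schottky_rel N\<^sub>0 a c \<and> schottky_rel N\<^sub>0 c b"
    if "a \<in> {1..N\<^sub>0 + N\<^sub>1}" "b \<in> {1..N\<^sub>0 + N\<^sub>1}" for a b
  proof (cases "schottky_rel N\<^sub>0 a b")
    case True
    then show ?thesis using that(1) N\<^sub>0_pos by (intro bexI[of _ a]) (simp_all add: schottky_rel_def)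
  next
    case False
    \<comment> \<open>Here a and b differ by \<open>N\<^sub>0\<close>; the letter after the smaller
      one is at distances 1 and \<open>N\<^sub>0 - 1\<close> from them, neither equal to
      \<open>N\<^sub>0\<close>.\<close>
    have "min a b + 1 \<in> {1..N\<^sub>0 + N\<^sub>1}" "schottky_rel N\<^sub>0 a (min a b + 1)" "schottky_rel N\<^sub>0 (min a b + 1) b"
      using False that two_le_N\<^sub>0 by (auto simp: schottky_rel_def min_def)
    then show ?thesis by blast
  qed
  show "1 \<in> {1..N\<^sub>0 + N\<^sub>1}" "1 \<in> {1..N\<^sub>0 + N\<^sub>1}" using N\<^sub>0_pos by simp_all
  show "infinite (return_trajectory_subgroup (N\<^sub>0 + N\<^sub>1) (schottky_rel N\<^sub>0) g 1 1 1)"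
    by (rule infinite_return_trajectory_subgroup)
qed (use assms in auto)

end


section \<open>The continued fractions setting\<close>

text \<open>Restricted to the curve, an equation of \<open>H\<close> is a polynomial in one
  variable, and the multiples of \<open>d\<close> are infinitely many zeros of it.\<close>

lemma mpolys_vanish_on_curve:
  fixes M :: "complex \<Rightarrow> complex^'n^'n"
  assumes poly: "\<And>i j. \<exists>p. \<forall>t. M t $ i $ j = poly p t"
    and "d \<noteq> 0" and mem: "\<And>n. M (of_nat n * d) \<in> zariski_closure H"
  shows "M t \<in> zariski_closure H"
  unfolding zariski_closure_def
proof safe
  fix f assume f: "f \<in> vanishing H"
  obtain p where p: "\<forall>t. f (M t) = poly p t"
    using mpolys_polynomial_curve[OF vanishing_mpolys[OF f] poly] by blast
  have "inj (\<lambda>n. complex_of_nat n * d)" using \<open>d \<noteq> 0\<close> by (auto simp: inj_def)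
  then have "infinite (range (\<lambda>n. complex_of_nat n * d))" by (simp add: range_inj_infinite)
  moreover have "range (\<lambda>n. complex_of_nat n * d) \<subseteq> {t. poly p t = 0}"
    using mem f by (auto simp: zariski_closure_def p[rule_format, symmetric])
  ultimately have "infinite {t. poly p t = 0}" using infinite_super by blast
  then have "p = 0" using poly_roots_finite by blast
  then show "f (M t) = 0" using p by simp
qed

definition lower_unipotent :: "'a::comm_ring_1 \<Rightarrow> 'a^2^2" where
  "lower_unipotent t = vector [vector [1, 0], vector [t, 1]]"

definition upper_unipotent :: "'a::comm_ring_1 \<Rightarrow> 'a^2^2" where
  "upper_unipotent t = vector [vector [1, t], vector [0, 1]]"

lemmas matrix_2_simps = vec_eq_iff forall_2 matrix_matrix_mult_def sum_2 lower_unipotent_def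
  upper_unipotent_def mat_def

lemma lower_unipotent_add: "lower_unipotent s ** lower_unipotent t = lower_unipotent (s + t)"
  and upper_unipotent_add: "upper_unipotent s ** upper_unipotent t = upper_unipotent (s + t)"
  and lower_unipotent_zero: "lower_unipotent 0 = mat 1"
  and upper_unipotent_zero: "upper_unipotent 0 = mat 1"
  by (simp_all add: matrix_2_simps algebra_simps)

lemma det_unipotent [simp]: "det (lower_unipotent t) = 1" "det (upper_unipotent t) = 1"
  by (simp_all add: det_2 lower_unipotent_def upper_unipotent_def)

lemma cf_matrix_mult: "cf_matrix a ** cf_matrix b = lower_unipotent a ** upper_unipotent b"
  by (simp add: matrix_2_simps cf_matrix_def)

lemma matrix_inv_lower_upper:
  "matrix_inv (lower_unipotent a ** upper_unipotent b) = upper_unipotent (- b) ** lower_unipotent (- a :: 'a::field)"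
  by (rule matrix_inv_unique) (simp add: matrix_2_simps algebra_simps)

text \<open>A matrix with nonzero lower left entry factors as upper, lower, upper unipotent.
  Otherwise the upper left entry is nonzero, and multiplication by \<open>lower_unipotent 1\<close>
  copies it to the lower left.\<close>

lemma SL2_subset_unipotents:
  assumes mult: "\<And>x y. x \<in> X \<Longrightarrow> y \<in> X \<Longrightarrow> x ** y \<in> X"
    and lower: "\<And>t. lower_unipotent t \<in> X" and upper: "\<And>t. upper_unipotent t \<in> X"
  shows "SL2 \<subseteq> X"
proof
  have generic: "x \<in> X" if "det x = 1" "x $ 2 $ 1 \<noteq> 0" for x
  proof -
    have "x = upper_unipotent ((x $ 1 $ 1 - 1) / x $ 2 $ 1) **
        (lower_unipotent (x $ 2 $ 1) ** upper_unipotent ((x $ 2 $ 2 - 1) / x $ 2 $ 1))"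
      using that by (simp add: matrix_2_simps det_2 field_simps)
    then show ?thesis using mult lower upper by metis
  qed
  fix x assume x: "x \<in> SL2"
  then have det: "det x = 1" by (simp add: SL2_def)
  show "x \<in> X"
  proof (cases "x $ 2 $ 1 = 0")
    case True
    have "det (lower_unipotent 1 ** x) = 1"
      using det by (simp add: det_mul)
    moreover have "(lower_unipotent 1 ** x) $ 2 $ 1 \<noteq> 0"
      using det True by (auto simp: matrix_2_simps det_2)
    ultimately have "lower_unipotent 1 ** x \<in> X" by (rule generic)
    then have "lower_unipotent (-1) ** (lower_unipotent 1 ** x) \<in> X" by (rule mult[OF lower])
    then show ?thesis
      by (simp add: matrix_mul_assoc lower_unipotent_add lower_unipotent_zero)
  qed (use det generic in blast)
qed

lemma subgroup_SL2: "subgroup SL2 GL"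
  unfolding subgroup_GL_iff SL2_def
proof safe
  fix x :: "complex^2^2" assume x: "det x = 1"
  then show inv: "invertible x" by (simp add: invertible_det_nz)
  have "det x * det (matrix_inv x) = 1"
    using matrix_inv(1)[OF inv] by (metis det_I det_mul)
  then show "det (matrix_inv x) = 1" using x by simp
qed (simp_all add: det_mul)

lemma word_quotient_Cons_Cons:
  "word_quotient g (i # as) (j # bs) = g i ** word_quotient g as bs ** matrix_inv (g j)"
  by (simp add: word_quotient_def mat_prod_append matrix_mul_assoc)

lemma word_quotient_self:
  "(\<And>i. i \<in> set as \<Longrightarrow> invertible (g i)) \<Longrightarrow> word_quotient g as as = mat 1"
  by (induction as) (simp_all add: word_quotient_Cons_Cons matrix_inv, simp add: word_quotient_def)

context continued_fractions_setting
begin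

lemma generator: "i \<in> {1..N} \<Longrightarrow> g i = lower_unipotent (fst (e i)) ** upper_unipotent (snd (e i))"
  using generators by (simp add: cf_matrix_mult)

lemma generator_in_SL2: "i \<in> {1..N} \<Longrightarrow> g i \<in> SL2"
  by (simp add: generator SL2_def det_mul)

text \<open>If \<open>S\<close> had at most one element, all generators would be one symmetric
  matrix. Commuting products of symmetric matrices are symmetric, so the equation of symmetry would
  hold on the closure, but \<open>upper_unipotent 1\<close> violates it.\<close>

lemma two_elements: "\<exists>a\<in>S. \<exists>b\<in>S. a \<noteq> b"
proof (rule ccontr)
  assume "\<not> ?thesis"
  then have same: "a = b" if "a \<in> S" "b \<in> S" for a b using that by blast
  have e: "e i = (a, b) \<Longrightarrow> a \<in> S \<and> b \<in> S" if "i \<in> {1..N}" for i a b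
    using relabel that by (metis bij_betwE mem_Sigma_iff)
  have sym: "transpose (g i) = g i" if "i \<in> {1..N}" for i
  proof -
    have "fst (e i) = snd (e i)" using e[OF that, of "fst (e i)" "snd (e i)"] same by simp
    then show ?thesis
      by (simp add: generator[OF that] matrix_2_simps transpose_def)
  qed
  have eq: "g i = g j" if "i \<in> {1..N}" "j \<in> {1..N}" for i j
  proof -
    have "e i = e j"
      using e[OF that(1), of "fst (e i)" "snd (e i)"] e[OF that(2), of "fst (e j)" "snd (e j)"] same
      by (simp add: prod_eq_iff)
    then show ?thesis using generator that by simp
  qed
  have comm: "x ** y = y ** x" if "x \<in> semigroup_gen (g ` {1..N})" "y \<in> semigroup_gen (g ` {1..N})" for x y
  proof (rule semigroup_gen_commute[OF _ that])
    fix x y assume "x \<in> g ` {1..N}" "y \<in> g ` {1..N}"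
    then have "x = y" using eq by blast
    then show "x ** y = y ** x" by simp
  qed
  have "transpose x = x" if "x \<in> semigroup_gen (g ` {1..N})" for x
    using that
  proof induction
    case (gen x)
    then show ?case using sym by blast
  next
    case (prod x y)
    then show ?case using comm by (simp add: matrix_transpose_mul)
  qed
  then have "transpose x $ 2 $ 1 = x $ 2 $ 1" if "x \<in> semigroup_gen (g ` {1..N})" for x
    using that by simp
  then have vanish: "(\<lambda>x. x $ 1 $ 2 - x $ 2 $ 1) \<in> vanishing (semigroup_gen (g ` {1..N}))"
    by (intro vanishingI mpolys_minus mpolys_entry) (simp add: transpose_def)
  have "upper_unipotent 1 \<in> zariski_closure (semigroup_gen (g ` {1..N}))"
    using dense by (simp add: zariski_dense_in_iff SL2_def)
  then have "\<forall>f\<in>vanishing (semigroup_gen (g ` {1..N})). f (upper_unipotent 1) = 0"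
    by (simp add: zariski_closure_def)
  from bspec[OF this vanish] show False by (simp add: upper_unipotent_def)
qed

text \<open>With no admissibility condition, two words may share everything but their first letter,
  so every p >= 1 works.\<close>

theorem dense_return_trajectory_subgroups:
  assumes "y \<in> {1..N}" "z \<in> {1..N}" "p \<ge> 1"
  shows "zariski_dense_in (return_trajectory_subgroup N free_rel g p y z) SL2"
proof -
  define H where "H = return_trajectory_subgroup N free_rel g p y z"
  have inv: "invertible (g i)" if "i \<in> {1..N}" for i
    using generator_in_SL2[OF that] by (simp add: SL2_def invertible_det_nz)
  have "subgroup H GL" unfolding H_def by (rule subgroup_return_trajectory_subgroup[OF inv])
  then have H: "mat 1 \<in> H" "\<And>x y. x \<in> H \<Longrightarrow> y \<in> H \<Longrightarrow> x ** y \<in> H"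
    unfolding subgroup_GL_iff by blast+
  have quotient: "g i ** matrix_inv (g j) \<in> H" if "i \<in> {1..N}" "j \<in> {1..N}" for i j
  proof -
    \<comment> \<open>The common tail of letters \<open>y\<close> is an arbitrary choice; it cancels
      and leaves the quotient of the first letters.\<close>
    have traj: "k # replicate (p - 1) y \<in> trajectories N free_rel p y z" if "k \<in> {1..N}" for k
    proof -
      have "successively free_rel w" for w by (induction w) (auto simp: successively_Cons free_rel_def)
      then show ?thesis using that assms by (auto simp: trajectories_def admissible_def)
    qed
    have "word_quotient g (i # replicate (p - 1) y) (j # replicate (p - 1) y) \<in> H"
      unfolding H_def by (rule word_quotient_in_subgroup[OF traj[OF that(1)] traj[OF that(2)]])
    moreover have "word_quotient g (replicate (p - 1) y) (replicate (p - 1) y) = mat 1"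
      using inv assms by (intro word_quotient_self) auto
    ultimately show ?thesis by (simp add: word_quotient_Cons_Cons)
  qed
  \<comment> \<open>All pairs of parameters occur among the generators, so the four parameters are
    independent: \<open>c = d\<close> isolates a lower unipotent matrix, \<open>a = b\<close> an
    upper one up to conjugation.\<close>
  have letters: "lower_unipotent a ** upper_unipotent (c - d) ** lower_unipotent (- b) \<in> H"
    if "a \<in> S" "b \<in> S" "c \<in> S" "d \<in> S" for a b c d
  proof -
    have "(a, c) \<in> e ` {1..N}" "(b, d) \<in> e ` {1..N}"
      using relabel that by (simp_all only: bij_betw_def mem_Sigma_iff)
    then obtain i j where ij: "i \<in> {1..N}" "e i = (a, c)" "j \<in> {1..N}" "e j = (b, d)"
      by (metis imageE)
    have "g i ** matrix_inv (g j) = lower_unipotent a ** (upper_unipotent c ** upper_unipotent (- d)) ** lower_unipotent (- b)"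
      using ij by (simp add: generator matrix_inv_lower_upper matrix_mul_assoc)
    then show ?thesis using quotient[OF ij(1,3)] by (simp add: upper_unipotent_add)
  qed
  obtain a b where ab: "a \<in> S" "b \<in> S" "a \<noteq> b" using two_elements by blast
  define X where "X = zariski_closure H"
  have HX: "H \<subseteq> X" unfolding X_def by (rule zariski_closure_subset)
  have mult: "x ** y \<in> X" if "x \<in> X" "y \<in> X" for x y
    using H(2) that unfolding X_def by (rule zariski_closure_mult)
  have 1: "mat 1 \<in> X" using H(1) HX by blast
  have lower1: "lower_unipotent (a - b) \<in> X"
    using subsetD[OF HX letters[OF ab(1,2,1,1)]]
    by (simp add: upper_unipotent_zero lower_unipotent_add)
  have "lower_unipotent (of_nat n * (a - b)) \<in> X" for n
  proof (induction n)
    case (Suc n)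
    have "lower_unipotent (a - b) ** lower_unipotent (of_nat n * (a - b)) \<in> X"
      by (intro mult lower1 Suc.IH)
    moreover have "a - b + of_nat n * (a - b) = of_nat (Suc n) * (a - b)"
      by (simp add: algebra_simps)
    ultimately show ?case by (simp only: lower_unipotent_add)
  qed (simp add: lower_unipotent_zero 1)
  then have lower: "lower_unipotent t \<in> X" for t
    unfolding X_def
  proof (rule mpolys_vanish_on_curve[rotated 2])
    show "\<exists>p. \<forall>t. lower_unipotent t $ i $ j = poly p t" for i j :: 2
      using exhaust_2[of i] exhaust_2[of j]
      by (auto simp: lower_unipotent_def intro: exI[of _ "[:1:]"] exI[of _ "[:0:]"] exI[of _ "[:0, 1:]"])
    show "a - b \<noteq> 0" using ab by simp
  qed
  \<comment> \<open>Lower unipotent matrices are already in \<open>X\<close>, so conjugation by one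
    of them strips the outer factors.\<close>
  have "lower_unipotent (- a) ** (lower_unipotent a ** upper_unipotent (a - b) ** lower_unipotent (- a)) ** lower_unipotent a \<in> X"
    by (rule mult[OF mult[OF lower subsetD[OF HX letters[OF ab(1,1,1,2)]]] lower])
  also have "lower_unipotent (- a) ** (lower_unipotent a ** upper_unipotent (a - b) ** lower_unipotent (- a)) ** lower_unipotent a
     = (lower_unipotent (- a) ** lower_unipotent a) ** upper_unipotent (a - b) ** (lower_unipotent (- a) ** lower_unipotent a)"
    by (simp only: matrix_mul_assoc)
  finally have upper1: "upper_unipotent (a - b) \<in> X"
    by (simp add: lower_unipotent_add lower_unipotent_zero)
  have "upper_unipotent (of_nat n * (a - b)) \<in> X" for n
  proof (induction n)
    case (Suc n)
    have "upper_unipotent (a - b) ** upper_unipotent (of_nat n * (a - b)) \<in> X"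
      by (intro mult upper1 Suc.IH)
    moreover have "a - b + of_nat n * (a - b) = of_nat (Suc n) * (a - b)"
      by (simp add: algebra_simps)
    ultimately show ?case by (simp only: upper_unipotent_add)
  qed (simp add: upper_unipotent_zero 1)
  then have upper: "upper_unipotent t \<in> X" for t
    unfolding X_def
  proof (rule mpolys_vanish_on_curve[rotated 2])
    show "\<exists>p. \<forall>t. upper_unipotent t $ i $ j = poly p t" for i j :: 2
      using exhaust_2[of i] exhaust_2[of j]
      by (auto simp: upper_unipotent_def intro: exI[of _ "[:1:]"] exI[of _ "[:0:]"] exI[of _ "[:0, 1:]"])
    show "a - b \<noteq> 0" using ab by simp
  qed
  have "H \<subseteq> SL2"
    unfolding H_def by (rule return_trajectory_subgroup_subset[OF subgroup_SL2 generator_in_SL2])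
  moreover have SL2: "SL2 \<subseteq> X" by (rule SL2_subset_unipotents[OF mult lower upper])
  moreover have "semigroup_gen (g ` {1..N}) \<subseteq> SL2"
    using dense by (simp add: zariski_dense_in_def)
  ultimately have "zariski_dense_in H SL2"
    unfolding X_def by (intro zariski_dense_in_trans[OF dense]) blast+
  then show ?thesis by (simp add: H_def)
qed

end


theorem theorem7p2:
  fixes N\<^sub>0 N\<^sub>1 :: nat
    and D :: "nat \<Rightarrow> (real^'d::finite) set"
    and gS :: "nat \<Rightarrow> real^('d option option)^('d option option)"
    and Gt :: "(complex^'m::finite^'m) set"
    and \<pi> :: "complex^'m^'m \<Rightarrow> complex^('d option option)^('d option option)"
    and gt :: "nat \<Rightarrow> complex^'m^'m"
    and S :: "complex set"
    and N :: nat
    and e :: "nat \<Rightarrow> complex \<times> complex"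
    and gC :: "nat \<Rightarrow> complex^2^2"
  shows "(schottky_setting N\<^sub>0 N\<^sub>1 D gS Gt \<pi> gt \<longrightarrow>
           (\<forall>y\<in>{1..N\<^sub>0 + N\<^sub>1}. \<forall>z\<in>{1..N\<^sub>0 + N\<^sub>1}. \<exists>p\<^sub>0\<ge>1. \<forall>p>p\<^sub>0.
              zariski_dense_in
                (complexify `
                  return_trajectory_subgroup (N\<^sub>0 + N\<^sub>1) (schottky_rel N\<^sub>0) gS p y z)
                SO_Q))
       \<and> (continued_fractions_setting S N e gC \<longrightarrow>
           (\<forall>y\<in>{1..N}. \<forall>z\<in>{1..N}. \<exists>p\<^sub>0\<ge>1. \<forall>p>p\<^sub>0.
              zariski_dense_in (return_trajectory_subgroup N free_rel gC p y z) SL2))"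
proof (intro conjI impI ballI)
  fix y z
  assume "schottky_setting N\<^sub>0 N\<^sub>1 D gS Gt \<pi> gt" "y \<in> {1..N\<^sub>0 + N\<^sub>1}" "z \<in> {1..N\<^sub>0 + N\<^sub>1}"
  then show "\<exists>p\<^sub>0\<ge>1. \<forall>p>p\<^sub>0. zariski_dense_in (complexify `
      return_trajectory_subgroup (N\<^sub>0 + N\<^sub>1) (schottky_rel N\<^sub>0) gS p y z) SO_Q"
    by (rule schottky_setting.dense_return_trajectory_subgroups)
next
  fix y z
  assume cf: "continued_fractions_setting S N e gC" "y \<in> {1..N}" "z \<in> {1..N}"
  show "\<exists>p\<^sub>0\<ge>1. \<forall>p>p\<^sub>0. zariski_dense_in (return_trajectory_subgroup N free_rel gC p y z) SL2"
    using continued_fractions_setting.dense_return_trajectory_subgroups[OF cf]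
    by (intro exI[of _ 1]) simp
qed

end
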